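(* Let $\delta>0$ and let $f^*\in C^0$ be the unique fixed point of $\mathcal G$ in $B(f^*,\delta)$. Assume: [K1] for $i=1,2$, $\sup_{y\in[-1,1]}\int_{-1}^1|k_i(x,y)|\,dx<\infty$ and $\lim_{y\to\tilde y}\int_{-1}^1|k_i(x,y)-k_i(x,\tilde y)|\,dx=0$ for every $\tilde y\in[-1,1]$; [H1] $h:[-1,1]\times\mathbb R\to\mathbb R$ is continuous; [G1] $g$ is continuous on $[-1,1]$; [H2], [H3] in the ball $B(f^*,\delta)$: $h_v=\partial h/\partial v$ and $h_{vv}=\partial^2h/\partial v^2$ exist and are continuous for $x\in[-1,1]$ and $|v-f^*(x)|\le\delta$; and that $1$ is not an eigenvalue of $\mathcal G'(f^* )$. In addition, assume that for some integer $r\ge1$ $$\sup_{x\in[-1,1]}\|k_i(x,\cdot)\|_{W^r}<\infty,\qquad \sup_{y\in[-1,1]}\|k_i(\cdot,y)\|_{W^r}<\infty,\qquad i=1,2,$$ $$g\in W^r,\qquad h\in\mathbf W^r(\Omega),$$ where $\Omega\subseteq(-1,1)\times\mathbb R$ is an open subset of $\mathbb R^2$ with $(x,f^*(x))\in\Omega$ for all $x\in(-1,1)$. Then there exist $\epsilon$ with $0<\epsilon\le\delta$ and $m_0\in\mathbb N$ such that for every $m\ge m_0$ the operator $\mathcal G_m$ has a unique fixed point $f_m$ in $B(f^*,\epsilon)$, and $$\|f^*-f_m\|_\infty=\mathcal O\left(\frac1{m^r}\right)\qquad(m\to\infty).$$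
   Context: $C^0=C^0([-1,1])$ is the Banach space of real continuous functions on $[-1,1]$ with the maximum norm $\|\cdot\|_\infty$, and $B(f^*,\delta)=\{f\in C^0:\|f-f^*\|_\infty\le\delta\}$. For an integer $r\ge1$ and $\varphi(x)=\sqrt{1-x^2}$, $$W^r=\{f\in C^0: f^{(r-1)}\in AC((-1,1)),\ \|f^{(r)}\varphi^r\|_\infty<\infty\},\qquad \|f\|_{W^r}=\|f\|_\infty+\|f^{(r)}\varphi^r\|_\infty,$$ where $AC((-1,1))$ is the set of absolutely continuous functions on $(-1,1)$. For $\Omega\subseteq\mathbb R^2$ open, $\mathbf W^r(\Omega)$ is the set of functions $F:\Omega\to\mathbb R$ such that for every pair of nonnegative integers $\ell=(\ell_1,\ell_2)$ with $|\ell|=\ell_1+\ell_2\le r$ the mixed partial derivative $D^\ell F=\partial^{\ell_1+\ell_2}F/\partial x_1^{\ell_1}\partial x_2^{\ell_2}$ exists and $\|D^\ell F\|_\infty<\infty$ (sup norm on $\Omega$). The kernels $k_1,k_2$ are continuous on $[-1,1]^2$ (standing assumption). For $y\in[-1,1]$, $$(\mathcal Gf)(y)=\int_{-1}^1k_1(x,y)f(x)\,dx+\int_{-1}^1k_2(x,y)h(x,f(x))\,dx+g(y),$$ $$[(\mathcal G'f)\phi](y)=\int_{-1}^1k_1(x,y)\phi(x)\,dx+\int_{-1}^1k_2(x,y)h_v(x,f(x))\phi(x)\,dx,\qquad\phi\in C^0,$$ where $\mathcal G'f$ (also written $\mathcal G'(f)$) is the Fréchet derivative of $\mathcal G$ at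 $f$, and $$(\mathcal G_mf)(y)=\sum_{k=1}^m\lambda_kk_1(x_k,y)f(x_k)+\sum_{k=1}^m\lambda_kk_2(x_k,y)h(x_k,f(x_k))+g(y),$$ where $x_k$ and $\lambda_k$, $k=1,\dots,m$, are the nodes (zeros of the Legendre polynomial of degree $m$) and weights (Christoffel numbers) of the $m$-point Gauss–Legendre rule on $[-1,1]$. *)

theory Defs
  imports
    "HOL-Probability.Essential_Supremum"
    "HOL-Computational_Algebra.Polynomial"
    "HOL-Library.Landau_Symbols"
begin

text \<open>
  Elements of C^0([-1,1]) are represented by functions on the reals that are continuous on
  [-1,1]; their values outside [-1,1] are never used, and two of them are the same element iff
  they agree on [-1,1].
\<close>

definition C0 :: "(real \<Rightarrow> real) set" where
  "C0 = {f. continuous_on {-1..1} f}"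

definition eq_C0 :: "(real \<Rightarrow> real) \<Rightarrow> (real \<Rightarrow> real) \<Rightarrow> bool" where
  "eq_C0 f g \<longleftrightarrow> (\<forall>x\<in>{-1..1}. f x = g x)"

definition max_norm :: "(real \<Rightarrow> real) \<Rightarrow> real" where
  "max_norm f = (SUP x\<in>{-1..1}. \<bar>f x\<bar>)"

definition C0_ball :: "(real \<Rightarrow> real) \<Rightarrow> real \<Rightarrow> (real \<Rightarrow> real) set" where
  "C0_ball f0 d = {f \<in> C0. max_norm (\<lambda>x. f x - f0 x) \<le> d}"

definition unique_fixed_point_in ::
    "((real \<Rightarrow> real) \<Rightarrow> real \<Rightarrow> real) \<Rightarrow> (real \<Rightarrow> real) \<Rightarrow> (real \<Rightarrow> real) set \<Rightarrow> bool" where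
  "unique_fixed_point_in T f B \<longleftrightarrow>
     f \<in> B \<and> eq_C0 (T f) f \<and> (\<forall>f'\<in>B. eq_C0 (T f') f' \<longrightarrow> eq_C0 f' f)"

definition is_eigenvalue :: "((real \<Rightarrow> real) \<Rightarrow> real \<Rightarrow> real) \<Rightarrow> real \<Rightarrow> bool" where
  "is_eigenvalue T c \<longleftrightarrow>
     (\<exists>\<phi>\<in>C0. \<not> eq_C0 \<phi> (\<lambda>x. 0) \<and> eq_C0 (T \<phi>) (\<lambda>x. c * \<phi> x))"

definition absolutely_continuous_on :: "real set \<Rightarrow> (real \<Rightarrow> real) \<Rightarrow> bool" where
  "absolutely_continuous_on S f \<longleftrightarrow>
     (\<forall>e>0. \<exists>d>0. \<forall>P. finite P \<longrightarrow> (\<forall>(a, b)\<in>P. a < b \<and> {a..b} \<subseteq> S) \<longrightarrow>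
        disjoint_family_on (\<lambda>(a, b). {a<..<b}) P \<longrightarrow>
        (\<Sum>(a, b)\<in>P. b - a) < d \<longrightarrow> (\<Sum>(a, b)\<in>P. \<bar>f b - f a\<bar>) < e)"

definition weight :: "real \<Rightarrow> real" where
  "weight x = sqrt (1 - x\<^sup>2)"

text \<open>
  The r-th derivative of a function in W^r exists almost everywhere only, so the second summand
  of the norm is an essential supremum with respect to Lebesgue measure on (-1,1).
  The value of \<^const>\<open>deriv\<close> on the exceptional null set is irrelevant.
\<close>

definition weighted_deriv_norm :: "nat \<Rightarrow> (real \<Rightarrow> real) \<Rightarrow> ereal" where
  "weighted_deriv_norm r f =
     esssup (lebesgue_on {-1<..<1}) (\<lambda>x. ereal \<bar>(deriv ^^ r) f x * weight x ^ r\<bar>)"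

definition Wspace :: "nat \<Rightarrow> (real \<Rightarrow> real) set" where
  "Wspace r = {f \<in> C0.
     (\<forall>j<r - 1. \<forall>x\<in>{-1<..<1}. (deriv ^^ j) f field_differentiable at x) \<and>
     absolutely_continuous_on {-1<..<1} ((deriv ^^ (r - 1)) f) \<and>
     weighted_deriv_norm r f < \<infinity>}"

definition Wnorm :: "nat \<Rightarrow> (real \<Rightarrow> real) \<Rightarrow> ereal" where
  "Wnorm r f = ereal (max_norm f) + weighted_deriv_norm r f"

text \<open>Functions of two real variables are curried.\<close>

definition partial1 :: "(real \<Rightarrow> real \<Rightarrow> real) \<Rightarrow> real \<Rightarrow> real \<Rightarrow> real" where
  "partial1 F x v = deriv (\<lambda>s. F s v) x"

definition partial2 :: "(real \<Rightarrow> real \<Rightarrow> real) \<Rightarrow> real \<Rightarrow> real \<Rightarrow> real" where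
  "partial2 F x v = deriv (\<lambda>t. F x t) v"

definition mixed_partial :: "nat \<Rightarrow> nat \<Rightarrow> (real \<Rightarrow> real \<Rightarrow> real) \<Rightarrow> real \<Rightarrow> real \<Rightarrow> real" where
  "mixed_partial l1 l2 F = (partial1 ^^ l1) ((partial2 ^^ l2) F)"

definition mixed_partial_exists ::
    "(real \<times> real) set \<Rightarrow> nat \<Rightarrow> nat \<Rightarrow> (real \<Rightarrow> real \<Rightarrow> real) \<Rightarrow> bool" where
  "mixed_partial_exists \<Omega> l1 l2 F \<longleftrightarrow>
     (\<forall>j<l2. \<forall>(x, v)\<in>\<Omega>. (\<lambda>t. mixed_partial 0 j F x t) field_differentiable at v) \<and>
     (\<forall>i<l1. \<forall>(x, v)\<in>\<Omega>. (\<lambda>s. mixed_partial i l2 F s v) field_differentiable at x)"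

definition Wspace2 :: "nat \<Rightarrow> (real \<times> real) set \<Rightarrow> (real \<Rightarrow> real \<Rightarrow> real) set" where
  "Wspace2 r \<Omega> = {F. \<forall>l1 l2. l1 + l2 \<le> r \<longrightarrow>
     mixed_partial_exists \<Omega> l1 l2 F \<and>
     bdd_above ((\<lambda>(x, v). \<bar>mixed_partial l1 l2 F x v\<bar>) ` \<Omega>)}"

definition tube :: "(real \<Rightarrow> real) \<Rightarrow> real \<Rightarrow> (real \<times> real) set" where
  "tube f d = {(x, v). x \<in> {-1..1} \<and> \<bar>v - f x\<bar> \<le> d}"

definition cond_K1 :: "(real \<Rightarrow> real \<Rightarrow> real) \<Rightarrow> bool" where
  "cond_K1 k \<longleftrightarrow>
     bdd_above ((\<lambda>y. integral {-1..1} (\<lambda>x. \<bar>k x y\<bar>)) ` {-1..1}) \<and>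
     (\<forall>y'\<in>{-1..1}. ((\<lambda>y. integral {-1..1} (\<lambda>x. \<bar>k x y - k x y'\<bar>)) \<longlongrightarrow> 0)
        (at y' within {-1..1}))"

definition cond_H2 :: "(real \<Rightarrow> real \<Rightarrow> real) \<Rightarrow> (real \<Rightarrow> real) \<Rightarrow> real \<Rightarrow> bool" where
  "cond_H2 h f d \<longleftrightarrow>
     (\<forall>(x, v)\<in>tube f d. (\<lambda>t. h x t) field_differentiable at v) \<and>
     continuous_on (tube f d) (\<lambda>(x, v). partial2 h x v)"

text \<open>
  Since the first derivative in v is only known to exist on the tube, the second one is taken
  relative to the tube; this matters only at the two end points of each slice.
\<close>

definition cond_H3 :: "(real \<Rightarrow> real \<Rightarrow> real) \<Rightarrow> (real \<Rightarrow> real) \<Rightarrow> real \<Rightarrow> bool" where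
  "cond_H3 h f d \<longleftrightarrow>
     (\<exists>hvv. (\<forall>(x, v)\<in>tube f d.
          ((\<lambda>t. partial2 h x t) has_real_derivative hvv x v) (at v within {t. (x, t) \<in> tube f d})) \<and>
        continuous_on (tube f d) (\<lambda>(x, v). hvv x v))"

definition op_G :: "(real \<Rightarrow> real \<Rightarrow> real) \<Rightarrow> (real \<Rightarrow> real \<Rightarrow> real) \<Rightarrow> (real \<Rightarrow> real \<Rightarrow> real) \<Rightarrow>
    (real \<Rightarrow> real) \<Rightarrow> (real \<Rightarrow> real) \<Rightarrow> real \<Rightarrow> real" where
  "op_G k1 k2 h g f y =
     integral {-1..1} (\<lambda>x. k1 x y * f x) + integral {-1..1} (\<lambda>x. k2 x y * h x (f x)) + g y"

definition op_G_deriv :: "(real \<Rightarrow> real \<Rightarrow> real) \<Rightarrow> (real \<Rightarrow> real \<Rightarrow> real) \<Rightarrow> (real \<Rightarrow> real \<Rightarrow> real) \<Rightarrow>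
    (real \<Rightarrow> real) \<Rightarrow> (real \<Rightarrow> real) \<Rightarrow> real \<Rightarrow> real" where
  "op_G_deriv k1 k2 h f \<phi> y =
     integral {-1..1} (\<lambda>x. k1 x y * \<phi> x) +
     integral {-1..1} (\<lambda>x. k2 x y * partial2 h x (f x) * \<phi> x)"

text \<open>Legendre polynomials are given by Rodrigues' formula.\<close>

definition legendre_poly :: "nat \<Rightarrow> real poly" where
  "legendre_poly m = smult (1 / (2 ^ m * fact m)) ((pderiv ^^ m) ([:-1, 0, 1:] ^ m))"

definition gauss_nodes :: "nat \<Rightarrow> real set" where
  "gauss_nodes m = {t. poly (legendre_poly m) t = 0}"

text \<open>The Christoffel number of a node is the integral of its fundamental Lagrange polynomial.\<close>

definition gauss_weight :: "nat \<Rightarrow> real \<Rightarrow> real" where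
  "gauss_weight m t = integral {-1..1} (\<lambda>x. \<Prod>s\<in>gauss_nodes m - {t}. (x - s) / (t - s))"

definition op_Gm :: "(real \<Rightarrow> real \<Rightarrow> real) \<Rightarrow> (real \<Rightarrow> real \<Rightarrow> real) \<Rightarrow> (real \<Rightarrow> real \<Rightarrow> real) \<Rightarrow>
    (real \<Rightarrow> real) \<Rightarrow> nat \<Rightarrow> (real \<Rightarrow> real) \<Rightarrow> real \<Rightarrow> real" where
  "op_Gm k1 k2 h g m f y =
     (\<Sum>t\<in>gauss_nodes m. gauss_weight m t * k1 t y * f t) +
     (\<Sum>t\<in>gauss_nodes m. gauss_weight m t * k2 t y * h t (f t)) + g y"

end

theory Submission
  imports Defs "HOL-Analysis.Analysis" "HOL-Complex_Analysis.Great_Picard"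
begin

text \<open>
  Let K_m denote the Gauss discretization of the integral operator with the kernel k1(x,y) +
  k2(x,y) * h_v(x,f*(x)), that is, of the derivative of op_G at the fixed point f* (written
  fstar below), and G_m = op_Gm. The proof rests on consistency and stability. Consistency:
  the residual f* - G_m f* is O(m^(-r)), uniformly on [-1,1]. Stability: 1 - K_m is bounded
  below by a constant c > 0 that does not depend on m, for all large m. Given both, the
  simplified Newton map f \<mapsto> f - (1 - K_m)^(-1) (f - G_m f) is a contraction with
  factor 1/2 on a ball about f* whose radius does not depend on m, since h_v is uniformly
  continuous near the graph of f*. So G_m has exactly one fixed point f_m in the ball, and the
  distance from f* to f_m is at most 2/c times the residual (newton_fixed_point).

  Stability (nystrom_stability) is a compactness argument. The weights of the Gauss rule are
  nonnegative with sum 2, so that the images of the unit ball under all the K_m are uniformly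
  bounded and equicontinuous. If there were no constant c, the theorem of Arzela and Ascoli
  would yield a function of norm 1 that is an eigenfunction of the derivative of op_G for the
  eigenvalue 1. That 1 - K_m is onto follows from injectivity, as K_m has finite rank
  (finite_rank_surj).

  For consistency, the residual at y is the error of the Gauss rule for the integrand k1(x,y)
  * f*(x) + k2(x,y) * h(x,f*(x)). The rule with m nodes is exact up to degree 2m - 1 and has
  nonnegative weights, so its error is at most four times the error of the best polynomial
  approximation (gauss_error_le_approximation_error), and this is O(m^(-r)) for integrands of
  class W^r. The latter is a weighted Jackson theorem: after the substitution x = cos t a
  function is convolved with a power of the Dirichlet kernel (weighted_jackson), and Favard's
  induction raises the order (weighted_polynomial_approximation).

  The integrand has to be shown to be of class W^r with a bound that is uniform in y. Instead
  of W^r, the proof works with the class wsmooth, in which the almost everywhere bound of the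
  derivative of order r is replaced by a weighted Lipschitz condition on the derivative of
  order r - 1. This class makes no reference to derivatives that exist only almost everywhere,
  and it is stable under products (wsmooth_mult), under integration with respect to a
  parameter (wsmooth_integral) and under composition with a function of two variables whose
  mixed partial derivatives are bounded (composition_wsmooth). The fixed point equation
  represents f* by integrals of the kernels and g, which makes f* smooth; then h(x,f*(x)) is
  smooth, and so is the integrand.

  The passage from W^r to the class wsmooth (Wspace_wsmooth) has two ingredients. The
  essential bound of the derivative of order r has to be turned into a Lipschitz condition.
  For this an absolutely continuous function must be known to be the integral of its
  derivative, which is proved by way of the Jordan decomposition and the Radon--Nikodym
  theorem (ae_deriv_bound_imp_Lipschitz). The derivatives of intermediate order are not part
  of the norm of W^r; they are bounded by the two terms that are (derivative_chain_wsmooth).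
\<close>

section \<open>Absolutely continuous functions as indefinite integrals\<close>

abbreviation dyadic_increment :: "(real \<Rightarrow> real) \<Rightarrow> nat \<Rightarrow> nat \<Rightarrow> real" where
  "dyadic_increment u n k \<equiv> u (real (Suc k) / 2 ^ n) - u (real k / 2 ^ n)"

text \<open>
  Absolute continuity on the half line [0,\<infinity>), tested only on unions of dyadic cells
  of one and the same generation. This weak form is enough to exclude a singular part, and it
  passes at once from a function to its total variation, because the variation over a dyadic
  cell is a limit of sums over finer dyadic cells.
\<close>
definition dyadic_ac :: "(real \<Rightarrow> real) \<Rightarrow> bool" where
  "dyadic_ac F \<longleftrightarrow> (\<forall>e>0. \<exists>d>0. \<forall>m I. finite I \<longrightarrow> real (card I) / 2 ^ m < d \<longrightarrow>
     (\<Sum>k\<in>I. \<bar>dyadic_increment F m k\<bar>) \<le> e)"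

lemma absolutely_continuous_imp_dyadic_ac:
  assumes "absolutely_continuous_on UNIV u"
  shows "dyadic_ac u"
  unfolding dyadic_ac_def
proof (intro allI impI)
  fix e :: real assume "e > 0"
  then obtain d where d: "d > 0" and D: "\<And>P. finite P \<Longrightarrow> (\<forall>(a, b)\<in>P. a < b \<and> {a..b} \<subseteq> UNIV) \<Longrightarrow>
        disjoint_family_on (\<lambda>(a, b). {a<..<b}) P \<Longrightarrow>
        (\<Sum>(a, b)\<in>P. b - a) < d \<Longrightarrow> (\<Sum>(a, b)\<in>P. \<bar>u b - u a\<bar>) < e"
    using assms unfolding absolutely_continuous_on_def by blast
  have "(\<Sum>k\<in>I. \<bar>dyadic_increment u m k\<bar>) \<le> e"
    if fin: "finite I" and card: "real (card I) / 2 ^ m < d" for m and I :: "nat set"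
  proof -
    define c where "c = (\<lambda>k::nat. (real k / 2 ^ m, real (Suc k) / 2 ^ m))"
    have inj: "inj_on c I"
      by (auto simp: inj_on_def c_def)
    have "(\<Sum>(a, b)\<in>c ` I. \<bar>u b - u a\<bar>) < e"
    proof (rule D)
      show "finite (c ` I)" using fin by simp
      show "\<forall>(a, b)\<in>c ` I. a < b \<and> {a..b} \<subseteq> UNIV"
        by (auto simp: c_def divide_strict_right_mono)
      show "disjoint_family_on (\<lambda>(a, b). {a<..<b}) (c ` I)"
      proof -
        have "{real j / 2 ^ m<..<real (Suc j) / 2 ^ m} \<inter> {real k / 2 ^ m<..<real (Suc k) / 2 ^ m} = {}"
          if "j \<noteq> k" for j k
        proof -
          have "real (Suc j) \<le> real k \<or> real (Suc k) \<le> real j" using that by linarith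
          then have "real (Suc j) / 2^m \<le> real k / 2^m \<or> real (Suc k) / 2^m \<le> real j / 2^m"
            by (meson divide_right_mono zero_le_numeral zero_le_power)
          then show ?thesis by auto
        qed
        note cells = this
        have "(\<lambda>(a, b). {a<..<b}) (c i) \<inter> (\<lambda>(a, b). {a<..<b}) (c j) = {}" if "c i \<noteq> c j" for i j
        proof -
          have "i \<noteq> j" using that by auto
          from cells[OF this] show ?thesis by (simp only: c_def case_prod_conv)
        qed
        then show ?thesis unfolding disjoint_family_on_def
          by (intro ballI impI) (elim imageE, simp only:)
      qed
      have "(\<Sum>(a, b)\<in>c ` I. b - a) = (\<Sum>k\<in>I. 1 / 2 ^ m)"
        by (subst sum.reindex[OF inj]) (auto simp: c_def diff_divide_distrib[symmetric] intro!: sum.cong)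
      then show "(\<Sum>(a, b)\<in>c ` I. b - a) < d" using card by simp
    qed
    moreover have "(\<Sum>(a, b)\<in>c ` I. \<bar>u b - u a\<bar>) = (\<Sum>k\<in>I. \<bar>dyadic_increment u m k\<bar>)"
      by (subst sum.reindex[OF inj]) (auto simp: c_def)
    ultimately show ?thesis by simp
  qed
  then show "\<exists>d>0. \<forall>m I. finite I \<longrightarrow> real (card I) / 2 ^ m < d \<longrightarrow>
     (\<Sum>k\<in>I. \<bar>dyadic_increment u m k\<bar>) \<le> e" using d by blast
qed

lemma absolutely_continuous_imp_continuous:
  assumes "absolutely_continuous_on UNIV u"
  shows "continuous_on UNIV u"
proof -
  have "\<exists>d>0. \<forall>y. dist y x < d \<longrightarrow> dist (u y) (u x) < e" if "e > 0" for x e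
  proof -
    obtain d where d: "d > 0" and D: "\<And>P. finite P \<Longrightarrow> (\<forall>(a, b)\<in>P. a < b \<and> {a..b} \<subseteq> UNIV) \<Longrightarrow>
        disjoint_family_on (\<lambda>(a, b). {a<..<b}) P \<Longrightarrow>
        (\<Sum>(a, b)\<in>P. b - a) < d \<Longrightarrow> (\<Sum>(a, b)\<in>P. \<bar>u b - u a\<bar>) < e"
      using assms \<open>e > 0\<close> unfolding absolutely_continuous_on_def by blast
    have "dist (u y) (u x) < e" if "dist y x < d" for y
    proof (cases "x = y")
      case True
      then show ?thesis using \<open>e > 0\<close> by simp
    next
      case False
      have "(\<Sum>(a, b)\<in>{(min x y, max x y)}. \<bar>u b - u a\<bar>) < e"
        by (rule D) (use False that in \<open>auto simp: disjoint_family_on_def dist_real_def\<close>)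
      then show ?thesis by (cases "x \<le> y") (simp_all add: dist_real_def min_def max_def abs_minus_commute)
    qed
    then show ?thesis using d by blast
  qed
  then show ?thesis by (simp add: continuous_on_iff)
qed

lemma dyadic_floor_tendsto:
  "(\<lambda>n. real (nat \<lfloor>2 ^ n * x\<rfloor>) / 2 ^ n) \<longlonglongrightarrow> max x (0::real)"
proof (rule LIMSEQ_I)
  fix e :: real assume "e > 0"
  then obtain N where N: "(1/2::real) ^ N < e"
    using real_arch_pow_inv[of e "1/2"] by auto
  have "norm (real (nat \<lfloor>2 ^ n * x\<rfloor>) / 2 ^ n - max x 0) < e" if "n \<ge> N" for n
  proof -
    have e: "1 / 2 ^ n < e"
    proof -
      have "(1/2::real) ^ n \<le> (1/2) ^ N" using that by (intro power_decreasing) auto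
      with N show ?thesis by (simp add: power_one_over)
    qed
    show ?thesis
    proof (cases "x \<ge> 0")
      case True
      have *: "real (nat \<lfloor>2 ^ n * x\<rfloor>) = of_int \<lfloor>2 ^ n * x\<rfloor>"
        using True by (simp add: of_nat_nat)
      have "of_int \<lfloor>2 ^ n * x\<rfloor> \<le> 2 ^ n * x" "2 ^ n * x < of_int \<lfloor>2 ^ n * x\<rfloor> + 1" by linarith+
      then have "of_int \<lfloor>2 ^ n * x\<rfloor> / 2 ^ n \<le> x" "x < of_int \<lfloor>2 ^ n * x\<rfloor> / 2 ^ n + 1 / 2 ^ n"
        by (auto simp: field_simps)
      then show ?thesis using e True unfolding * by (simp add: abs_if)
    next
      case False
      then have "nat \<lfloor>2 ^ n * x\<rfloor> = 0"
      proof -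
        have "2 ^ n * x \<le> 0" using False by (simp add: mult_nonneg_nonpos)
        then show ?thesis by (simp add: floor_le_iff)
      qed
      then show ?thesis using \<open>e > 0\<close> False by simp
    qed
  qed
  then show "\<exists>no. \<forall>n\<ge>no. norm (real (nat \<lfloor>2 ^ n * x\<rfloor>) / 2 ^ n - max x 0) < e" by blast
qed

text \<open>
  The variation of u over the cells of order n that end at or before x. It is a step function
  of x, and its supremum over n is the total variation of a continuous u on [0,x].
\<close>
definition dyadic_var :: "(real \<Rightarrow> real) \<Rightarrow> nat \<Rightarrow> real \<Rightarrow> real" where
  "dyadic_var u n x = (\<Sum>k<nat \<lfloor>2 ^ n * x\<rfloor>. \<bar>dyadic_increment u n k\<bar>)"

lemma dyadic_var_diff:
  assumes "x \<le> y"
  shows "dyadic_var u n y - dyadic_var u n x =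
    (\<Sum>k\<in>{nat \<lfloor>2 ^ n * x\<rfloor>..<nat \<lfloor>2 ^ n * y\<rfloor>}. \<bar>dyadic_increment u n k\<bar>)"
proof -
  have le: "nat \<lfloor>2 ^ n * x\<rfloor> \<le> nat \<lfloor>2 ^ n * y\<rfloor>"
    using assms by (intro nat_mono floor_mono mult_left_mono) auto
  show ?thesis unfolding dyadic_var_def
    using sum_diff_nat_ivl[OF zero_le le, of "\<lambda>k. \<bar>dyadic_increment u n k\<bar>"]
    by (simp only: lessThan_atLeast0)
qed

lemma sum_double:
  "(\<Sum>k<2 * (n::nat). f k) = (\<Sum>k<n. f (2 * k) + f (Suc (2 * k)) :: real)"
  by (induction n) (auto simp: algebra_simps)

text \<open>
  Halving a cell can only increase the variation, by the triangle inequality.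
\<close>
lemma dyadic_var_Suc:
  "dyadic_var u n x \<le> dyadic_var u (Suc n) x"
proof -
  let ?m = "nat \<lfloor>2 ^ n * x\<rfloor>"
  have le: "2 * ?m \<le> nat \<lfloor>2 ^ Suc n * x\<rfloor>"
  proof -
    have "2 * \<lfloor>2 ^ n * x\<rfloor> \<le> \<lfloor>2 ^ Suc n * x\<rfloor>"
      by (simp add: le_floor_iff mult.assoc)
    then show ?thesis by linarith
  qed
  have "dyadic_var u n x \<le> (\<Sum>k<?m. \<bar>u (real (Suc (2*k)) / 2 ^ Suc n) - u (real (2*k) / 2 ^ Suc n)\<bar> +
     \<bar>u (real (Suc (Suc (2*k))) / 2 ^ Suc n) - u (real (Suc (2*k)) / 2 ^ Suc n)\<bar>)"
    unfolding dyadic_var_def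
  proof (rule sum_mono)
    fix k assume "k \<in> {..<?m}"
    have 1: "real (Suc (Suc (2*k))) / 2 ^ Suc n = real (Suc k) / 2 ^ n" by (simp add: field_simps)
    have 2: "real (2*k) / 2 ^ Suc n = real k / 2 ^ n" by (simp add: field_simps)
    show "\<bar>dyadic_increment u n k\<bar> \<le> \<bar>u (real (Suc (2*k)) / 2 ^ Suc n) - u (real (2*k) / 2 ^ Suc n)\<bar> +
     \<bar>u (real (Suc (Suc (2*k))) / 2 ^ Suc n) - u (real (Suc (2*k)) / 2 ^ Suc n)\<bar>"
      unfolding 1 2 by linarith
  qed
  also have "\<dots> = (\<Sum>k<2 * ?m. \<bar>u (real (Suc k) / 2 ^ Suc n) - u (real k / 2 ^ Suc n)\<bar>)"
    by (subst sum_double) simp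
  also have "\<dots> \<le> dyadic_var u (Suc n) x" unfolding dyadic_var_def
    by (rule sum_mono2) (use le in auto)
  finally show ?thesis .
qed

lemma dyadic_var_mono:
  assumes "x \<le> y"
  shows "dyadic_var u n x \<le> dyadic_var u n y"
proof -
  have "0 \<le> dyadic_var u n y - dyadic_var u n x"
    unfolding dyadic_var_diff[OF assms] by (intro sum_nonneg abs_ge_zero)
  then show ?thesis by linarith
qed

lemma nat_floor_dyadic:
  assumes "m \<le> n"
  shows "nat \<lfloor>2 ^ n * (real k / 2 ^ m)\<rfloor> = k * 2 ^ (n - m)"
proof -
  have "(2::real) ^ n * (real k / 2 ^ m) = real (k * 2 ^ (n - m))"
    using assms by (auto simp: le_iff_add power_add)
  then show ?thesis by (metis floor_of_nat nat_int)
qed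

text \<open>
  The cells of order n that are contained in the given cells of order m have the same total
  length. This is what carries the absolute continuity of u over to its variation.
\<close>
lemma dyadic_var_cells:
  assumes fin: "finite I" and "m \<le> n"
  obtains J where "finite J" "real (card J) / 2 ^ n = real (card I) / 2 ^ m"
    "(\<Sum>k\<in>I. dyadic_increment (dyadic_var u n) m k) =
     (\<Sum>k\<in>J. \<bar>dyadic_increment u n k\<bar>)"
proof -
  define A where "A k = {k * 2 ^ (n - m)..<Suc k * 2 ^ (n - m)}" for k :: nat
  have disj: "A i \<inter> A j = {}" if "i \<noteq> j" for i j
  proof -
    have "Suc i * 2 ^ (n - m) \<le> j * 2 ^ (n - m) \<or> Suc j * 2 ^ (n - m) \<le> i * 2 ^ (n - m)"
      using that by (metis Suc_leI mult_le_mono1 nat_neq_iff)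
    then show ?thesis by (auto simp: A_def)
  qed
  show ?thesis
  proof
    show "finite (\<Union>(A ` I))" using fin by (auto simp: A_def)
    have "card (\<Union>(A ` I)) = (\<Sum>k\<in>I. card (A k))"
      using fin disj by (subst card_UN_disjoint) (auto simp: A_def)
    also have "\<dots> = card I * 2 ^ (n - m)" by (simp add: A_def)
    finally show "real (card (\<Union>(A ` I))) / 2 ^ n = real (card I) / 2 ^ m"
      using \<open>m \<le> n\<close> by (auto simp: le_iff_add power_add)
    have "(\<Sum>k\<in>I. dyadic_increment (dyadic_var u n) m k) =
       (\<Sum>i\<in>I. \<Sum>k\<in>A i. \<bar>dyadic_increment u n k\<bar>)"
    proof (rule sum.cong)
      fix i assume "i \<in> I"
      have "real i / 2 ^ m \<le> real (Suc i) / 2 ^ m" by (simp add: divide_right_mono)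
      from dyadic_var_diff[OF this, of u n]
      show "dyadic_increment (dyadic_var u n) m i = 
        (\<Sum>k\<in>A i. \<bar>dyadic_increment u n k\<bar>)"
        by (simp only: nat_floor_dyadic[OF \<open>m \<le> n\<close>] A_def)
    qed simp
    also have "\<dots> = (\<Sum>k\<in>\<Union>(A ` I). \<bar>dyadic_increment u n k\<bar>)"
      using fin disj by (intro sum.UNION_disjoint[symmetric]) (auto simp: A_def)
    finally show "(\<Sum>k\<in>I. dyadic_increment (dyadic_var u n) m k) =
      (\<Sum>k\<in>\<Union>(A ` I). \<bar>dyadic_increment u n k\<bar>)" .
  qed
qed

text \<open>
  By absolute continuity, the variation over a sufficiently short dyadic interval is at most
  1, so on [0,x] it is at most the number of such intervals that are needed to cover [0,x].
\<close>
lemma dyadic_var_bounded: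
  assumes ac: "dyadic_ac u"
  obtains B where "\<And>n. dyadic_var u n x \<le> B"
proof -
  obtain d where d: "d > 0" and D: "\<And>m I. finite I \<Longrightarrow> real (card I) / 2 ^ m < d \<Longrightarrow>
     (\<Sum>k\<in>I. \<bar>dyadic_increment u m k\<bar>) \<le> 1"
    using ac[unfolded dyadic_ac_def, rule_format, OF zero_less_one] by blast
  obtain N where N: "(1/2::real) ^ N < d" using real_arch_pow_inv[of d "1/2"] d by auto
  have step: "dyadic_var u n (real j / 2 ^ N) \<le> real j" if nN: "n \<ge> N" for n j
  proof (induction j)
    case 0
    then show ?case by (simp add: dyadic_var_def)
  next
    case (Suc j)
    obtain J where J: "finite J" "real (card J) / 2 ^ n = real (card {j}) / 2 ^ N"
      "(\<Sum>k\<in>{j}. dyadic_var u n (real (Suc k) / 2 ^ N) - dyadic_var u n (real k / 2 ^ N)) =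
       (\<Sum>k\<in>J. \<bar>dyadic_increment u n k\<bar>)"
      using dyadic_var_cells[OF _ nN, of "{j}" u] by blast
    have "(\<Sum>k\<in>J. \<bar>dyadic_increment u n k\<bar>) \<le> 1"
      using J N by (intro D) (auto simp: power_one_over)
    then show ?case using J Suc by simp
  qed
  define j where "j = nat \<lceil>2 ^ N * x\<rceil>"
  have xj: "x \<le> real j / 2 ^ N"
  proof -
    have "2 ^ N * x \<le> real j" unfolding j_def by linarith
    then show ?thesis by (simp add: field_simps)
  qed
  have inc: "incseq (\<lambda>n. dyadic_var u n x)" by (intro incseq_SucI dyadic_var_Suc)
  have "dyadic_var u n x \<le> real j" for n
  proof -
    have "dyadic_var u n x \<le> dyadic_var u (max n N) x" using inc by (simp add: incseq_def)
    also have "\<dots> \<le> dyadic_var u (max n N) (real j / 2 ^ N)" by (rule dyadic_var_mono[OF xj])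
    also have "\<dots> \<le> real j" by (rule step) simp
    finally show ?thesis .
  qed
  then show ?thesis using that by blast
qed

text \<open>
  The Jordan decomposition: V is the total variation of u, so that V and V - u are both
  monotone. The dyadic sums of V are limits of dyadic sums of u over finer cells of the same
  total length, so V is again absolutely continuous.
\<close>
lemma dyadic_ac_decompose:
  assumes ac: "dyadic_ac u" and cont: "continuous_on UNIV u"
    and left: "\<And>x. x \<le> 0 \<Longrightarrow> u x = u 0"
  obtains V where "dyadic_ac V" "\<And>x y. x \<le> y \<Longrightarrow> \<bar>u y - u x\<bar> \<le> V y - V x"
    "\<forall>x\<le>0. V x = V 0"
proof -
  define V where "V x = (SUP n. dyadic_var u n x)" for x
  have lim: "(\<lambda>n. dyadic_var u n x) \<longlonglongrightarrow> V x" for x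
    unfolding V_def
  proof (rule LIMSEQ_incseq_SUP)
    obtain B where "\<And>n. dyadic_var u n x \<le> B" using dyadic_var_bounded[OF ac, of x] by blast
    then show "bdd_above (range (\<lambda>n. dyadic_var u n x))" unfolding bdd_above_def by blast
    show "incseq (\<lambda>n. dyadic_var u n x)" by (intro incseq_SucI dyadic_var_Suc)
  qed
  show ?thesis
  proof
    show "\<bar>u y - u x\<bar> \<le> V y - V x" if "x \<le> y" for x y
    proof (rule LIMSEQ_le)
      show "(\<lambda>n. dyadic_var u n y - dyadic_var u n x) \<longlonglongrightarrow> V y - V x" by (intro tendsto_diff lim)
      have "(\<lambda>n. u (real (nat \<lfloor>2 ^ n * z\<rfloor>) / 2 ^ n)) \<longlonglongrightarrow> u z" for z
      proof -
        have "u z = u (max z 0)" using left[of z] by (auto simp: max_def)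
        then show ?thesis
          using continuous_on_tendsto_compose[OF cont dyadic_floor_tendsto[of z]] by simp
      qed
      then show "(\<lambda>n. \<bar>u (real (nat \<lfloor>2 ^ n * y\<rfloor>) / 2 ^ n) - u (real (nat \<lfloor>2 ^ n * x\<rfloor>) / 2 ^ n)\<bar>) \<longlonglongrightarrow> \<bar>u y - u x\<bar>"
        by (intro tendsto_rabs tendsto_diff)
      have "\<bar>u (real (nat \<lfloor>2 ^ n * y\<rfloor>) / 2 ^ n) - u (real (nat \<lfloor>2 ^ n * x\<rfloor>) / 2 ^ n)\<bar> \<le> dyadic_var u n y - dyadic_var u n x" for n
      proof -
        have le: "nat \<lfloor>2 ^ n * x\<rfloor> \<le> nat \<lfloor>2 ^ n * y\<rfloor>"
          using that by (intro nat_mono floor_mono mult_left_mono) auto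
        have "u (real (nat \<lfloor>2 ^ n * y\<rfloor>) / 2 ^ n) - u (real (nat \<lfloor>2 ^ n * x\<rfloor>) / 2 ^ n) = 
          (\<Sum>k\<in>{nat \<lfloor>2 ^ n * x\<rfloor>..<nat \<lfloor>2 ^ n * y\<rfloor>}. dyadic_increment u n k)"
          using sum_Suc_diff'[OF le, of "\<lambda>k. u (real k / 2 ^ n)"] by simp
        then show ?thesis unfolding dyadic_var_diff[OF that] by (simp only: sum_abs)
      qed
      then show "\<exists>N. \<forall>n\<ge>N. \<bar>u (real (nat \<lfloor>2 ^ n * y\<rfloor>) / 2 ^ n) - u (real (nat \<lfloor>2 ^ n * x\<rfloor>) / 2 ^ n)\<bar> \<le> dyadic_var u n y - dyadic_var u n x"
        by blast
    qed
    show "\<forall>x\<le>0. V x = V 0"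
    proof (intro allI impI)
      fix x :: real assume that: "x \<le> 0"
      have "nat \<lfloor>2 ^ n * x\<rfloor> = 0" for n
      proof -
        have "2 ^ n * x \<le> 0" using that by (simp add: mult_nonneg_nonpos)
        then show ?thesis by (simp add: floor_le_iff)
      qed
      then show "V x = V 0" by (simp add: V_def dyadic_var_def)
    qed
    show "dyadic_ac V" unfolding dyadic_ac_def
    proof (intro allI impI)
      fix e :: real assume "e > 0"
      then obtain d where d: "d > 0" and D: "\<And>m I. finite I \<Longrightarrow> real (card I) / 2 ^ m < d \<Longrightarrow>
        (\<Sum>k\<in>I. \<bar>dyadic_increment u m k\<bar>) \<le> e"
        using ac[unfolded dyadic_ac_def, rule_format, of e] by blast
      have "(\<Sum>k\<in>I. \<bar>dyadic_increment V m k\<bar>) \<le> e"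
        if I: "finite I" "real (card I) / 2 ^ m < d" for m I
      proof (rule LIMSEQ_le_const2)
        show "(\<lambda>n. \<Sum>k\<in>I. \<bar>dyadic_increment (dyadic_var u n) m k\<bar>)
          \<longlonglongrightarrow> (\<Sum>k\<in>I. \<bar>dyadic_increment V m k\<bar>)"
          by (intro tendsto_sum tendsto_rabs tendsto_diff lim)
        have "(\<Sum>k\<in>I. \<bar>dyadic_increment (dyadic_var u n) m k\<bar>) \<le> e"
          if nm: "n \<ge> m" for n
        proof -
          obtain J where J: "finite J" "real (card J) / 2 ^ n = real (card I) / 2 ^ m"
            "(\<Sum>k\<in>I. dyadic_increment (dyadic_var u n) m k) =
             (\<Sum>k\<in>J. \<bar>dyadic_increment u n k\<bar>)"
            using dyadic_var_cells[OF I(1) nm, of u] by blast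
          have "(\<Sum>k\<in>J. \<bar>dyadic_increment u n k\<bar>) \<le> e"
            using J I by (intro D) auto
          moreover have "\<bar>dyadic_increment (dyadic_var u n) m k\<bar> = 
             dyadic_increment (dyadic_var u n) m k" for k
            using dyadic_var_mono[of "real k / 2 ^ m" "real (Suc k) / 2 ^ m" u n]
            by (simp add: divide_right_mono)
          ultimately show ?thesis using J(3) by simp
        qed
        then show "\<exists>N. \<forall>n\<ge>N. (\<Sum>k\<in>I. \<bar>dyadic_increment (dyadic_var u n) m k\<bar>) \<le> e"
          by blast
      qed
      then show "\<exists>d>0. \<forall>m I. finite I \<longrightarrow> real (card I) / 2 ^ m < d \<longrightarrow>
         (\<Sum>k\<in>I. \<bar>dyadic_increment V m k\<bar>) \<le> e" using d by blast
    qed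
  qed
qed

text \<open>
  Two points at distance less than 2^(-m) lie in a block of three adjacent cells of order m,
  and by monotonicity the increment between them is at most the sum over this block.
\<close>
lemma mono_dyadic_ac_continuous:
  assumes mono: "\<And>x y. x \<le> y \<Longrightarrow> F x \<le> F y" and left: "\<And>x. x \<le> 0 \<Longrightarrow> F x = F 0"
    and ac: "dyadic_ac F"
  shows "continuous_on UNIV F"
proof -
  have "\<exists>\<delta>>0. \<forall>y. dist y x < \<delta> \<longrightarrow> dist (F y) (F x) < e" if "e > 0" for x e
  proof -
    obtain d where d: "d > 0" and D: "\<And>m I. finite I \<Longrightarrow> real (card I) / 2 ^ m < d \<Longrightarrow>
       (\<Sum>k\<in>I. \<bar>dyadic_increment F m k\<bar>) \<le> e / 2"
      using ac[unfolded dyadic_ac_def, rule_format, OF half_gt_zero[OF \<open>e > 0\<close>]] by blast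
    obtain m where "(1/2::real) ^ m < d / 3" using real_arch_pow_inv[of "d / 3" "1/2"] d by auto
    then have m: "3 / 2 ^ m < d" by (simp add: power_one_over)
    have "dist (F y) (F x) < e" if xy: "dist y x < 1 / 2 ^ m" for y
    proof -
      have F0: "F z = F (max z 0)" for z using left[of z] by (cases "z \<le> 0") auto
      define k where "k = nat \<lfloor>2 ^ m * max x 0\<rfloor>"
      have k: "real k = of_int \<lfloor>2 ^ m * max x 0\<rfloor>" by (simp add: k_def)
      have k1: "real k \<le> 2 ^ m * max x 0" "2 ^ m * max x 0 < real k + 1"
        unfolding k by linarith+
      have close: "2 ^ m * max y 0 \<le> 2 ^ m * max x 0 + 1" "2 ^ m * max x 0 \<le> 2 ^ m * max y 0 + 1"
      proof -
        have "\<bar>max y 0 - max x 0\<bar> \<le> 1 / 2 ^ m" using xy by (simp add: dist_real_def)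
        then have "2 ^ m * \<bar>max y 0 - max x 0\<bar> \<le> 1" by (simp add: pos_le_divide_eq mult.commute)
        then have "\<bar>2 ^ m * max y 0 - 2 ^ m * max x 0\<bar> \<le> 1"
          by (simp add: abs_mult flip: right_diff_distrib)
        then show "2 ^ m * max y 0 \<le> 2 ^ m * max x 0 + 1" "2 ^ m * max x 0 \<le> 2 ^ m * max y 0 + 1"
          by linarith+
      qed
      have up: "max x 0 \<le> real (k + 2) / 2 ^ m" "max y 0 \<le> real (k + 2) / 2 ^ m"
      proof -
        have "2 ^ m * max x 0 \<le> real (k + 2)" "2 ^ m * max y 0 \<le> real (k + 2)"
          using k1 close by linarith+
        then show "max x 0 \<le> real (k + 2) / 2 ^ m" "max y 0 \<le> real (k + 2) / 2 ^ m"
          by (simp_all only: pos_le_divide_eq[of "2 ^ m"] zero_less_power zero_less_numeral mult.commute)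
      qed
      have low: "real (k - 1) / 2 ^ m \<le> max x 0" "real (k - 1) / 2 ^ m \<le> max y 0"
      proof -
        have "0 \<le> 2 ^ m * max y 0" by simp
        moreover note close(2)
        moreover have "real (k - 1) = max 0 (real k - 1)" by (cases k) auto
        ultimately have "real (k - 1) \<le> 2 ^ m * max x 0" "real (k - 1) \<le> 2 ^ m * max y 0"
          using k1 by linarith+
        then show "real (k - 1) / 2 ^ m \<le> max x 0" "real (k - 1) / 2 ^ m \<le> max y 0"
          by (simp_all only: pos_divide_le_eq[of "2 ^ m"] zero_less_power zero_less_numeral mult.commute)
      qed
      have "F (real (k + 2) / 2 ^ m) - F (real (k - 1) / 2 ^ m) = 
         (\<Sum>i\<in>{k - 1..<k + 2}. dyadic_increment F m i)"
        using sum_Suc_diff'[of "k - 1" "k + 2" "\<lambda>i. F (real i / 2 ^ m)"] by simp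
      also have "\<dots> \<le> (\<Sum>i\<in>{k - 1..<k + 2}. \<bar>dyadic_increment F m i\<bar>)"
        by (intro sum_mono) simp
      also have "\<dots> \<le> e / 2"
      proof (rule D)
        have "real (card {k - 1..<k + 2}) \<le> 3" by (cases k) auto
        then have "real (card {k - 1..<k + 2}) / 2 ^ m \<le> 3 / 2 ^ m" by (intro divide_right_mono) auto
        then show "real (card {k - 1..<k + 2}) / 2 ^ m < d" using m by linarith
      qed simp
      finally have "F (real (k + 2) / 2 ^ m) - F (real (k - 1) / 2 ^ m) \<le> e / 2" .
      moreover note mono[OF up(1)] mono[OF up(2)] mono[OF low(1)] mono[OF low(2)]
      ultimately have "\<bar>F (max y 0) - F (max x 0)\<bar> \<le> e / 2" by linarith
      then show ?thesis using \<open>e > 0\<close> F0[of x] F0[of y] by (simp add: dist_real_def)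
    qed
    then show ?thesis by (intro exI[of _ "1 / 2 ^ m"]) auto
  qed
  then show ?thesis by (simp add: continuous_on_iff)
qed

text \<open>
  Enclose a null set in an open set U of small measure. The cells of order m that are
  contained in U have small total length and therefore small Stieltjes measure, and every
  positive point of U belongs to one of these cells as soon as m is large.
\<close>
lemma dyadic_ac_null_sets:
  assumes mono: "\<And>x y. x \<le> y \<Longrightarrow> F x \<le> F y" and left: "\<And>x. x \<le> 0 \<Longrightarrow> F x = F 0"
    and ac: "dyadic_ac F"
  shows "absolutely_continuous lborel (interval_measure F)"
proof -
  let ?\<mu> = "interval_measure F"
  have cont: "continuous_on UNIV F" by (rule mono_dyadic_ac_continuous[OF mono left ac])
  then have rc: "continuous (at_right a) F" for a
    by (simp add: continuous_on_eq_continuous_at continuous_at_imp_continuous_within)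
  note em = emeasure_interval_measure_Ioc[OF _ mono rc]
  have neg: "emeasure ?\<mu> {..0} = 0"
  proof -
    have "{..0} = (\<Union>n::nat. {- real n<..0})"
      by (auto) (metis minus_less_iff reals_Archimedean2)
    moreover have "{- real n<..0} \<in> null_sets ?\<mu>" for n
      using em[of "- real n" 0] left[of "- real n"] by (auto simp: null_sets_def)
    ultimately have "{..0} \<in> null_sets ?\<mu>" by (metis null_sets_UN)
    then show ?thesis by auto
  qed
  have "N \<in> null_sets ?\<mu>" if N: "N \<in> null_sets lborel" for N
  proof -
    have Nb: "N \<in> sets borel" using N by (auto simp: null_sets_def)
    have small: "emeasure ?\<mu> (N \<inter> {0<..}) \<le> ennreal e" if epos: "e > 0" for e
    proof -
      obtain d where d: "d > 0" and D: "\<And>m I. finite I \<Longrightarrow> real (card I) / 2 ^ m < d \<Longrightarrow>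
         (\<Sum>k\<in>I. \<bar>dyadic_increment F m k\<bar>) \<le> e"
        using ac[unfolded dyadic_ac_def, rule_format, OF epos] by blast
      obtain U where U: "open U" "N \<subseteq> U" "emeasure lborel U < ennreal d"
      proof -
        have "N \<in> sets lebesgue" using Nb by auto
        then obtain U where U: "open U" "N \<subseteq> U" "U - N \<in> lmeasurable" "emeasure lebesgue (U - N) < ennreal d"
          using sets_lebesgue_outer_open[OF _ d] by metis
        have Ub: "U \<in> sets borel" using U(1) by auto
        have "emeasure lborel U \<le> emeasure lborel N + emeasure lborel (U - N)"
        proof -
          have "emeasure lborel (N \<union> (U - N)) \<le> emeasure lborel N + emeasure lborel (U - N)"
            using Nb Ub by (intro emeasure_subadditive) auto
          then show ?thesis using U(2) by (simp add: Un_absorb1)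
        qed
        also have "\<dots> = emeasure lebesgue (U - N)" using N Nb Ub by (auto simp: null_sets_def)
        finally show ?thesis using U that by force
      qed
      define C where "C m k = {real k / 2 ^ m<..real (Suc k) / 2 ^ m}" for m k
      define I where "I m = {k. k < m * 2 ^ m \<and> {real k / 2 ^ m..real (Suc k) / 2 ^ m} \<subseteq> U}" for m
      define W where "W m = (\<Union>k\<in>I m. C m k)" for m
      have fin: "finite (I m)" for m by (simp add: I_def)
      have disj: "disjoint_family_on (C m) (I m)" for m
        unfolding disjoint_family_on_def
      proof (intro ballI impI)
        fix i j :: nat assume "i \<noteq> j"
        then have "real (Suc i) \<le> real j \<or> real (Suc j) \<le> real i" by linarith
        then have "real (Suc i) / 2^m \<le> real j / 2^m \<or> real (Suc j) / 2^m \<le> real i / 2^m"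
          by (meson divide_right_mono zero_le_numeral zero_le_power)
        then show "C m i \<inter> C m j = {}" by (auto simp: C_def)
      qed
      have Wb: "W m \<in> sets borel" for m using fin by (auto simp: W_def C_def)
      have WU: "W m \<subseteq> U" for m by (fastforce simp: W_def I_def C_def)
      have step: "real k / 2 ^ m \<le> real (Suc k) / 2 ^ m" for k m by (simp add: divide_right_mono)
      have card: "real (card (I m)) / 2 ^ m < d" for m
      proof -
        have "emeasure lborel (W m) = (\<Sum>k\<in>I m. emeasure lborel (C m k))"
          unfolding W_def by (rule sum_emeasure[symmetric, OF _ disj fin]) (auto simp: C_def)
        also have "\<dots> = (\<Sum>k\<in>I m. ennreal (1 / 2 ^ m))"
          unfolding C_def by (subst emeasure_lborel_Ioc[OF step]) (simp add: diff_divide_distrib[symmetric])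
        also have "\<dots> = ennreal (\<Sum>k\<in>I m. 1 / 2 ^ m)" by (rule sum_ennreal) simp
        also have "\<dots> = ennreal (real (card (I m)) / 2 ^ m)" by simp
        finally have "ennreal (real (card (I m)) / 2 ^ m) = emeasure lborel (W m)" ..
        also have "\<dots> \<le> emeasure lborel U" using WU U(1) by (intro emeasure_mono) auto
        also have "\<dots> < ennreal d" by (rule U(3))
        finally show ?thesis by (simp add: ennreal_less_iff)
      qed
      have mu: "emeasure ?\<mu> (W m) \<le> ennreal e" for m
      proof -
        have "emeasure ?\<mu> (W m) = (\<Sum>k\<in>I m. emeasure ?\<mu> (C m k))"
          unfolding W_def by (rule sum_emeasure[symmetric, OF _ disj fin]) (auto simp: C_def)
        also have "\<dots> = (\<Sum>k\<in>I m. ennreal \<bar>dyadic_increment F m k\<bar>)"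
          by (intro sum.cong refl) (use em[OF step] mono[OF step] in \<open>simp add: C_def\<close>)
        also have "\<dots> = ennreal (\<Sum>k\<in>I m. \<bar>dyadic_increment F m k\<bar>)"
          by (simp add: sum_ennreal)
        also have "\<dots> \<le> ennreal e" by (intro ennreal_leI D fin card)
        finally show ?thesis .
      qed
      define A where "A n = (\<Inter>m\<in>{n..}. W m)" for n
      have Ab: "A n \<in> sets borel" for n unfolding A_def by (intro sets.countable_INT'') (use Wb in auto)
      have "N \<inter> {0<..} \<subseteq> (\<Union>n. A n)"
      proof
        fix x assume "x \<in> N \<inter> {0<..}"
        then have x: "x \<in> U" "x > 0" using U(2) by auto
        obtain \<rho> where \<rho>: "\<rho> > 0" "cball x \<rho> \<subseteq> U" using U(1) x(1) open_contains_cball by blast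
        obtain n1 where n1: "(1/2::real) ^ n1 < \<rho>" using real_arch_pow_inv[of \<rho> "1/2"] \<rho> by auto
        obtain n2 where n2: "x \<le> real n2" using real_arch_simple by blast
        have "x \<in> W m" if m: "m \<ge> max n1 n2" for m
        proof -
          define k where "k = nat (\<lceil>2 ^ m * x\<rceil> - 1)"
          have "\<lceil>2 ^ m * x\<rceil> \<ge> 1" using x(2) by (simp add: one_le_ceiling)
          then have k: "real k = of_int \<lceil>2 ^ m * x\<rceil> - 1" by (simp add: k_def of_nat_nat)
          then have k1: "real k < 2 ^ m * x" "2 ^ m * x \<le> real (Suc k)" by linarith+
          have xc: "real k / 2 ^ m < x" "x \<le> real (Suc k) / 2 ^ m" using k1 by (auto simp: field_simps)
          have "(1/2::real) ^ m \<le> (1/2) ^ n1" using m by (intro power_decreasing) auto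
          then have r: "1 / 2 ^ m < \<rho>" using n1 by (simp add: power_one_over)
          have len: "real (Suc k) / 2 ^ m = real k / 2 ^ m + 1 / 2 ^ m" by (simp add: add_divide_distrib)
          have "{real k / 2 ^ m..real (Suc k) / 2 ^ m} \<subseteq> cball x \<rho>"
            using xc r len by (auto simp: dist_real_def)
          moreover have "k < m * 2 ^ m"
          proof -
            have "2 ^ m * x \<le> 2 ^ m * real m" using n2 m by (intro mult_left_mono) auto
            then have "real k < 2 ^ m * real m" using k1(1) n2 by linarith
            then have "real k < real (m * 2 ^ m)" by (simp only: of_nat_mult of_nat_power of_nat_numeral mult.commute)
            then show ?thesis by (simp only: of_nat_less_iff)
          qed
          ultimately have "k \<in> I m" using \<rho> by (auto simp: I_def)
          then show ?thesis using xc by (auto simp: W_def C_def)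
        qed
        then have "x \<in> A (max n1 n2)" by (auto simp: A_def)
        then show "x \<in> (\<Union>n. A n)" by blast
      qed
      then have "emeasure ?\<mu> (N \<inter> {0<..}) \<le> emeasure ?\<mu> (\<Union>n. A n)"
        using Ab by (intro emeasure_mono) auto
      also have "\<dots> = (SUP n. emeasure ?\<mu> (A n))"
        by (rule SUP_emeasure_incseq[symmetric]) (use Ab in \<open>auto simp: incseq_def A_def\<close>)
      also have "\<dots> \<le> ennreal e"
      proof (rule SUP_least)
        fix n
        have "emeasure ?\<mu> (A n) \<le> emeasure ?\<mu> (W n)" using Wb by (intro emeasure_mono) (auto simp: A_def)
        then show "emeasure ?\<mu> (A n) \<le> ennreal e" using mu order_trans by blast
      qed
      finally show ?thesis .
    qed
    have "emeasure ?\<mu> (N \<inter> {0<..}) \<le> 0"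
      by (rule ennreal_le_epsilon) (use small in auto)
    moreover have "emeasure ?\<mu> (N \<inter> {..0}) \<le> 0"
      using neg emeasure_mono[of "N \<inter> {..0}" "{..0}" ?\<mu>] by simp
    moreover have "emeasure ?\<mu> ((N \<inter> {0<..}) \<union> (N \<inter> {..0})) \<le> emeasure ?\<mu> (N \<inter> {0<..}) + emeasure ?\<mu> (N \<inter> {..0})"
      using Nb by (intro emeasure_subadditive) auto
    moreover have "(N \<inter> {0<..}) \<union> (N \<inter> {..0}) = N" by auto
    ultimately have "emeasure ?\<mu> N = 0" by simp
    then show ?thesis using Nb by (simp add: null_sets_def)
  qed
  then show ?thesis unfolding absolutely_continuous_def by blast
qed

text \<open>
  The density is the Radon--Nikodym derivative of the Stieltjes measure of F.
\<close>
lemma mono_dyadic_ac_density: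
  assumes mono: "\<And>x y. x \<le> y \<Longrightarrow> F x \<le> F y" and left: "\<And>x. x \<le> 0 \<Longrightarrow> F x = F 0"
    and ac: "dyadic_ac F"
  obtains f where "\<And>x y. x \<le> y \<Longrightarrow> (f has_integral (F y - F x)) {x..y}"
proof -
  let ?\<mu> = "interval_measure F"
  have cont: "continuous_on UNIV F" by (rule mono_dyadic_ac_continuous[OF mono left ac])
  have sets: "sets ?\<mu> = sets lborel" by (simp only: sets_interval_measure sets_lborel)
  have acl: "absolutely_continuous lborel ?\<mu>" by (rule dyadic_ac_null_sets[OF mono left ac])
  have "\<exists>f\<in>borel_measurable lborel. density lborel f = ?\<mu>"
    by (rule sigma_finite_measure.Radon_Nikodym[OF lborel.sigma_finite_measure_axioms acl sets])
  then obtain \<phi> where \<phi>[measurable]: "\<phi> \<in> borel_measurable lborel" and dens: "density lborel \<phi> = ?\<mu>" by blast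
  show ?thesis
  proof
    fix x y :: real assume xy: "x \<le> y"
    have nn: "(\<integral>\<^sup>+z. \<phi> z * indicator {x..y} z \<partial>lborel) = ennreal (F y - F x)"
    proof -
      have "emeasure (density lborel \<phi>) {x..y} = (\<integral>\<^sup>+z. \<phi> z * indicator {x..y} z \<partial>lborel)"
        by (rule emeasure_density) auto
      then show ?thesis using emeasure_interval_measure_Icc[OF xy mono cont] dens by simp
    qed
    have "AE z in lborel. \<phi> z * indicator {x..y} z \<noteq> \<infinity>"
      by (rule nn_integral_noteq_infinite) (use nn in auto)
    then have "(\<integral>\<^sup>+z. ennreal (enn2real (\<phi> z) * indicator {x..y} z) \<partial>lborel) = 
       (\<integral>\<^sup>+z. \<phi> z * indicator {x..y} z \<partial>lborel)"
      by (intro nn_integral_cong_AE) (auto split: split_indicator elim!: eventually_mono simp: less_top)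
    then have "((\<lambda>z. enn2real (\<phi> z) * indicator {x..y} z) has_integral (F y - F x)) UNIV"
      using mono[OF xy] nn by (intro nn_integral_has_integral) auto
    then show "((\<lambda>z. enn2real (\<phi> z)) has_integral (F y - F x)) {x..y}"
      by (subst has_integral_restrict_UNIV[symmetric]) (simp add: indicator_def if_distrib of_bool_def mult_if_delta cong: if_cong)
  qed
qed

text \<open>
  The differentiation theorem for averages over cubes with one corner at x gives the
  derivative from the right; applied to the reflected function, it gives the derivative from
  the left.
\<close>
lemma indefinite_integral_deriv_ae:
  fixes u f :: "real \<Rightarrow> real"
  assumes int: "\<And>x y. x \<le> y \<Longrightarrow> (f has_integral (u y - u x)) {x..y}"
  obtains N where "negligible N" "\<And>x. x \<notin> N \<Longrightarrow> (u has_real_derivative f x) (at x)"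
proof -
  have "f integrable_on cbox a b" for a b
    using int[of a b] by (cases "a \<le> b") (auto simp: integrable_on_def)
  then obtain N1 where N1: "negligible N1" "\<And>x e. x \<notin> N1 \<Longrightarrow> 0 < e \<Longrightarrow>
     \<exists>d>0. \<forall>h. 0 < h \<and> h < d \<longrightarrow> norm (integral (cbox x (x + h *\<^sub>R One)) f /\<^sub>R h ^ DIM(real) - f x) < e"
    using integrable_ccontinuous_explicit by blast
  have ref: "((\<lambda>x. f (- x)) has_integral (u (- x) - u (- y))) {x..y}" if "x \<le> y" for x y
    using int[of "- y" "- x"] that has_integral_reflect_real[where f=f and i="u (- x) - u (- y)" and a="-y" and b="-x"] by simp
  have "(\<lambda>x. f (- x)) integrable_on cbox a b" for a b
    using ref[of a b] by (cases "a \<le> b") (auto simp: integrable_on_def)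
  then obtain N2 where N2: "negligible N2" "\<And>x e. x \<notin> N2 \<Longrightarrow> 0 < e \<Longrightarrow>
     \<exists>d>0. \<forall>h. 0 < h \<and> h < d \<longrightarrow> norm (integral (cbox x (x + h *\<^sub>R One)) (\<lambda>x. f (- x)) /\<^sub>R h ^ DIM(real) - f (- x)) < e"
    using integrable_ccontinuous_explicit[of "\<lambda>x. f (- x)"] by blast
  show ?thesis
  proof
    have "negligible (uminus ` N2)"
      by (rule negligible_differentiable_image_negligible[OF _ N2(1)])
        (auto intro!: differentiable_on_minus differentiable_on_ident)
    then show "negligible (N1 \<union> uminus ` N2)" using N1(1) by simp
    fix x assume x: "x \<notin> N1 \<union> uminus ` N2"
    then have x1: "x \<notin> N1" and x2: "- x \<notin> N2" by (auto simp: image_iff)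
    show "(u has_real_derivative f x) (at x)"
      unfolding has_field_derivative_iff
    proof (rule LIM_I)
      fix e :: real assume e: "e > 0"
      obtain d1 where d1: "d1 > 0" "\<And>h. 0 < h \<Longrightarrow> h < d1 \<Longrightarrow> norm ((u (x + h) - u x) / h - f x) < e"
      proof -
        obtain d1 where d1: "d1 > 0" "\<forall>h. 0 < h \<and> h < d1 \<longrightarrow> norm (integral (cbox x (x + h *\<^sub>R One)) f /\<^sub>R h ^ DIM(real) - f x) < e"
          using N1(2)[OF x1 e] by blast
        have "integral (cbox x (x + h *\<^sub>R One)) f = u (x + h) - u x" if "h > 0" for h
          using int[of x "x + h"] that by (simp add: integral_unique)
        then show ?thesis using d1 by (intro that[of d1]) (auto simp: divide_inverse mult.commute)
      qed
      obtain d2 where d2: "d2 > 0" "\<And>h. 0 < h \<Longrightarrow> h < d2 \<Longrightarrow> norm ((u x - u (x - h)) / h - f x) < e"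
      proof -
        obtain d2 where d2: "d2 > 0" "\<forall>h. 0 < h \<and> h < d2 \<longrightarrow> norm (integral (cbox (-x) (-x + h *\<^sub>R One)) (\<lambda>x. f (- x)) /\<^sub>R h ^ DIM(real) - f (- (- x))) < e"
          using N2(2)[OF x2 e] by blast
        have "integral (cbox (-x) (-x + h *\<^sub>R One)) (\<lambda>x. f (- x)) = u x - u (x - h)" if "h > 0" for h
          using ref[of "-x" "-x + h"] that by (simp add: integral_unique)
        then show ?thesis using d2 by (intro that[of d2]) (auto simp: divide_inverse mult.commute)
      qed
      have "norm ((u z - u x) / (z - x) - f x) < e" if z: "z \<noteq> x" "norm (z - x) < min d1 d2" for z
      proof (cases "z > x")
        case True
        then show ?thesis using d1(2)[of "z - x"] z by simp
      next
        case False
        have "(u z - u x) / (z - x) = (u x - u z) / (x - z)" by (metis minus_diff_eq minus_divide_divide)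
        then show ?thesis using d2(2)[of "x - z"] z False by simp
      qed
      then show "\<exists>s>0. \<forall>z. z \<noteq> x \<and> norm (z - x) < s \<longrightarrow> norm ((u z - u x) / (z - x) - f x) < e"
        using d1(1) d2(1) by (intro exI[of _ "min d1 d2"]) auto
    qed
  qed
qed

lemma dyadic_ac_diff:
  assumes "dyadic_ac F" "dyadic_ac G"
  shows "dyadic_ac (\<lambda>x. F x - G x)"
  unfolding dyadic_ac_def
proof (intro allI impI)
  fix e :: real assume "e > 0"
  obtain d1 where d1: "d1 > 0" "\<And>m I. finite I \<Longrightarrow> real (card I) / 2 ^ m < d1 \<Longrightarrow>
     (\<Sum>k\<in>I. \<bar>dyadic_increment F m k\<bar>) \<le> e / 2"
    using assms(1)[unfolded dyadic_ac_def, rule_format, of "e / 2"] \<open>e > 0\<close> by auto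
  obtain d2 where d2: "d2 > 0" "\<And>m I. finite I \<Longrightarrow> real (card I) / 2 ^ m < d2 \<Longrightarrow>
     (\<Sum>k\<in>I. \<bar>dyadic_increment G m k\<bar>) \<le> e / 2"
    using assms(2)[unfolded dyadic_ac_def, rule_format, of "e / 2"] \<open>e > 0\<close> by auto
  have "(\<Sum>k\<in>I. \<bar>F (real (Suc k) / 2 ^ m) - G (real (Suc k) / 2 ^ m) - (F (real k / 2 ^ m) - G (real k / 2 ^ m))\<bar>) \<le> e"
    if I: "finite I" "real (card I) / 2 ^ m < min d1 d2" for m I
  proof -
    have "(\<Sum>k\<in>I. \<bar>F (real (Suc k) / 2 ^ m) - G (real (Suc k) / 2 ^ m) - (F (real k / 2 ^ m) - G (real k / 2 ^ m))\<bar>) \<le>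
      (\<Sum>k\<in>I. \<bar>dyadic_increment F m k\<bar> + \<bar>dyadic_increment G m k\<bar>)"
      by (intro sum_mono) linarith
    then show ?thesis using d1(2)[OF I(1), of m] d2(2)[OF I(1), of m] I(2) by (simp add: sum.distrib)
  qed
  then show "\<exists>d>0. \<forall>m I. finite I \<longrightarrow> real (card I) / 2 ^ m < d \<longrightarrow>
    (\<Sum>k\<in>I. \<bar>F (real (Suc k) / 2 ^ m) - G (real (Suc k) / 2 ^ m) - (F (real k / 2 ^ m) - G (real k / 2 ^ m))\<bar>) \<le> e"
    using d1(1) d2(1) by (intro exI[of _ "min d1 d2"]) auto
qed

text \<open>
  The two monotone parts of the Jordan decomposition have densities, whose difference is the
  density of u. Dyadic cells cover the half line only, which is why u has to be constant to
  the left of 0.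
\<close>
lemma absolutely_continuous_has_integral:
  assumes ac: "absolutely_continuous_on UNIV u"
    and left: "\<And>x. x \<le> 0 \<Longrightarrow> u x = u 0"
  obtains f where "\<And>x y. x \<le> y \<Longrightarrow> (f has_integral (u y - u x)) {x..y}"
proof -
  note dac = absolutely_continuous_imp_dyadic_ac[OF ac]
  obtain V where V: "dyadic_ac V" "\<And>x y. x \<le> y \<Longrightarrow> \<bar>u y - u x\<bar> \<le> V y - V x" and V0: "\<forall>x\<le>0. V x = V 0"
    by (rule dyadic_ac_decompose[OF dac absolutely_continuous_imp_continuous[OF ac] left]) blast+
  have V3: "V x = V 0" if "x \<le> 0" for x using V0 that by blast
  have "V x \<le> V y" if "x \<le> y" for x y using V(2)[OF that] by linarith
  then obtain f1 where f1: "\<And>x y. x \<le> y \<Longrightarrow> (f1 has_integral (V y - V x)) {x..y}"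
    by (rule mono_dyadic_ac_density[OF _ V3 V(1)]) blast+
  have "V x - u x \<le> V y - u y" if "x \<le> y" for x y using V(2)[OF that] by linarith
  moreover have "V x - u x = V 0 - u 0" if "x \<le> 0" for x
    unfolding V3[OF that] left[OF that] ..
  ultimately obtain f2 where f2: "\<And>x y. x \<le> y \<Longrightarrow> (f2 has_integral ((V y - u y) - (V x - u x))) {x..y}"
    by (rule mono_dyadic_ac_density[OF _ _ dyadic_ac_diff[OF V(1) dac]]) blast+
  show ?thesis
  proof
    fix x y :: real assume "x \<le> y"
    from has_integral_diff[OF f1[OF this] f2[OF this]]
    show "((\<lambda>x. f1 x - f2 x) has_integral (u y - u x)) {x..y}" by (simp add: algebra_simps)
  qed
qed

text \<open>
  Brings a function on an interval into the form that absolutely_continuous_has_integral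
  expects: defined everywhere and constant to the left of 0. Clamping is monotone and does not
  increase lengths, so that it preserves absolute continuity.
\<close>
lemma clamp_shift_absolutely_continuous:
  assumes ab: "a < b" and ac: "absolutely_continuous_on {a..b} u"
  shows "absolutely_continuous_on UNIV (\<lambda>t. u (min b (max a (a + t))))"
  unfolding absolutely_continuous_on_def
proof (intro allI impI)
  fix e :: real assume "e > 0"
  then obtain d where d: "d > 0" and D: "\<And>P. finite P \<Longrightarrow> (\<forall>(s, t)\<in>P. s < t \<and> {s..t} \<subseteq> {a..b}) \<Longrightarrow>
        disjoint_family_on (\<lambda>(s, t). {s<..<t}) P \<Longrightarrow>
        (\<Sum>(s, t)\<in>P. t - s) < d \<Longrightarrow> (\<Sum>(s, t)\<in>P. \<bar>u t - u s\<bar>) < e"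
    using ac unfolding absolutely_continuous_on_def by blast
  define c where "c t = min b (max a (a + t))" for t
  have c: "s \<le> t \<Longrightarrow> c s \<le> c t" "s \<le> t \<Longrightarrow> c t - c s \<le> t - s" "c t \<in> {a..b}" for s t
    using ab by (auto simp: c_def)
  have cin: "t \<in> {c x<..<c y} \<Longrightarrow> t - a \<in> {x<..<y}" for t x y
    by (auto simp: c_def min_def max_def split: if_splits)
  show "\<exists>d>0. \<forall>P. finite P \<longrightarrow> (\<forall>(s, t)\<in>P. s < t \<and> {s..t} \<subseteq> UNIV) \<longrightarrow>
      disjoint_family_on (\<lambda>(s, t). {s<..<t}) P \<longrightarrow> (\<Sum>(s, t)\<in>P. t - s) < d \<longrightarrow>
      (\<Sum>(s, t)\<in>P. \<bar>u (min b (max a (a + t))) - u (min b (max a (a + s)))\<bar>) < e"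
  proof (intro exI[of _ d] conjI allI impI)
    fix P assume fin: "finite P" and lt: "\<forall>(s, t)\<in>P. s < t \<and> {s..t} \<subseteq> (UNIV :: real set)"
      and disj: "disjoint_family_on (\<lambda>(s, t). {s<..<t}) P" and len: "(\<Sum>(s, t)\<in>P. t - s) < d"
    define P' where "P' = {p \<in> P. c (fst p) < c (snd p)}"
    define C where "C p = (c (fst p), c (snd p))" for p
    have disjC: "{c (fst p)<..<c (snd p)} \<inter> {c (fst q)<..<c (snd q)} = {}"
      if "p \<in> P" "q \<in> P" "p \<noteq> q" for p q
    proof -
      have "{fst p<..<snd p} \<inter> {fst q<..<snd q} = {}"
        using disj that unfolding disjoint_family_on_def case_prod_beta by blast
      then show ?thesis using cin[of _ "fst p" "snd p"] cin[of _ "fst q" "snd q"] by blast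
    qed
    have inj: "inj_on C P'"
    proof (rule inj_onI, rule ccontr)
      fix p q assume pq: "p \<in> P'" "q \<in> P'" "C p = C q" "p \<noteq> q"
      then have "{c (fst p)<..<c (snd p)} \<inter> {c (fst q)<..<c (snd q)} = {}"
        by (intro disjC) (auto simp: P'_def)
      then show False using pq by (auto simp: C_def P'_def)
    qed
    have sumC: "(\<Sum>(s, t)\<in>C ` P'. f s t) = (\<Sum>p\<in>P'. f (c (fst p)) (c (snd p)))" for f :: "real \<Rightarrow> real \<Rightarrow> real"
      by (subst sum.reindex[OF inj]) (simp add: C_def)
    have "(\<Sum>(s, t)\<in>C ` P'. \<bar>u t - u s\<bar>) < e"
    proof (rule D)
      show "finite (C ` P')" using fin by (simp add: P'_def)
      show "\<forall>(s, t)\<in>C ` P'. s < t \<and> {s..t} \<subseteq> {a..b}"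
      proof (intro ballI, elim imageE)
        fix x p assume "x = C p" "p \<in> P'"
        then show "case x of (s, t) \<Rightarrow> s < t \<and> {s..t} \<subseteq> {a..b}"
          using c(3)[of "fst p"] c(3)[of "snd p"] by (auto simp: C_def P'_def)
      qed
      show "disjoint_family_on (\<lambda>(s, t). {s<..<t}) (C ` P')"
        unfolding disjoint_family_on_def
      proof (intro ballI impI, elim imageE)
        fix x y p q assume "x \<noteq> y" "x = C p" "p \<in> P'" "y = C q" "q \<in> P'"
        then show "(case x of (s, t) \<Rightarrow> {s<..<t}) \<inter> (case y of (s, t) \<Rightarrow> {s<..<t}) = {}"
          using disjC[of p q] by (auto simp: C_def P'_def)
      qed
      have "(\<Sum>(s, t)\<in>C ` P'. t - s) = (\<Sum>p\<in>P'. c (snd p) - c (fst p))" by (rule sumC)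
      also have "\<dots> \<le> (\<Sum>p\<in>P'. snd p - fst p)"
        by (intro sum_mono c(2)) (use lt in \<open>auto simp: P'_def\<close>)
      also have "\<dots> \<le> (\<Sum>p\<in>P. snd p - fst p)"
        by (rule sum_mono2) (use fin lt in \<open>auto simp: P'_def\<close>)
      also have "\<dots> < d" using len by (simp add: case_prod_beta)
      finally show "(\<Sum>(s, t)\<in>C ` P'. t - s) < d" .
    qed
    also have "(\<Sum>(s, t)\<in>C ` P'. \<bar>u t - u s\<bar>) = (\<Sum>p\<in>P'. \<bar>u (c (snd p)) - u (c (fst p))\<bar>)" by (rule sumC)
    also have "\<dots> = (\<Sum>p\<in>P. \<bar>u (c (snd p)) - u (c (fst p))\<bar>)"
    proof (rule sum.mono_neutral_left[OF fin])
      show "\<forall>p\<in>P - P'. \<bar>u (c (snd p)) - u (c (fst p))\<bar> = 0"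
      proof
        fix p assume p: "p \<in> P - P'"
        then have "fst p \<le> snd p" using lt by auto
        then have "c (snd p) = c (fst p)" using c(1)[of "fst p" "snd p"] p by (auto simp: P'_def)
        then show "\<bar>u (c (snd p)) - u (c (fst p))\<bar> = 0" by simp
      qed
    qed (auto simp: P'_def)
    finally show "(\<Sum>(s, t)\<in>P. \<bar>u (min b (max a (a + t))) - u (min b (max a (a + s)))\<bar>) < e"
      by (simp add: c_def case_prod_beta)
  qed (use d in auto)
qed

text \<open>
  Since u is the integral of its almost everywhere derivative, a bound of this derivative is a
  Lipschitz constant. The bound is required only where a derivative exists, because an
  essential bound of deriv u says nothing at the other points: there the value of deriv u is
  arbitrary.
\<close>
lemma ae_deriv_bound_imp_Lipschitz:
  assumes ab: "a < b" and ac: "absolutely_continuous_on {a..b} u" and N: "negligible N"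
    and bound: "\<And>x D. x \<in> {a<..<b} - N \<Longrightarrow> (u has_real_derivative D) (at x) \<Longrightarrow> \<bar>D\<bar> \<le> B"
  shows "\<bar>u b - u a\<bar> \<le> B * (b - a)"
proof -
  define w where "w t = u (min b (max a (a + t)))" for t
  have "absolutely_continuous_on UNIV w"
    unfolding w_def by (rule clamp_shift_absolutely_continuous[OF ab ac])
  moreover have "w t = w 0" if "t \<le> 0" for t using that by (simp add: w_def max_def)
  ultimately obtain f where f: "\<And>x y. x \<le> y \<Longrightarrow> (f has_integral (w y - w x)) {x..y}"
    by (rule absolutely_continuous_has_integral) blast+
  obtain M where M: "negligible M" "\<And>t. t \<notin> M \<Longrightarrow> (w has_real_derivative f t) (at t)"
    by (rule indefinite_integral_deriv_ae[of f w]) (use f in blast)+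
  have fB: "\<bar>f t\<bar> \<le> B" if t: "t \<in> {0<..<b - a}" "t \<notin> M" "a + t \<notin> N" for t
  proof (rule bound)
    show "a + t \<in> {a<..<b} - N" using t by auto
    have "((\<lambda>x. w (x - a)) has_real_derivative f t) (at (a + t))"
      using DERIV_shift[of w "f t" t a] M(2)[OF t(2)]
      using DERIV_shift[of "\<lambda>x. w (x - a)" "f t" t a] by (simp add: add.commute)
    then show "(u has_real_derivative f t) (at (a + t))"
      by (rule has_field_derivative_transform_within_open[of _ _ _ "{a<..<b}"]) (use t in \<open>auto simp: w_def\<close>)
  qed
  define K where "K = {0, b - a} \<union> M \<union> (\<lambda>x. - a + x) ` N"
  have K: "negligible K" unfolding K_def using M(1) negligible_translation[OF N, of "- a"] by (intro negligible_Un) auto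
  have "B \<ge> 0"
  proof -
    have "\<not> negligible {0<..<b - a}" using ab open_not_negligible[of "{0<..<b-a}"] by auto
    then have "\<not> {0<..<b - a} \<subseteq> K" using K negligible_subset by blast
    then obtain t where t: "t \<in> {0<..<b - a}" "t \<notin> K" by blast
    have "a + t \<notin> N" using t(2) by (auto simp: K_def image_iff)
    then show ?thesis using fB[of t] t by (auto simp: K_def)
  qed
  have "((\<lambda>t. if t \<in> K then 0 else f t) has_integral (w (b - a) - w 0)) {0..b - a}"
    by (rule has_integral_spike[OF K _ f]) (use ab in auto)
  then have "((\<lambda>t. if t \<in> K then 0 else f t) has_integral (w (b - a) - w 0)) (cbox 0 (b - a))"
    by simp
  then have "norm (w (b - a) - w 0) \<le> B * measure lborel (cbox 0 (b - a))"
  proof (rule has_integral_bound[OF \<open>B \<ge> 0\<close>])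
    fix t assume t: "t \<in> cbox 0 (b - a)"
    show "norm (if t \<in> K then 0 else f t) \<le> B"
    proof (cases "t \<in> K")
      case False
      then have "t \<in> {0<..<b - a}" "t \<notin> M" "a + t \<notin> N" using t by (auto simp: K_def image_iff)
      then show ?thesis using fB False by simp
    qed (use \<open>B \<ge> 0\<close> in simp)
  qed
  then show ?thesis using ab by (simp add: w_def)
qed

section \<open>Gauss--Legendre quadrature\<close>

lemma integral_poly_pderiv:
  fixes p :: "real poly"
  shows "integral {-1..1} (poly (pderiv p)) = poly p 1 - poly p (-1)"
proof (rule integral_unique, rule fundamental_theorem_of_calculus)
  fix x :: real
  show "(poly p has_vector_derivative poly (pderiv p) x) (at x within {-1..1})"
    using poly_DERIV[of p x] by (simp add: has_real_derivative_iff_has_vector_derivative has_vector_derivative_at_within)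
qed simp

lemma integrable_poly: "poly p integrable_on {-1..1::real}"
  by (rule integrable_continuous_real) (intro continuous_intros)

lemma integral_poly_by_parts:
  fixes p q :: "real poly"
  assumes "poly q 1 = 0" "poly q (-1) = 0"
  shows "integral {-1..1} (poly (p * pderiv q)) = - integral {-1..1} (poly (pderiv p * q))"
proof -
  have "poly (pderiv (p * q)) = (\<lambda>x. poly (p * pderiv q) x + poly (pderiv p * q) x)"
    by (rule ext) (simp add: pderiv_mult algebra_simps)
  then have "integral {-1..1} (poly (p * pderiv q)) + integral {-1..1} (poly (pderiv p * q)) = 0"
    using integral_poly_pderiv[of "p * q"] assms integral_add[OF integrable_poly integrable_poly, of "p * pderiv q" "pderiv p * q"]
    by simp
  then show ?thesis by simp
qed

lemma dvd_pderiv_funpow: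
  fixes a :: "real poly"
  shows "a ^ (m - i) dvd (pderiv ^^ i) (a ^ m)"
proof (induction i)
  case (Suc i)
  obtain c where c: "(pderiv ^^ i) (a ^ m) = a ^ (m - i) * c" using Suc by (auto elim: dvdE)
  have "a ^ (m - Suc i) dvd pderiv (a ^ (m - i))"
  proof (cases "m - i")
    case (Suc k)
    then have "m - Suc i = k" by simp
    then show ?thesis unfolding Suc by (simp only: pderiv_power_Suc \<open>m - Suc i = k\<close> dvd_mult2 dvd_smult dvd_refl)
  qed simp
  moreover have "a ^ (m - Suc i) dvd a ^ (m - i)" by (rule le_imp_power_dvd) simp
  ultimately show ?case by (simp add: c pderiv_mult)
qed simp

text \<open>
  Integrate by parts j times. The boundary terms vanish, because fewer than m derivatives
  leave a factor x^2 - 1 in (x^2 - 1)^m.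
\<close>
lemma rodrigues_orthogonal:
  fixes p :: "real poly"
  shows "j \<le> m \<Longrightarrow> integral {-1..1} (poly (p * (pderiv ^^ m) ([:-1, 0, 1:] ^ m))) =
    (-1) ^ j * integral {-1..1} (poly ((pderiv ^^ j) p * (pderiv ^^ (m - j)) ([:-1, 0, 1:] ^ m)))"
proof (induction j)
  case (Suc j)
  let ?w = "[:-1, 0, 1:] :: real poly"
  define q where "q = (pderiv ^^ (m - Suc j)) (?w ^ m)"
  have e: "m - j = Suc (m - Suc j)" using Suc.prems by simp
  have "?w ^ Suc j dvd q" using dvd_pderiv_funpow[of ?w m "m - Suc j"] Suc.prems by (simp add: q_def)
  then have "?w dvd q" by (metis dvd_mult_left power_Suc)
  then have "poly q 1 = 0" "poly q (-1) = 0" by (auto elim!: dvdE)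
  have "integral {-1..1} (poly ((pderiv ^^ j) p * (pderiv ^^ (m - j)) (?w ^ m))) =
      - integral {-1..1} (poly ((pderiv ^^ Suc j) p * (pderiv ^^ (m - Suc j)) (?w ^ m)))"
    unfolding e funpow.simps comp_apply q_def[symmetric]
    by (rule integral_poly_by_parts[OF \<open>poly q 1 = 0\<close> \<open>poly q (-1) = 0\<close>])
  moreover have "integral {-1..1} (poly (p * (pderiv ^^ m) (?w ^ m))) =
    (-1) ^ j * integral {-1..1} (poly ((pderiv ^^ j) p * (pderiv ^^ (m - j)) (?w ^ m)))"
    by (rule Suc.IH) (use Suc.prems in simp)
  ultimately show ?case by (simp only: power_Suc mult_minus_right mult_minus_left mult_1_left)
qed simp

lemma degree_funpow_pderiv: "degree ((pderiv ^^ k) p) = degree (p :: real poly) - k"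
  by (induction k) (auto simp: degree_pderiv)

lemma legendre_orthogonal:
  assumes "degree p < m"
  shows "integral {-1..1} (poly (p * legendre_poly m)) = 0"
proof -
  have 0: "(pderiv ^^ m) p = 0"
  proof -
    have "m = Suc (m - 1)" using assms by simp
    then have "(pderiv ^^ m) p = pderiv ((pderiv ^^ (m - 1)) p)" by (metis comp_apply funpow.simps(2))
    moreover have "degree ((pderiv ^^ (m - 1)) p) = 0" using assms by (simp add: degree_funpow_pderiv)
    ultimately show ?thesis by (simp add: pderiv_eq_0_iff)
  qed
  have "integral {-1..1} (poly (p * (pderiv ^^ m) ([:-1, 0, 1:] ^ m))) = 0"
  proof -
    have "poly (0 * q) = (\<lambda>x::real. 0)" for q by (rule ext) simp
    then show ?thesis unfolding rodrigues_orthogonal[of m m p, OF order_refl] 0 by (simp only: integral_0 mult_zero_right)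
  qed
  moreover have "poly (p * legendre_poly m) = (\<lambda>x. 1 / (2 ^ m * fact m) * poly (p * (pderiv ^^ m) ([:-1, 0, 1:] ^ m)) x)"
    by (rule ext) (simp add: legendre_poly_def)
  ultimately show ?thesis by (simp only: integral_mult_right mult_zero_right)
qed

lemma degree_legendre_poly: "degree (legendre_poly m) = m"
proof -
  have "degree ([:-1, 0, 1:] ^ m :: real poly) = 2 * m"
    by (subst degree_power_eq) auto
  then show ?thesis by (simp add: legendre_poly_def degree_funpow_pderiv)
qed

text \<open>
  The points of S are the zeros in (-1,1) of odd multiplicity. The zeros are divided out one
  by one; a zero that is met for the second time goes into B as a square, which leaves the
  sign of B unchanged.
\<close>
lemma split_off_sign_changes:
  fixes p :: "real poly"
  assumes "p \<noteq> 0"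
  shows "\<exists>S B. finite S \<and> S \<subseteq> {-1<..<1} \<and> p = (\<Prod>s\<in>S. [:-s, 1:]) * B \<and>
     ((\<forall>x\<in>{-1<..<1}. poly B x \<ge> 0) \<or> (\<forall>x\<in>{-1<..<1}. poly B x \<le> 0))"
  using assms
proof (induction "degree p" arbitrary: p rule: less_induct)
  case less
  show ?case
  proof (cases "\<exists>a\<in>{-1<..<1}. poly p a = 0")
    case False
    have "(\<forall>x\<in>{-1<..<1}. poly p x \<ge> 0) \<or> (\<forall>x\<in>{-1<..<1}. poly p x \<le> 0)"
    proof (rule ccontr)
      assume "\<not> ?thesis"
      then obtain x y where xy: "x \<in> {-1<..<1}" "y \<in> {-1<..<1}" "poly p x < 0" "poly p y > 0" by (auto simp: not_le)
      then have "x \<noteq> y" by auto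
      then obtain z where z: "min x y \<le> z" "z \<le> max x y" "poly p z = 0"
      proof (cases "x < y")
        case True
        then show ?thesis using IVT[of "poly p" x 0 y] xy that by auto
      next
        case F: False
        then show ?thesis using IVT2[of "poly p" x 0 y] xy \<open>x \<noteq> y\<close> that by auto
      qed
      then have "z \<in> {-1<..<1}" using xy by (auto simp: min_def max_def split: if_splits)
      then show False using False z(3) by blast
    qed
    then show ?thesis by (intro exI[of _ "{}"] exI[of _ p]) simp
  next
    case True
    then obtain a where a: "a \<in> {-1<..<1}" "poly p a = 0" by blast
    then obtain q where q: "p = [:-a, 1:] * q" by (auto simp: poly_eq_0_iff_dvd elim: dvdE)
    have "q \<noteq> 0" using q less.prems by auto
    then have "degree p = Suc (degree q)" unfolding q by (subst degree_mult_eq) auto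
    with less.hyps[of q] \<open>q \<noteq> 0\<close> obtain S B where S: "finite S" "S \<subseteq> {-1<..<1}" "q = (\<Prod>s\<in>S. [:-s, 1:]) * B"
       "(\<forall>x\<in>{-1<..<1}. poly B x \<ge> 0) \<or> (\<forall>x\<in>{-1<..<1}. poly B x \<le> 0)" by auto
    show ?thesis
    proof (cases "a \<in> S")
      case False
      then have "p = (\<Prod>s\<in>insert a S. [:-s, 1:]) * B"
        unfolding q S(3) using S(1) by (simp only: prod.insert mult.assoc not_False_eq_True)
      then show ?thesis using S a by (intro exI[of _ "insert a S"] exI[of _ B]) auto
    next
      case True
      define B' where "B' = [:-a, 1:] ^ 2 * B"
      have "(\<Prod>s\<in>S. [:-s, 1:]) = [:-a, 1:] * (\<Prod>s\<in>S - {a}. [:-s, 1:])" using True S(1) by (rule prod.remove[rotated])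
      then have "p = (\<Prod>s\<in>S - {a}. [:-s, 1:]) * B'"
        unfolding q S(3) B'_def by (simp only: power2_eq_square mult.assoc mult.left_commute mult.commute)
      moreover have "(\<forall>x\<in>{-1<..<1}. poly B' x \<ge> 0) \<or> (\<forall>x\<in>{-1<..<1}. poly B' x \<le> 0)"
        using S(4) by (auto simp: B'_def poly_power mult_nonneg_nonpos)
      ultimately show ?thesis using S a by (intro exI[of _ "S - {a}"] exI[of _ B']) auto
    qed
  qed
qed

lemma integral_poly_pos:
  fixes p :: "real poly"
  assumes "p \<noteq> 0" "\<And>x. x \<in> {-1<..<1} \<Longrightarrow> poly p x \<ge> 0"
  shows "integral {-1..1} (poly p) > 0"
proof -
  have cont: "continuous_on {-1..1} (poly p)" by (intro continuous_intros)
  have nn: "poly p x \<ge> 0" if "x \<in> {-1..1}" for x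
  proof -
    have "x \<in> closure {-1<..<1}" using that by simp
    moreover have "continuous_on (closure {-1<..<1::real}) (poly p)" by (intro continuous_intros)
    ultimately show ?thesis
      using continuous_ge_on_closure[of "{-1<..<1}" "poly p" x 0] assms(2) by blast
  qed
  have "integral {-1..1} (poly p) \<noteq> 0"
  proof
    assume "integral {-1..1} (poly p) = 0"
    then have "\<forall>x\<in>{-1..1}. poly p x = 0"
      using integral_eq_0_iff[OF cont _ nn] by simp
    then have "{-1..1} \<subseteq> {x. poly p x = 0}" by blast
    then have "finite {-1..1::real}" using poly_roots_finite[OF assms(1)] finite_subset by blast
    then show False by (simp add: infinite_Icc)
  qed
  moreover have "integral {-1..1} (poly p) \<ge> 0" by (rule integral_nonneg[OF integrable_poly nn])
  ultimately show ?thesis by simp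
qed

lemma degree_prod_linear: "finite S \<Longrightarrow> degree (\<Prod>s\<in>S. [:-s, 1::real:]) = card S"
  by (subst degree_prod_eq_sum_degree) auto

text \<open>
  If the Legendre polynomial had fewer than m sign changes in (-1,1), it would be orthogonal
  to the product A of the corresponding linear factors, although their product is A^2 times a
  polynomial of constant sign. Hence there are m sign changes, and they are all its zeros.
\<close>
lemma gauss_nodes:
  shows "finite (gauss_nodes m)" "card (gauss_nodes m) = m" "gauss_nodes m \<subseteq> {-1<..<1}"
proof -
  have nz: "legendre_poly m \<noteq> 0"
  proof (cases "m = 0")
    case True
    then show ?thesis by (simp add: legendre_poly_def)
  next
    case False
    then show ?thesis using degree_legendre_poly[of m] by auto
  qed
  obtain S B where S: "finite S" "S \<subseteq> {-1<..<1}" "legendre_poly m = (\<Prod>s\<in>S. [:-s, 1:]) * B"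
    "(\<forall>x\<in>{-1<..<1}. poly B x \<ge> 0) \<or> (\<forall>x\<in>{-1<..<1}. poly B x \<le> 0)"
    using split_off_sign_changes[OF nz] by blast
  define A where "A = (\<Prod>s\<in>S. [:-s, 1::real:])"
  have A: "A \<noteq> 0" "B \<noteq> 0" using nz S(3) by (auto simp: A_def)
  have "card S \<ge> m"
  proof (rule ccontr)
    assume "\<not> card S \<ge> m"
    then have "integral {-1..1} (poly (A * legendre_poly m)) = 0"
      by (intro legendre_orthogonal) (simp add: A_def degree_prod_linear S(1))
    then have z: "integral {-1..1} (poly (A ^ 2 * B)) = 0" "integral {-1..1} (poly (- (A ^ 2 * B))) = 0"
    proof -
      have "A * legendre_poly m = A ^ 2 * B" unfolding S(3) A_def[symmetric] by (simp add: power2_eq_square mult.assoc)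
      with \<open>integral {-1..1} (poly (A * legendre_poly m)) = 0\<close> show z: "integral {-1..1} (poly (A ^ 2 * B)) = 0"
        by (simp only:)
      have "poly (- (A ^ 2 * B)) = (\<lambda>x. - poly (A ^ 2 * B) x)" by (rule ext) (simp only: poly_minus)
      then show "integral {-1..1} (poly (- (A ^ 2 * B))) = 0"
        using z by (simp only: integral_neg)
    qed
    show False using S(4)
    proof
      assume "\<forall>x\<in>{-1<..<1}. poly B x \<ge> 0"
      then show False using integral_poly_pos[of "A ^ 2 * B"] A z(1) by (simp add: poly_power)
    next
      assume "\<forall>x\<in>{-1<..<1}. poly B x \<le> 0"
      then show False using integral_poly_pos[of "- (A ^ 2 * B)"] A z(2) by (simp add: poly_power mult_nonneg_nonpos)
    qed
  qed
  moreover have sub: "S \<subseteq> gauss_nodes m" using S(1,3) by (auto simp: gauss_nodes_def poly_prod)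
  moreover show fin: "finite (gauss_nodes m)" using poly_roots_finite[OF nz] by (simp add: gauss_nodes_def)
  moreover have "card (gauss_nodes m) \<le> m"
    using card_poly_roots_bound[OF nz] by (simp add: gauss_nodes_def degree_legendre_poly)
  ultimately have "S = gauss_nodes m" "card S = m" 
    using card_mono[OF fin sub] card_subset_eq[OF fin sub] by auto
  then show "card (gauss_nodes m) = m" "gauss_nodes m \<subseteq> {-1<..<1}" using S by auto
qed

definition lagrange_poly :: "real set \<Rightarrow> real \<Rightarrow> real poly" where
  "lagrange_poly S t = (\<Prod>s\<in>S - {t}. smult (1 / (t - s)) [:-s, 1:])"

lemma poly_lagrange_poly: "poly (lagrange_poly S t) x = (\<Prod>s\<in>S - {t}. (x - s) / (t - s))"
  unfolding lagrange_poly_def poly_prod by (intro prod.cong) (auto simp: divide_simps)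

lemma lagrange_poly_node:
  assumes "finite S" "s \<in> S" "t \<in> S"
  shows "poly (lagrange_poly S t) s = (if s = t then 1 else 0)"
  using assms by (auto simp: poly_lagrange_poly intro!: prod.neutral prod_zero)

lemma degree_lagrange_poly:
  assumes "finite S" "t \<in> S"
  shows "degree (lagrange_poly S t) < card S"
proof -
  have "degree (lagrange_poly S t) \<le> (\<Sum>s\<in>S - {t}. degree (smult (1 / (t - s)) [:-s, 1:]))"
    unfolding lagrange_poly_def by (rule degree_prod_sum_le[unfolded comp_def]) (use assms in auto)
  also have "\<dots> \<le> (\<Sum>s\<in>S - {t}. 1)" by (intro sum_mono) simp
  also have "\<dots> = card S - 1" using assms by simp
  also have "\<dots> < card S" using assms by (metis card_gt_0_iff diff_less empty_iff zero_less_one)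
  finally show ?thesis .
qed

lemma lagrange_interpolation:
  assumes "finite S" "degree p < card S"
  shows "p = (\<Sum>t\<in>S. smult (poly p t) (lagrange_poly S t))"
proof -
  let ?q = "\<Sum>t\<in>S. smult (poly p t) (lagrange_poly S t)"
  have "poly (p - ?q) s = 0" if s: "s \<in> S" for s
  proof -
    have "poly ?q s = (\<Sum>t\<in>S. poly p t * (if s = t then 1 else 0))"
      unfolding poly_sum by (intro sum.cong) (simp_all add: lagrange_poly_node[OF assms(1) s])
    also have "\<dots> = poly p s" using assms(1) s by (simp add: if_distrib cong: if_cong)
    finally show ?thesis by simp
  qed
  then have sub: "S \<subseteq> {x. poly (p - ?q) x = 0}" by blast
  have "degree (p - ?q) < card S"
  proof (rule degree_diff_less[OF assms(2)])
    have "degree ?q \<le> card S - 1"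
      by (rule degree_sum_le[OF assms(1)]) (use degree_lagrange_poly[OF assms(1)] in \<open>fastforce intro: order_trans[OF degree_smult_le]\<close>)
    then show "degree ?q < card S" using assms(2) by simp
  qed
  have "p - ?q = 0"
  proof (rule ccontr)
    assume nz: "p - ?q \<noteq> 0"
    have "card S \<le> card {x. poly (p - ?q) x = 0}" by (rule card_mono[OF poly_roots_finite[OF nz] sub])
    also have "\<dots> \<le> degree (p - ?q)" by (rule card_poly_roots_bound[OF nz])
    finally show False using \<open>degree (p - ?q) < card S\<close> by simp
  qed
  then show ?thesis by simp
qed

lemma gauss_weight_eq: "gauss_weight m t = integral {-1..1} (poly (lagrange_poly (gauss_nodes m) t))"
  unfolding gauss_weight_def by (simp only: poly_lagrange_poly[symmetric])

text \<open>
  Divide p by the Legendre polynomial, p = q * legendre_poly m + s. The first summand vanishes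
  at the nodes, and its integral vanishes by orthogonality; on s the rule is exact by
  interpolation.
\<close>
lemma gauss_exact:
  assumes "degree p < 2 * m"
  shows "(\<Sum>t\<in>gauss_nodes m. gauss_weight m t * poly p t) = integral {-1..1} (poly p)"
proof -
  note fin = gauss_nodes(1)[of m] and card = gauss_nodes(2)[of m]
  define q where "q = p div legendre_poly m"
  define s where "s = p mod legendre_poly m"
  have m: "m > 0" using assms by simp
  have nz: "legendre_poly m \<noteq> 0" using degree_legendre_poly[of m] m by auto
  have p: "p = q * legendre_poly m + s" by (simp add: q_def s_def)
  have s: "degree s < m"
    using degree_mod_less[OF nz, of p] m by (auto simp: s_def degree_legendre_poly)
  have q: "degree q < m" using assms 
  proof (cases "degree p < m")
    case True
    then show ?thesis using m by (simp add: q_def div_poly_less degree_legendre_poly)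
  next
    case False
    show ?thesis
    proof (cases "q = 0")
      case True
      then show ?thesis using m by simp
    next
      case q0: False
      have "degree (q * legendre_poly m) = degree q + m"
        using degree_mult_eq[OF q0 nz] by (simp add: degree_legendre_poly)
      moreover have "degree (q * legendre_poly m + s) = degree (q * legendre_poly m)"
        using s calculation by (intro degree_add_eq_left) simp
      ultimately have "degree p = degree q + m" using p by simp
      then show ?thesis using assms by simp
    qed
  qed 
  have "integral {-1..1} (poly p) = integral {-1..1} (poly (q * legendre_poly m)) + integral {-1..1} (poly s)"
    using integral_add[OF integrable_poly integrable_poly, of "q * legendre_poly m" s] p by (simp add: poly_add[symmetric] del: poly_add poly_mult)
  also have "\<dots> = integral {-1..1} (poly s)" by (simp add: legendre_orthogonal[OF q] del: poly_mult)
  also have "poly s = (\<lambda>x. \<Sum>t\<in>gauss_nodes m. poly s t * poly (lagrange_poly (gauss_nodes m) t) x)"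
    by (subst lagrange_interpolation[OF fin, of s]) (use s card in \<open>auto simp: poly_sum\<close>)
  also have "integral {-1..1} \<dots> = (\<Sum>t\<in>gauss_nodes m. poly s t * gauss_weight m t)"
    by (subst integral_sum) (auto simp: fin gauss_weight_eq intro!: integrable_on_mult_right[OF integrable_poly])
  also have "\<dots> = (\<Sum>t\<in>gauss_nodes m. gauss_weight m t * poly p t)"
    by (intro sum.cong) (auto simp: p gauss_nodes_def)
  finally show ?thesis ..
qed

text \<open>
  The weight is the integral of the square of the fundamental polynomial, because the rule is
  exact on this square.
\<close>
lemma gauss_weight_nonneg:
  assumes t: "t \<in> gauss_nodes m"
  shows "gauss_weight m t \<ge> 0"
proof -
  note fin = gauss_nodes(1)[of m] and card = gauss_nodes(2)[of m]
  let ?l = "lagrange_poly (gauss_nodes m) t"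
  have "degree ?l < m" using degree_lagrange_poly[OF fin t] card by simp
  then have "degree (?l ^ 2) < 2 * m" using degree_power_le[of ?l 2] by simp
  from gauss_exact[OF this]
  have "integral {-1..1} (poly (?l ^ 2)) = (\<Sum>s\<in>gauss_nodes m. gauss_weight m s * (if s = t then 1 else 0))"
  proof -
    have "(\<Sum>s\<in>gauss_nodes m. gauss_weight m s * poly (?l ^ 2) s) = (\<Sum>s\<in>gauss_nodes m. gauss_weight m s * (if s = t then 1 else 0))"
      by (rule sum.cong) (simp_all add: poly_power lagrange_poly_node[OF fin _ t])
    with \<open>(\<Sum>s\<in>gauss_nodes m. gauss_weight m s * poly (?l ^ 2) s) = integral {-1..1} (poly (?l ^ 2))\<close>
    show ?thesis by (simp only:)
  qed
  also have "\<dots> = gauss_weight m t" using fin t by (simp add: if_distrib cong: if_cong)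
  finally have "gauss_weight m t = integral {-1..1} (poly (?l ^ 2))" ..
  also have "\<dots> \<ge> 0" by (rule integral_nonneg[OF integrable_poly]) (simp add: poly_power)
  finally show ?thesis .
qed

lemma gauss_weight_sum:
  assumes "m > 0"
  shows "(\<Sum>t\<in>gauss_nodes m. gauss_weight m t) = 2"
proof -
  have "poly 1 = (\<lambda>x::real. 1)" by (rule ext) simp
  then have "integral {-1..1} (poly (1::real poly)) = 2" by (simp only:) simp
  then show ?thesis using gauss_exact[of 1 m] assms by simp
qed

lemma integral_abs_le_of_interior:
  fixes f :: "real \<Rightarrow> real"
  assumes "continuous_on {-1..1} f" "\<And>x. x \<in> {-1<..<1} \<Longrightarrow> \<bar>f x\<bar> \<le> d"
  shows "\<bar>integral {-1..1} f\<bar> \<le> 2 * d"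
proof -
  have bd: "\<bar>f x\<bar> \<le> d" if "x \<in> {-1..1}" for x
  proof -
    have "x \<in> closure {-1<..<1}" using that by simp
    moreover have "continuous_on (closure {-1<..<1}) (\<lambda>x. \<bar>f x\<bar>)"
      using assms(1) by (auto intro: continuous_on_rabs)
    ultimately show ?thesis using continuous_le_on_closure[of "{-1<..<1}" "\<lambda>x. \<bar>f x\<bar>" x d] assms(2) by blast
  qed
  have "norm (integral {-1..1} f) \<le> integral {-1..1} (\<lambda>x::real. d)"
    by (rule integral_norm_bound_integral) (use assms(1) bd in \<open>auto intro: integrable_continuous_real\<close>)
  then show ?thesis by simp
qed

lemma gauss_quadrature_le:
  assumes m: "m > 0" and b: "\<And>t. t \<in> {-1<..<1} \<Longrightarrow> \<bar>f t\<bar> \<le> b"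
  shows "\<bar>\<Sum>t\<in>gauss_nodes m. gauss_weight m t * f t\<bar> \<le> 2 * b"
proof -
  have "\<bar>\<Sum>t\<in>gauss_nodes m. gauss_weight m t * f t\<bar> \<le> (\<Sum>t\<in>gauss_nodes m. gauss_weight m t * b)"
  proof (rule order_trans[OF sum_abs], rule sum_mono)
    fix t assume t: "t \<in> gauss_nodes m"
    have tI: "t \<in> {-1<..<1}" using gauss_nodes(3)[of m] t by auto
    show "\<bar>gauss_weight m t * f t\<bar> \<le> gauss_weight m t * b"
      unfolding abs_mult abs_of_nonneg[OF gauss_weight_nonneg[OF t]]
      by (rule mult_left_mono[OF b[OF tI] gauss_weight_nonneg[OF t]])
  qed
  also have "\<dots> = 2 * b" using gauss_weight_sum[OF m] by (simp flip: sum_distrib_right)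
  finally show ?thesis .
qed

text \<open>
  Subtracting q from u does not change the error of the rule, by exactness, and both the
  integral and the rule of u - q are at most 2d, as the weights are nonnegative with sum 2.
\<close>
lemma gauss_error_le_approximation_error:
  assumes u: "continuous_on {-1..1} u" and deg: "degree q < 2 * m"
    and d: "\<And>x. x \<in> {-1<..<1} \<Longrightarrow> \<bar>u x - poly q x\<bar> \<le> d"
  shows "\<bar>integral {-1..1} u - (\<Sum>t\<in>gauss_nodes m. gauss_weight m t * u t)\<bar> \<le> 4 * d"
proof -
  have cq: "continuous_on {-1..1} (poly q)" by (intro continuous_intros)
  have 1: "\<bar>integral {-1..1} (\<lambda>x. u x - poly q x)\<bar> \<le> 2 * d"
    by (rule integral_abs_le_of_interior) (use u cq d in \<open>auto intro: continuous_on_diff\<close>)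
  have 2: "\<bar>\<Sum>t\<in>gauss_nodes m. gauss_weight m t * (u t - poly q t)\<bar> \<le> 2 * d"
    by (rule gauss_quadrature_le) (use deg d in auto)
  have "integral {-1..1} u - (\<Sum>t\<in>gauss_nodes m. gauss_weight m t * u t) =
     integral {-1..1} (\<lambda>x. u x - poly q x) - (\<Sum>t\<in>gauss_nodes m. gauss_weight m t * (u t - poly q t))"
    using integral_diff[OF integrable_continuous_real[OF u] integrable_continuous_real[OF cq]] gauss_exact[OF deg]
    by (simp add: right_diff_distrib sum_subtractf)
  then show ?thesis using 1 2 by linarith
qed

section \<open>Weighted polynomial approximation\<close>

lemma weight_pos: "x \<in> {-1<..<1} \<Longrightarrow> 0 < weight x"
  by (auto simp: weight_def abs_square_less_1 abs_less_iff)

lemma weight_le_1: "weight x \<le> 1"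
  by (simp add: weight_def)

lemma weight_cos: "t \<in> {0..pi} \<Longrightarrow> weight (cos t) = sin t"
  by (simp add: weight_def sin_ge_zero flip: sin_squared_eq)

lemma weight_between:
  assumes "y \<in> {-1<..<1}" "z \<in> {-1<..<1}" "min y z \<le> x" "x \<le> max y z"
  shows "min (weight y) (weight z) \<le> weight x"
proof -
  have "\<bar>x\<bar> \<le> max \<bar>y\<bar> \<bar>z\<bar>" using assms by auto
  then have "\<bar>x\<bar> \<le> \<bar>y\<bar> \<or> \<bar>x\<bar> \<le> \<bar>z\<bar>" by auto
  then have "x\<^sup>2 \<le> y\<^sup>2 \<or> x\<^sup>2 \<le> z\<^sup>2" by (auto simp: abs_le_square_iff)
  then show ?thesis by (auto simp: weight_def min_le_iff_disj)
qed

text \<open>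
  The bound \<bar>u'\<bar> * weight^p \<le> M in integrated form, which needs no derivative.
  Between y and z the weight is at least its minimum at the two end points.
\<close>
definition wlip :: "nat \<Rightarrow> real \<Rightarrow> (real \<Rightarrow> real) \<Rightarrow> bool" where
  "wlip p M u \<longleftrightarrow> (\<forall>y\<in>{-1<..<1}. \<forall>z\<in>{-1<..<1}.
     \<bar>u y - u z\<bar> * min (weight y) (weight z) ^ p \<le> M * \<bar>y - z\<bar>)"

lemma deriv_bound_imp_wlip:
  assumes der: "\<And>x. x \<in> {-1<..<1} \<Longrightarrow> (u has_real_derivative u' x) (at x)"
    and bound: "\<And>x. x \<in> {-1<..<1} \<Longrightarrow> \<bar>u' x\<bar> * weight x ^ p \<le> M"
  shows "wlip p M u"
proof -
  have main: "\<bar>u y - u z\<bar> * min (weight y) (weight z) ^ p \<le> M * \<bar>y - z\<bar>"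
    if yz: "y \<in> {-1<..<1}" "z \<in> {-1<..<1}" "y < z" for y z
  proof -
    obtain x where x: "y < x" "x < z" "u z - u y = (z - y) * u' x"
      using MVT2[of y z u u'] yz der by force
    have xin: "x \<in> {-1<..<1}" using x yz by auto
    have "min (weight y) (weight z) ^ p \<le> weight x ^ p"
      using weight_between[of y z x] weight_pos yz x by (intro power_mono) (auto simp: less_imp_le)
    then have "\<bar>u' x\<bar> * min (weight y) (weight z) ^ p \<le> \<bar>u' x\<bar> * weight x ^ p" by (intro mult_left_mono) auto
    then have "\<bar>u' x\<bar> * min (weight y) (weight z) ^ p \<le> M" using bound[OF xin] by linarith
    then have "(z - y) * (\<bar>u' x\<bar> * min (weight y) (weight z) ^ p) \<le> (z - y) * M" using yz by (intro mult_left_mono) auto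
    moreover have "\<bar>u y - u z\<bar> = (z - y) * \<bar>u' x\<bar>"
    proof -
      have "\<bar>u y - u z\<bar> = \<bar>(z - y) * u' x\<bar>" unfolding x(3)[symmetric] by (rule abs_minus_commute)
      then show ?thesis using yz by (simp add: abs_mult)
    qed
    ultimately show ?thesis using yz by (simp add: mult_ac)
  qed
  show ?thesis unfolding wlip_def
  proof (intro ballI)
    fix y z :: real assume yz: "y \<in> {-1<..<1}" "z \<in> {-1<..<1}"
    consider "y < z" | "z < y" | "y = z" by linarith
    then show "\<bar>u y - u z\<bar> * min (weight y) (weight z) ^ p \<le> M * \<bar>y - z\<bar>"
    proof cases
      case 1 then show ?thesis using main yz by blast
    next
      case 2 then show ?thesis using main[OF yz(2,1) 2] by (simp add: abs_minus_commute min.commute)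
    qed simp
  qed
qed

lemma sin_ge_min:
  assumes "0 \<le> a" "a \<le> t" "t \<le> b" "b \<le> pi"
  shows "min (sin a) (sin b) \<le> sin t"
proof (cases "t \<le> pi / 2")
  case True
  have "sin a \<le> sin t" by (rule sin_monotone_2pi_le) (use assms True in auto)
  then show ?thesis by simp
next
  case False
  have "sin (pi - b) \<le> sin (pi - t)" by (rule sin_monotone_2pi_le) (use assms False in auto)
  then show ?thesis by simp
qed

lemma sin_ge_half:
  assumes "0 \<le> x" "x \<le> pi / 2"
  shows "x / 2 \<le> sin x"
proof (cases "x \<le> pi / 3")
  case True
  show ?thesis
  proof (cases "x = 0")
    case False
    then obtain z where z: "0 < z" "z < x" "sin x - sin 0 = (x - 0) * cos z"
      using MVT2[of 0 x sin cos] assms by auto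
    have "cos (pi / 3) \<le> cos z" by (rule cos_monotone_0_pi_le) (use z True assms in auto)
    then have "x * (1/2) \<le> x * cos z" using assms by (intro mult_left_mono) (auto simp: cos_60)
    then show ?thesis using z by simp
  qed simp
next
  case False
  have "sin (pi / 3) \<le> sin x" by (rule sin_monotone_2pi_le) (use False assms in auto)
  moreover have "sin (pi / 3) \<ge> 0.8" 
  proof -
    have "8 / 5 \<le> sqrt 3" by (rule real_le_rsqrt) (simp add: power2_eq_square)
    then show ?thesis unfolding sin_60 by simp
  qed
  moreover have "pi < 3.2" using pi_approx by simp
  ultimately show ?thesis using assms by linarith
qed

lemma sin_diff_le: "\<bar>sin s - sin t\<bar> \<le> \<bar>s - t :: real\<bar>"
proof -
  have "\<bar>sin b - sin a\<bar> \<le> b - a" if "a < b" for a b :: real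
  proof -
    obtain z where "sin b - sin a = (b - a) * cos z" using MVT2[OF \<open>a < b\<close>, of sin cos] DERIV_sin by blast
    then show ?thesis using that mult_left_mono[OF abs_cos_le_one[of z], of "b - a"] by (simp add: abs_mult)
  qed
  from this[of s t] this[of t s] show ?thesis
    by (cases s t rule: linorder_cases) (simp_all add: abs_minus_commute)
qed

text \<open>
  The derivative -sin t of the substitution x = cos t is -weight x and absorbs one power of
  the weight. Near an angle x all sines differ from sin x by at most a third, so that
  replacing one sine by another costs at most the factor (4/3) / (2/3) = 2; these local
  estimates, taken with the constant weight c, add up along the interval from a to b.
\<close>
lemma wlip_angle:
  assumes u: "wlip (Suc i) M u" and M: "M \<ge> 0" and ab: "a \<in> {0<..<pi}" "b \<in> {0<..<pi}"
  shows "\<bar>u (cos a) - u (cos b)\<bar> * min (sin a) (sin b) ^ i \<le> 2 * M * \<bar>a - b\<bar>"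
proof -
  have main: "\<bar>u (cos b) - u (cos a)\<bar> * min (sin a) (sin b) ^ i \<le> 2 * M * (b - a)"
    if ab: "a \<in> {0<..<pi}" "b \<in> {0<..<pi}" "a \<le> b" for a b
  proof -
    define c where "c = min (sin a) (sin b)"
    have c: "c > 0" using ab by (auto simp: c_def sin_gt_zero)
    define P where "P s t \<longleftrightarrow> (a \<le> s \<and> s \<le> t \<and> t \<le> b \<longrightarrow> \<bar>u (cos t) - u (cos s)\<bar> * c ^ i \<le> 2 * M * (t - s))" for s t
    have "P a b"
      using \<open>a \<le> b\<close>
    proof (induction rule: Bolzano)
      case (trans r s t)
      show ?case unfolding P_def
      proof (intro impI)
        assume rt: "a \<le> r \<and> r \<le> t \<and> t \<le> b"
        then have "\<bar>u (cos s) - u (cos r)\<bar> * c ^ i \<le> 2 * M * (s - r)" "\<bar>u (cos t) - u (cos s)\<bar> * c ^ i \<le> 2 * M * (t - s)"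
          using trans by (auto simp: P_def)
        moreover have "\<bar>u (cos t) - u (cos r)\<bar> * c ^ i \<le> (\<bar>u (cos s) - u (cos r)\<bar> + \<bar>u (cos t) - u (cos s)\<bar>) * c ^ i"
          using c by (intro mult_right_mono) auto
        ultimately show "\<bar>u (cos t) - u (cos r)\<bar> * c ^ i \<le> 2 * M * (t - r)" by (simp add: algebra_simps)
      qed
    next
      case (local x)
      have x: "0 < x" "x < pi" using local ab by auto
      then have sx: "sin x > 0" by (simp add: sin_gt_zero)
      show ?case
      proof (intro exI[of _ "sin x / 3"] conjI allI impI)
        show "sin x / 3 > 0" using sx by simp
        fix s t assume st: "s \<le> x \<and> x \<le> t \<and> t - s < sin x / 3"
        show "P s t" unfolding P_def
        proof (intro impI)
          assume "a \<le> s \<and> s \<le> t \<and> t \<le> b"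
          then have st': "0 < s" "s \<le> t" "t < pi" "a \<le> s" "t \<le> b" using ab by auto
          show "\<bar>u (cos t) - u (cos s)\<bar> * c ^ i \<le> 2 * M * (t - s)"
          proof (cases "s = t")
            case False
            then have "s < t" using st' by simp
            then obtain z where z: "s < z" "z < t" "cos t - cos s = (t - s) * (- sin z)"
              using MVT2[of s t cos "\<lambda>x. - sin x"] by auto
            have near: "\<bar>sin y - sin x\<bar> \<le> sin x / 3" if "s \<le> y" "y \<le> t" for y
              using sin_diff_le[of y x] st that by linarith
            have sz: "0 < sin z" "sin z \<le> 4/3 * sin x" using near[of z] z sx by linarith+
            have dc: "\<bar>cos t - cos s\<bar> \<le> (t - s) * (4/3 * sin x)"
            proof -
              have "\<bar>cos t - cos s\<bar> = (t - s) * sin z" using z(3) sz \<open>s < t\<close> by (simp add: abs_mult)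
              then show ?thesis using sz \<open>s < t\<close> by (simp add: mult_left_mono)
            qed
            define m where "m = min (sin t) (sin s)"
            have "2/3 * sin x \<le> sin s" "2/3 * sin x \<le> sin t" using near[of s] near[of t] st' by linarith+
            then have m: "2/3 * sin x \<le> m" by (simp add: m_def)
            have "c \<le> sin s" "c \<le> sin t" unfolding c_def using sin_ge_min[of a s b] sin_ge_min[of a t b] st' ab by auto
            then have mc: "c ^ i \<le> m ^ i" using c by (intro power_mono) (auto simp: m_def)
            have "\<bar>u (cos t) - u (cos s)\<bar> * m ^ Suc i \<le> M * \<bar>cos t - cos s\<bar>"
            proof -
              have "cos t \<in> {-1<..<1}" "cos s \<in> {-1<..<1}"
                using st' cos_monotone_0_pi[of 0 t] cos_monotone_0_pi[of t pi] cos_monotone_0_pi[of 0 s] cos_monotone_0_pi[of s pi] by auto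
              moreover have "weight (cos t) = sin t" "weight (cos s) = sin s" using st' by (auto intro: weight_cos)
              ultimately show ?thesis using u unfolding wlip_def m_def by metis
            qed
            also have "\<dots> \<le> M * ((t - s) * (4/3 * sin x))" using dc M by (intro mult_left_mono)
            finally have 1: "\<bar>u (cos t) - u (cos s)\<bar> * m ^ Suc i \<le> M * ((t - s) * (4/3 * sin x))" .
            have "\<bar>u (cos t) - u (cos s)\<bar> * m ^ i * (2/3 * sin x) \<le> \<bar>u (cos t) - u (cos s)\<bar> * m ^ i * m"
              using m sx by (intro mult_left_mono mult_nonneg_nonneg zero_le_power) auto
            with 1 have "(\<bar>u (cos t) - u (cos s)\<bar> * m ^ i) * (2/3 * sin x) \<le> (2 * M * (t - s)) * (2/3 * sin x)"
              by (simp add: mult_ac)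
            then have "\<bar>u (cos t) - u (cos s)\<bar> * m ^ i \<le> 2 * M * (t - s)"
              by (rule mult_right_le_imp_le) (use sx in simp)
            moreover have "\<bar>u (cos t) - u (cos s)\<bar> * c ^ i \<le> \<bar>u (cos t) - u (cos s)\<bar> * m ^ i"
              using mc by (intro mult_left_mono) auto
            ultimately show ?thesis by linarith
          qed simp
        qed
      qed
    qed
    then show ?thesis using \<open>a \<le> b\<close> by (simp add: P_def c_def)
  qed
  show ?thesis
  proof (cases "a \<le> b")
    case True
    then show ?thesis using main[OF ab True] by (simp add: abs_minus_commute)
  next
    case False
    then show ?thesis using main[OF ab(2,1)] by (simp add: min.commute)
  qed
qed

definition cospoly :: "nat \<Rightarrow> (real \<Rightarrow> real) \<Rightarrow> bool" where
  "cospoly d f \<longleftrightarrow> (\<exists>a. \<forall>w. f w = (\<Sum>k\<le>d. a k * cos (real k * w)))"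

lemma cospoly_add: "cospoly d f \<Longrightarrow> cospoly d g \<Longrightarrow> cospoly d (\<lambda>w. f w + g w)"
  unfolding cospoly_def
proof (elim exE)
  fix a b assume "\<forall>w. f w = (\<Sum>k\<le>d. a k * cos (real k * w))" "\<forall>w. g w = (\<Sum>k\<le>d. b k * cos (real k * w))"
  then show "\<exists>a. \<forall>w. f w + g w = (\<Sum>k\<le>d. a k * cos (real k * w))"
    by (intro exI[of _ "\<lambda>k. a k + b k"]) (simp add: sum.distrib distrib_right)
qed

lemma cospoly_cos: "n \<le> d \<Longrightarrow> cospoly d (\<lambda>w. c * cos (real n * w))"
  unfolding cospoly_def
  by (intro exI[of _ "\<lambda>k. if k = n then c else 0"]) (simp add: if_distrib[of "\<lambda>x. x * _"] cong: if_cong)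

lemma cospoly_sum: "finite A \<Longrightarrow> (\<And>x. x \<in> A \<Longrightarrow> cospoly d (f x)) \<Longrightarrow> cospoly d (\<lambda>w. \<Sum>x\<in>A. f x w)"
proof (induction A rule: finite_induct)
  case empty
  show ?case using cospoly_cos[of 0 d 0] by simp
next
  case (insert x A)
  then show ?case using cospoly_add[of d "f x" "\<lambda>w. \<Sum>x\<in>A. f x w"] by simp
qed

lemma cospoly_mult:
  assumes "cospoly d f" "cospoly e g"
  shows "cospoly (d + e) (\<lambda>w. f w * g w)"
proof -
  obtain a b where ab: "\<And>w. f w = (\<Sum>k\<le>d. a k * cos (real k * w))" "\<And>w. g w = (\<Sum>k\<le>e. b k * cos (real k * w))"
    using assms unfolding cospoly_def by blast
  have prod: "cospoly (d + e) (\<lambda>w. (a j * cos (real j * w)) * (b k * cos (real k * w)))" if jk: "j \<le> d" "k \<le> e" for j k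
  proof -
    define n where "n = (if j \<le> k then k - j else j - k)"
    have n: "cos (real j * w - real k * w) = cos (real n * w)" for w
    proof (cases "j \<le> k")
      case True
      then have "real j * w - real k * w = - (real n * w)" by (simp add: n_def of_nat_diff algebra_simps)
      then show ?thesis by (metis cos_minus)
    next
      case False
      then show ?thesis by (simp add: n_def of_nat_diff algebra_simps)
    qed
    have "(a j * cos (real j * w)) * (b k * cos (real k * w)) =
      (a j * b k / 2) * cos (real n * w) + (a j * b k / 2) * cos (real (j + k) * w)" for w
    proof -
      have "(a j * cos (real j * w)) * (b k * cos (real k * w)) = a j * b k * (cos (real j * w) * cos (real k * w))" by simp
      also have "cos (real j * w) * cos (real k * w) = (cos (real n * w) + cos (real (j + k) * w)) / 2"
        by (simp only: cos_times_cos n of_nat_add distrib_right)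
      finally show ?thesis by (simp add: field_simps)
    qed
    moreover have "n \<le> d + e" "j + k \<le> d + e" using jk by (auto simp: n_def)
    ultimately show ?thesis by (simp only:) (intro cospoly_add cospoly_cos)
  qed
  have "f w * g w = (\<Sum>j\<le>d. \<Sum>k\<le>e. (a j * cos (real j * w)) * (b k * cos (real k * w)))" for w
    by (simp only: ab sum_product)
  then show ?thesis using prod by (simp only:) (intro cospoly_sum; simp)
qed

lemma cospoly_power: "cospoly d f \<Longrightarrow> cospoly (n * d) (\<lambda>w. f w ^ n)"
proof (induction n)
  case 0
  show ?case using cospoly_cos[of 0 0 1] by simp
next
  case (Suc n)
  then show ?case using cospoly_mult[of d f "n * d" "\<lambda>w. f w ^ n"] by simp
qed

lemma chebyshev_cos: "\<exists>p. degree p \<le> n \<and> (\<forall>t. cos (real n * t) = poly p (cos t))"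
proof (induction n rule: less_induct)
  case (less n)
  consider "n = 0" | "n = 1" | k where "n = Suc (Suc k)" by (metis One_nat_def not0_implies_Suc)
  then show ?case
  proof cases
    case 1 then show ?thesis by (intro exI[of _ 1]) simp
  next
    case 2 then show ?thesis by (intro exI[of _ "[:0, 1:]"]) simp
  next
    case 3
    obtain p q where p: "degree p \<le> k" "\<And>t. cos (real k * t) = poly p (cos t)"
      and q: "degree q \<le> Suc k" "\<And>t. cos (real (Suc k) * t) = poly q (cos t)"
      using less.IH[of k] less.IH[of "Suc k"] 3 by auto
    have "cos (real n * t) = poly ([:0, 2:] * q - p) (cos t)" for t
    proof -
      have e: "real n * t = real (Suc k) * t + t" "real k * t = real (Suc k) * t - t"
        by (auto simp: 3 algebra_simps)
      have "cos (real n * t) + cos (real k * t) = 2 * cos t * cos (real (Suc k) * t)"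
        unfolding e by (simp add: cos_add cos_diff)
      then show ?thesis by (simp add: p(2)[symmetric] q(2)[symmetric] algebra_simps)
    qed
    moreover have "degree ([:0, 2:] * q - p) \<le> n"
    proof (rule degree_diff_le)
      show "degree ([:0, 2:] * q) \<le> n" using degree_mult_le[of "[:0, 2:]" q] q(1) 3 by simp
      show "degree p \<le> n" using p(1) 3 by simp
    qed
    ultimately show ?thesis by blast
  qed
qed

text \<open>
  The symmetrization in v turns a summand of frequency k into a multiple of cos (k t) cos (k
  v), so that the integral is a combination of Chebyshev polynomials in cos t.
\<close>
lemma cospoly_convolution:
  assumes f: "cospoly d f" and w: "continuous_on {0..pi} w"
  obtains q where "degree q \<le> d" "\<And>t. integral {0..pi} (\<lambda>v. (f (t - v) + f (t + v)) * w v) = poly q (cos t)"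
proof -
  obtain a where a: "\<And>w. f w = (\<Sum>k\<le>d. a k * cos (real k * w))" using f unfolding cospoly_def by blast
  obtain T where T: "\<And>k. degree (T k) \<le> k" "\<And>k t. cos (real k * t) = poly (T k) (cos t)"
    using chebyshev_cos by metis
  define I where "I k = integral {0..pi} (\<lambda>v. cos (real k * v) * w v)" for k
  define q where "q = (\<Sum>k\<le>d. smult (2 * a k * I k) (T k))"
  show ?thesis
  proof
    show "degree q \<le> d" unfolding q_def
      by (rule degree_sum_le) (use T(1) in \<open>auto intro: order_trans[OF degree_smult_le] order_trans\<close>)
    fix t
    have "(f (t - v) + f (t + v)) * w v = (\<Sum>k\<le>d. (2 * a k * cos (real k * t)) * (cos (real k * v) * w v))" for v
    proof -
      have "f (t - v) + f (t + v) = (\<Sum>k\<le>d. 2 * a k * cos (real k * t) * cos (real k * v))"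
        unfolding a sum.distrib[symmetric]
        by (intro sum.cong refl) (simp add: right_diff_distrib distrib_left cos_add cos_diff algebra_simps)
      then show ?thesis by (simp add: sum_distrib_right mult.assoc)
    qed
    then have "integral {0..pi} (\<lambda>v. (f (t - v) + f (t + v)) * w v) = (\<Sum>k\<le>d. (2 * a k * cos (real k * t)) * I k)"
      unfolding I_def by (simp only:) (subst integral_sum; auto intro!: integrable_on_mult_right integrable_continuous_real continuous_intros w)
    also have "\<dots> = poly q (cos t)" unfolding q_def poly_sum by (intro sum.cong) (auto simp: T(2))
    finally show "integral {0..pi} (\<lambda>v. (f (t - v) + f (t + v)) * w v) = poly q (cos t)" .
  qed
qed

lemma integral_cos_multiple: "k > 0 \<Longrightarrow> integral {0..pi} (\<lambda>v. cos (real k * v)) = 0"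
proof (rule integral_unique)
  assume k: "k > 0"
  have "((\<lambda>v. cos (real k * v)) has_integral (sin (real k * pi) / real k - sin (real k * 0) / real k)) {0..pi}"
  proof (rule fundamental_theorem_of_calculus)
    fix x :: real
    show "((\<lambda>v. sin (real k * v) / real k) has_vector_derivative cos (real k * x)) (at x within {0..pi})"
      unfolding has_real_derivative_iff_has_vector_derivative[symmetric]
      using k by (auto intro!: derivative_eq_intros)
  qed simp
  then show "((\<lambda>v. cos (real k * v)) has_integral 0) {0..pi}" by (simp add: sin_npi)
qed

text \<open>
  Only the constant term has a nonzero integral, so that the total mass does not depend on t.
\<close>
lemma cospoly_total:
  assumes f: "cospoly d f"
  shows "integral {0..pi} (\<lambda>v. f (t - v) + f (t + v)) = 2 * integral {0..pi} f"
proof -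
  obtain a where a: "\<And>w. f w = (\<Sum>k\<le>d. a k * cos (real k * w))" using f unfolding cospoly_def by blast
  have 1: "f (t - v) + f (t + v) = (\<Sum>k\<le>d. (2 * a k * cos (real k * t)) * cos (real k * v))" for v t
    unfolding a sum.distrib[symmetric]
    by (intro sum.cong refl) (simp add: right_diff_distrib distrib_left cos_add cos_diff algebra_simps)
  have 2: "integral {0..pi} (\<lambda>v. f (t - v) + f (t + v)) = (\<Sum>k\<le>d. (2 * a k * cos (real k * t)) * integral {0..pi} (\<lambda>v. cos (real k * v)))" for t
    unfolding 1 by (subst integral_sum) (auto intro!: integrable_on_mult_right integrable_continuous_real continuous_intros)
  have 3: "integral {0..pi} (\<lambda>v. f (t - v) + f (t + v)) = 2 * a 0 * pi" for t
  proof -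
    have "(\<Sum>k\<le>d. (2 * a k * cos (real k * t)) * integral {0..pi} (\<lambda>v. cos (real k * v))) =
      (\<Sum>k\<in>{0}. (2 * a k * cos (real k * t)) * integral {0..pi} (\<lambda>v. cos (real k * v)))"
      by (rule sum.mono_neutral_right) (auto simp: integral_cos_multiple)
    then show ?thesis unfolding 2 by simp
  qed
  have even: "f (- v) = f v" for v by (simp add: a)
  have "integral {0..pi} (\<lambda>v. f (0 - v) + f (0 + v)) = integral {0..pi} (\<lambda>v. 2 * f v)"
    by (simp add: even)
  then show ?thesis using 3[of t] 3[of 0] by simp
qed

definition dirichlet :: "nat \<Rightarrow> real \<Rightarrow> real" where
  "dirichlet n w = 1 + (\<Sum>k=1..n. 2 * cos (real k * w))"

lemma cospoly_dirichlet: "cospoly n (dirichlet n)"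
proof -
  have "cospoly n (\<lambda>w. 1 * cos (real 0 * w) + (\<Sum>k=1..n. 2 * cos (real k * w)))"
    by (intro cospoly_add cospoly_cos cospoly_sum) auto
  moreover have "(\<lambda>w. 1 * cos (real 0 * w) + (\<Sum>k=1..n. 2 * cos (real k * w))) = dirichlet n"
    by (rule ext) (simp add: dirichlet_def)
  ultimately show ?thesis by (simp only:)
qed

lemma dirichlet_sin: "dirichlet n w * sin (w / 2) = sin ((real n + 1/2) * w)"
proof (induction n)
  case (Suc n)
  have e: "(real (Suc n) + 1/2) * w = real (Suc n) * w + w / 2" "(real n + 1/2) * w = real (Suc n) * w - w / 2"
    by (auto simp: algebra_simps)
  have "dirichlet (Suc n) w * sin (w / 2) = dirichlet n w * sin (w / 2) + 2 * cos (real (Suc n) * w) * sin (w / 2)"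
    by (simp add: dirichlet_def distrib_right)
  also have "\<dots> = sin (real (Suc n) * w - w / 2) + 2 * cos (real (Suc n) * w) * sin (w / 2)"
    unfolding Suc.IH e(2) ..
  also have "\<dots> = sin (real (Suc n) * w + w / 2)" by (simp only: sin_add sin_diff)
  finally show ?case unfolding e(1) .
qed (simp add: dirichlet_def)

lemma dirichlet_le: "\<bar>dirichlet n w\<bar> \<le> 2 * real n + 1"
proof -
  have "\<bar>\<Sum>k=1..n. 2 * cos (real k * w)\<bar> \<le> (\<Sum>k=1..n. 2)"
    by (rule order_trans[OF sum_abs]) (intro sum_mono, simp add: abs_mult)
  then show ?thesis by (simp add: dirichlet_def)
qed

lemma dirichlet_ge:
  assumes "0 \<le> w" "w \<le> 1 / (2 * real n + 1)"
  shows "(2 * real n + 1) / 2 \<le> dirichlet n w"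
proof -
  have "(\<Sum>k=1..n. 1) \<le> (\<Sum>k=1..n. 2 * cos (real k * w))"
  proof (rule sum_mono)
    fix k assume k: "k \<in> {1..n}"
    have "real k * w \<le> real n * (1 / (2 * real n + 1))" using k assms by (intro mult_mono) auto
    also have "\<dots> \<le> 1 / 2" by (simp add: field_simps)
    also have "\<dots> \<le> pi / 3" using pi_gt3 by simp
    finally have "cos (pi / 3) \<le> cos (real k * w)" using assms by (intro cos_monotone_0_pi_le) auto
    then show "1 \<le> 2 * cos (real k * w)" by (simp add: cos_60)
  qed
  then show ?thesis by (simp add: dirichlet_def)
qed

text \<open>
  The kernel decays in \<bar>t - v\<bar> also when its argument is t + v, because on [0,\<pi>]
  sin^2 ((t + v) / 2) - sin^2 ((t - v) / 2) = sin t * sin v \<ge> 0.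
\<close>
lemma jackson_kernel_decay:
  assumes tv: "t \<in> {0..pi}" "v \<in> {0..pi}" and w: "w = t - v \<or> w = t + v"
  shows "\<bar>dirichlet n w\<bar> * (1 + (2 * real n + 1) * \<bar>t - v\<bar>) \<le> 5 * (2 * real n + 1)"
proof -
  let ?N = "2 * real n + 1"
  have 1: "\<bar>sin ((t - v) / 2)\<bar> \<le> \<bar>sin (w / 2)\<bar>"
  proof -
    have "(sin ((t + v) / 2))\<^sup>2 - (sin ((t - v) / 2))\<^sup>2 = sin t * sin v"
    proof -
      have "(sin ((t + v) / 2))\<^sup>2 - (sin ((t - v) / 2))\<^sup>2 = (cos (t - v) - cos (t + v)) / 2"
      proof -
        have "2 * ((t + v) / 2) = t + v" "2 * ((t - v) / 2) = t - v" by (simp_all only: mult_2 field_sum_of_halves)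
        then have "cos (t + v) = 1 - 2 * (sin ((t + v) / 2))\<^sup>2" "cos (t - v) = 1 - 2 * (sin ((t - v) / 2))\<^sup>2"
          using cos_double_sin[of "(t + v) / 2"] cos_double_sin[of "(t - v) / 2"] by (simp_all only:)
        then show ?thesis by simp
      qed
      then show ?thesis by (simp add: cos_add cos_diff)
    qed
    moreover have "0 \<le> sin t * sin v" using tv by (simp add: sin_ge_zero)
    ultimately show ?thesis using w by (auto simp: abs_le_square_iff)
  qed
  have 2: "\<bar>t - v\<bar> \<le> 4 * \<bar>sin ((t - v) / 2)\<bar>"
  proof -
    have "\<bar>t - v\<bar> / 2 / 2 \<le> sin (\<bar>t - v\<bar> / 2)" by (rule sin_ge_half) (use tv in auto)
    moreover have "sin (\<bar>t - v\<bar> / 2) \<le> \<bar>sin ((t - v) / 2)\<bar>"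
    proof (cases "t \<ge> v")
      case False
      then have "\<bar>t - v\<bar> = - (t - v)" by simp
      then have "\<bar>t - v\<bar> / 2 = - ((t - v) / 2)" by (simp only: minus_divide_left)
      then have "sin (\<bar>t - v\<bar> / 2) = - sin ((t - v) / 2)" by (simp only: sin_minus)
      then show ?thesis by simp
    qed simp
    ultimately have "\<bar>t - v\<bar> / 2 / 2 \<le> \<bar>sin ((t - v) / 2)\<bar>" by (rule order_trans)
    then show ?thesis by simp
  qed
  have "\<bar>dirichlet n w\<bar> * \<bar>t - v\<bar> \<le> \<bar>dirichlet n w\<bar> * (4 * \<bar>sin (w / 2)\<bar>)"
    using 1 2 by (intro mult_left_mono) auto
  also have "\<dots> = 4 * \<bar>dirichlet n w * sin (w / 2)\<bar>" by (simp add: abs_mult)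
  also have "\<dots> \<le> 4" unfolding dirichlet_sin by simp
  finally have "?N * (\<bar>dirichlet n w\<bar> * \<bar>t - v\<bar>) \<le> ?N * 4" by (intro mult_left_mono) auto
  then show ?thesis using dirichlet_le[of n w] by (simp add: algebra_simps)
qed

lemma integral_inverse_square_decay:
  assumes N: "N > 0" and t: "t \<in> {0..pi}"
  shows "(\<lambda>v. 1 / (1 + N * \<bar>t - v\<bar>)\<^sup>2) integrable_on {0..pi}"
    "integral {0..pi} (\<lambda>v. 1 / (1 + N * \<bar>t - v\<bar>)\<^sup>2) \<le> 2 / N"
proof -
  define G where "G v = (v - t) / (1 + N * \<bar>t - v\<bar>)" for v
  have pos: "1 + N * \<bar>t - v\<bar> > 0" for v using N by (simp add: add_pos_nonneg)
  have "((\<lambda>v. 1 / (1 + N * \<bar>t - v\<bar>)\<^sup>2) has_integral (G pi - G 0)) {0..pi}"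
  proof (rule fundamental_theorem_of_calculus_interior_strong[of "{t}"])
    show "continuous_on {0..pi} G" unfolding G_def
      by (intro continuous_intros) (use pos in \<open>auto simp: less_imp_neq[symmetric]\<close>)
    fix v assume v: "v \<in> {0<..<pi} - {t}"
    show "(G has_vector_derivative 1 / (1 + N * \<bar>t - v\<bar>)\<^sup>2) (at v)"
      unfolding has_real_derivative_iff_has_vector_derivative[symmetric]
    proof (cases "v > t")
      case True
      have "1 + N * (v - t) \<noteq> 0" using pos[of v] True by auto
      then have "((\<lambda>v. (v - t) / (1 + N * (v - t))) has_real_derivative 1 / (1 + N * (v - t))\<^sup>2) (at v)"
        by (auto intro!: derivative_eq_intros simp: power2_eq_square) 
      then show "(G has_real_derivative 1 / (1 + N * \<bar>t - v\<bar>)\<^sup>2) (at v)"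
        using True by (intro has_field_derivative_transform_within_open[of _ _ _ "{t<..}" G]) (auto simp: G_def)
    next
      case False
      then have vt: "v < t" using v by auto
      have "1 + N * (t - v) \<noteq> 0" using pos[of v] vt by auto
      then have "((\<lambda>v. (v - t) / (1 + N * (t - v))) has_real_derivative 1 / (1 + N * (t - v))\<^sup>2) (at v)"
        by (auto intro!: derivative_eq_intros simp: power2_eq_square algebra_simps)
      then show "(G has_real_derivative 1 / (1 + N * \<bar>t - v\<bar>)\<^sup>2) (at v)"
        using vt by (intro has_field_derivative_transform_within_open[of _ _ _ "{..<t}" G]) (auto simp: G_def)
    qed
  qed auto
  moreover have "\<bar>G v\<bar> \<le> 1 / N" for v
  proof -
    have "\<bar>G v\<bar> = \<bar>t - v\<bar> / (1 + N * \<bar>t - v\<bar>)" using pos[of v] by (simp add: G_def abs_minus_commute)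
    also have "\<dots> \<le> 1 / N" using N pos[of v] by (simp add: divide_simps)
    finally show ?thesis .
  qed
  then have "\<bar>G pi\<bar> \<le> 1 / N" "\<bar>G 0\<bar> \<le> 1 / N" by blast+
  then have "G pi - G 0 \<le> 2 / N" by linarith
  ultimately show "(\<lambda>v. 1 / (1 + N * \<bar>t - v\<bar>)\<^sup>2) integrable_on {0..pi}"
    "integral {0..pi} (\<lambda>v. 1 / (1 + N * \<bar>t - v\<bar>)\<^sup>2) \<le> 2 / N"
    by (auto simp: integral_unique has_integral_integrable)
qed

lemma dirichlet_power_total:
  shows "(2 * real n + 1) ^ (2 * p) / (2 * real n + 1) / 4 ^ p \<le> integral {0..pi} (\<lambda>w. dirichlet n w ^ (2 * p))"
proof -
  let ?N = "2 * real n + 1"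
  have cont: "continuous_on S (\<lambda>w. dirichlet n w ^ (2 * p))" for S
    unfolding dirichlet_def by (intro continuous_intros)
  have Npi: "1 / ?N \<le> pi"
  proof -
    have "1 / ?N \<le> 1" by simp
    then show ?thesis using pi_gt3 by linarith
  qed
  have "(?N / 2) ^ (2 * p) * (1 / ?N - 0) \<le> integral {0..1 / ?N} (\<lambda>w. dirichlet n w ^ (2 * p))"
  proof -
    have "integral {0..1 / ?N} (\<lambda>w. (?N / 2) ^ (2 * p)) \<le> integral {0..1 / ?N} (\<lambda>w. dirichlet n w ^ (2 * p))"
    proof (rule integral_le)
      show "(\<lambda>w. dirichlet n w ^ (2 * p)) integrable_on {0..1 / ?N}"
        by (rule integrable_continuous_real[OF cont])
      fix w assume "w \<in> {0..1 / ?N}"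
      then show "(?N / 2) ^ (2 * p) \<le> dirichlet n w ^ (2 * p)"
        by (intro power_mono dirichlet_ge) auto
    qed auto
    then show ?thesis by simp
  qed
  also have "\<dots> \<le> integral {0..pi} (\<lambda>w. dirichlet n w ^ (2 * p))"
    by (rule integral_subset_le[OF _ integrable_continuous_real[OF cont] integrable_continuous_real[OF cont]])
       (use Npi in \<open>auto simp: power_mult\<close>)
  finally show ?thesis by (simp add: power_divide power_mult)
    (simp add: mult.commute power_mult)
qed

text \<open>
  The kernel decays like (N * \<bar>t - v\<bar>)^(-2p), and i + 3 \<le> 2p leaves an
  integrable inverse square after the i + 1 growing factors are absorbed. The total mass of
  the kernel is at least of the order N^(2p-1), so one factor 1/N is gained. The factor (1 + 2
  * N * \<bar>t - v\<bar>)^i is the price for moving the weight from v to t in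
  weighted_jackson.
\<close>
lemma jackson_moment:
  fixes i p n :: nat and t :: real
  defines "N \<equiv> 2 * real n + 1"
  assumes ip: "i + 3 \<le> 2 * p" and t: "t \<in> {0..pi}"
  defines "K \<equiv> \<lambda>w. dirichlet n w ^ (2 * p)"
  shows "integral {0..pi} (\<lambda>v. (K (t - v) + K (t + v)) * (\<bar>t - v\<bar> * (1 + 2 * N * \<bar>t - v\<bar>) ^ i))
    \<le> 2 ^ i * 4 * 100 ^ p / N * integral {0..pi} K"
proof -
  have N: "N \<ge> 1" by (simp add: N_def)
  have contK: "continuous_on S K" for S unfolding K_def dirichlet_def by (intro continuous_intros)
  have K0: "K w \<ge> 0" for w by (simp add: K_def power_mult)
  have bound: "(K (t - v) + K (t + v)) * (\<bar>t - v\<bar> * (1 + 2 * N * \<bar>t - v\<bar>) ^ i)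
     \<le> 2 ^ i * 2 * (5 * N) ^ (2 * p) / N * (1 / (1 + N * \<bar>t - v\<bar>)\<^sup>2)" if v: "v \<in> {0..pi}" for v
  proof -
    define d where "d = \<bar>t - v\<bar>"
    define x where "x = 1 + N * d"
    have d: "d \<ge> 0" and x: "x \<ge> 1" using N by (auto simp: d_def x_def)
    have Kx: "K w * x ^ (2 * p) \<le> (5 * N) ^ (2 * p)" if "w = t - v \<or> w = t + v" for w
    proof -
      have "\<bar>dirichlet n w\<bar> * x \<le> 5 * N"
        using jackson_kernel_decay[OF t v that, of n] by (simp add: x_def d_def N_def)
      then have "(\<bar>dirichlet n w\<bar> * x) ^ (2 * p) \<le> (5 * N) ^ (2 * p)"
        using x by (intro power_mono) auto
      then show ?thesis by (simp add: K_def power_mult_distrib power_even_abs)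
    qed
    have x2: "x ^ (i + 1) * x\<^sup>2 \<le> x ^ (2 * p)"
    proof -
      have "x ^ (i + 1) * x\<^sup>2 = x ^ (i + 1 + 2)" by (simp only: power_add)
      also have "\<dots> \<le> x ^ (2 * p)" by (rule power_increasing) (use ip x in auto)
      finally show ?thesis .
    qed
    have Kx': "K w * x ^ (i + 1) * x\<^sup>2 \<le> (5 * N) ^ (2 * p)" if "w = t - v \<or> w = t + v" for w
      using mult_left_mono[OF x2 K0[of w]] Kx[OF that] by (simp add: mult.assoc)
    have Nd: "N * (d * (1 + 2 * N * d) ^ i) \<le> 2 ^ i * x ^ (i + 1)"
    proof -
      have "(1 + 2 * N * d) ^ i \<le> (2 * x) ^ i" using d N by (intro power_mono) (auto simp: x_def)
      then have "(N * d) * (1 + 2 * N * d) ^ i \<le> x * (2 * x) ^ i"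
        using d N x by (intro mult_mono) (auto simp: x_def)
      then show ?thesis by (simp add: power_mult_distrib mult_ac)
    qed
    have "(K (t - v) + K (t + v)) * (N * (d * (1 + 2 * N * d) ^ i)) * x\<^sup>2
      \<le> (K (t - v) + K (t + v)) * (2 ^ i * x ^ (i + 1)) * x\<^sup>2"
      using K0 by (intro mult_right_mono mult_left_mono Nd) (auto simp: add_nonneg_nonneg)
    also have "\<dots> = 2 ^ i * (K (t - v) * x ^ (i + 1) * x\<^sup>2 + K (t + v) * x ^ (i + 1) * x\<^sup>2)"
      by (simp add: algebra_simps)
    also have "\<dots> \<le> 2 ^ i * ((5 * N) ^ (2 * p) + (5 * N) ^ (2 * p))"
      by (intro mult_left_mono add_mono Kx') auto
    finally have "(K (t - v) + K (t + v)) * (d * (1 + 2 * N * d) ^ i) * (N * x\<^sup>2) \<le> 2 ^ i * 2 * (5 * N) ^ (2 * p)"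
      by (simp add: mult_ac)
    moreover have "N * x\<^sup>2 > 0" using N x by simp
    ultimately have "(K (t - v) + K (t + v)) * (d * (1 + 2 * N * d) ^ i) \<le> 2 ^ i * 2 * (5 * N) ^ (2 * p) / (N * x\<^sup>2)"
      by (simp only: pos_le_divide_eq)
    then show ?thesis by (simp add: d_def x_def)
  qed
  note dec = integral_inverse_square_decay[of N t, OF _ t]
  have "integral {0..pi} (\<lambda>v. (K (t - v) + K (t + v)) * (\<bar>t - v\<bar> * (1 + 2 * N * \<bar>t - v\<bar>) ^ i))
    \<le> integral {0..pi} (\<lambda>v. 2 ^ i * 2 * (5 * N) ^ (2 * p) / N * (1 / (1 + N * \<bar>t - v\<bar>)\<^sup>2))"
  proof (rule integral_le)
    show "(\<lambda>v. (K (t - v) + K (t + v)) * (\<bar>t - v\<bar> * (1 + 2 * N * \<bar>t - v\<bar>) ^ i)) integrable_on {0..pi}"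
      by (intro integrable_continuous_real continuous_intros continuous_on_compose2[OF contK]) auto
    show "(\<lambda>v. 2 ^ i * 2 * (5 * N) ^ (2 * p) / N * (1 / (1 + N * \<bar>t - v\<bar>)\<^sup>2)) integrable_on {0..pi}"
      by (intro integrable_on_mult_right dec) (use N in auto)
  qed (use bound in blast)
  also have "\<dots> = 2 ^ i * 2 * (5 * N) ^ (2 * p) / N * integral {0..pi} (\<lambda>v. 1 / (1 + N * \<bar>t - v\<bar>)\<^sup>2)"
    by (rule integral_mult_right)
  also have "\<dots> \<le> 2 ^ i * 2 * (5 * N) ^ (2 * p) / N * (2 / N)"
    by (intro mult_left_mono dec) (use N in auto)
  also have "\<dots> = (2 ^ i * 4 * 100 ^ p / N) * (N ^ (2 * p) / N / 4 ^ p)"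
  proof -
    have "(5 * N) ^ (2 * p) = 25 ^ p * N ^ (2 * p)" by (simp add: power_mult_distrib power_mult)
    moreover have "(100::real) ^ p = 25 ^ p * 4 ^ p" by (simp flip: power_mult_distrib)
    ultimately show ?thesis using N by (simp add: field_simps)
  qed
  also have "\<dots> \<le> (2 ^ i * 4 * 100 ^ p / N) * integral {0..pi} K"
    using dirichlet_power_total[of n p] N by (intro mult_left_mono) (auto simp: N_def K_def)
  finally show ?thesis .
qed

lemma wlip_isCont:
  assumes u: "wlip (Suc i) E u" and x: "x \<in> {-1<..<1}"
  shows "isCont u x"
proof -
  define c where "c = weight x / 2"
  have c: "0 < c" "c < weight x" using weight_pos[OF x] by (auto simp: c_def)
  have "isCont weight x" unfolding weight_def by (intro continuous_intros)
  then have "((\<lambda>y. weight y) \<longlongrightarrow> weight x) (at x)" by (simp add: isCont_def)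
  then have 1: "\<forall>\<^sub>F y in at x. c < weight y" using c(2) by (rule order_tendstoD)
  have 2: "\<forall>\<^sub>F y in at x. y \<in> {-1<..<1}" using x by (intro eventually_at_in_open') auto
  have 3: "\<forall>\<^sub>F y in at x. norm (u y - u x) \<le> E / c ^ Suc i * \<bar>y - x\<bar>"
    using 1 2
  proof eventually_elim
    case (elim y)
    have "c ^ Suc i \<le> min (weight y) (weight x) ^ Suc i" using elim c by (intro power_mono) auto
    then have "\<bar>u y - u x\<bar> * c ^ Suc i \<le> \<bar>u y - u x\<bar> * min (weight y) (weight x) ^ Suc i" by (intro mult_left_mono) auto
    also have "\<dots> \<le> E * \<bar>y - x\<bar>" using u elim(2) x unfolding wlip_def by blast
    finally show ?case using c by (simp add: pos_le_divide_eq)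
  qed
  have "((\<lambda>y. E / c ^ Suc i * \<bar>y - x\<bar>) \<longlongrightarrow> E / c ^ Suc i * \<bar>x - x\<bar>) (at x)" by (intro tendsto_intros)
  then have "((\<lambda>y. u y - u x) \<longlongrightarrow> 0) (at x)" using 3 by (intro Lim_null_comparison[OF 3]) simp
  then show "isCont u x" by (simp add: isCont_def LIM_zero_iff)
qed

text \<open>
  Jackson's theorem for the weighted maximum norm. In the angle t, u is first made constant
  within distance \<tau> = 1/N of the end points 0 and \<pi>, at an error of order E/N. On the
  remaining angles the sine is at least 1/(2N), so that it can grow from v to t at most by the
  factor 1 + 2 * N * \<bar>t - v\<bar>. The modified function is then convolved with the even
  kernel D_n^(2p), normalized, where D_n is the Dirichlet kernel; the moment bound
  jackson_moment controls the error.
\<close>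
theorem weighted_jackson:
  assumes ip: "i + 3 \<le> 2 * p" and u: "wlip (Suc i) E u" and E: "E \<ge> 0"
  obtains q where "degree q \<le> 2 * p * n"
    "\<And>x. x \<in> {-1<..<1} \<Longrightarrow> \<bar>u x - poly q x\<bar> * weight x ^ i \<le> 2 ^ i * 6 * 100 ^ p * E / (2 * real n + 1)"
proof -
  define N where "N = 2 * real n + 1"
  have N: "N \<ge> 1" by (simp add: N_def)
  define \<tau> where "\<tau> = 1 / N"
  have \<tau>: "0 < \<tau>" "\<tau> \<le> 1" using N by (auto simp: \<tau>_def)
  have pi3: "pi > 3" by (rule pi_gt3)
  define \<psi> where "\<psi> t = max \<tau> (min (pi - \<tau>) t)" for t
  have \<psi>: "\<psi> t \<in> {\<tau>..pi - \<tau>}" "\<psi> t \<in> {0<..<pi}" for t using \<tau> pi3 by (auto simp: \<psi>_def)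
  have \<psi>_lip: "\<bar>\<psi> s - \<psi> t\<bar> \<le> \<bar>s - t\<bar>" for s t by (auto simp: \<psi>_def)
  define S where "S t = sin (\<psi> t)" for t
  have S_low: "1 / (2 * N) \<le> S t" for t
  proof -
    have "\<tau> / 2 \<le> sin \<tau>" using \<tau> pi3 by (intro sin_ge_half) auto
    also have "\<dots> \<le> S t" using sin_ge_min[of \<tau> "\<psi> t" "pi - \<tau>"] \<psi>(1)[of t] \<tau> by (auto simp: S_def)
    finally show ?thesis by (simp add: \<tau>_def)
  qed
  have S_pos: "S t > 0" for t using \<psi>(2)[of t] by (auto simp: S_def sin_gt_zero)
  have S_sin: "sin t \<le> S t" if t: "t \<in> {0<..<pi}" for t
  proof -
    consider "t < \<tau>" | "t > pi - \<tau>" | "\<tau> \<le> t" "t \<le> pi - \<tau>" by linarith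
    then show ?thesis
    proof cases
      case 1
      then have "sin t \<le> sin \<tau>" using t \<tau> pi3 by (intro sin_monotone_2pi_le) auto
      then show ?thesis using 1 \<tau> pi3 by (simp add: S_def \<psi>_def)
    next
      case 2
      then have "sin (pi - t) \<le> sin \<tau>" using t \<tau> pi3 by (intro sin_monotone_2pi_le) auto
      then show ?thesis using 2 \<tau> pi3 by (simp add: S_def \<psi>_def)
    next
      case 3
      then show ?thesis by (simp add: S_def \<psi>_def)
    qed
  qed
  define U where "U v = u (cos (\<psi> v))" for v
  have key: "\<bar>U t - U v\<bar> * S t ^ i \<le> 2 * E * (\<bar>t - v\<bar> * (1 + 2 * N * \<bar>t - v\<bar>) ^ i)" for t v
  proof -
    let ?m = "min (S t) (S v)"
    have "S t \<le> ?m * (1 + 2 * N * \<bar>t - v\<bar>)"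
    proof -
      have "\<bar>S t - S v\<bar> \<le> \<bar>t - v\<bar>" unfolding S_def using sin_diff_le[of "\<psi> t" "\<psi> v"] \<psi>_lip[of t v] by linarith
      moreover have "1 * \<bar>t - v\<bar> \<le> (S w * (2 * N)) * \<bar>t - v\<bar>" for w
        using S_low[of w] N by (intro mult_right_mono) (auto simp: field_simps)
      then have "\<bar>t - v\<bar> \<le> S v * (2 * N * \<bar>t - v\<bar>)" "0 \<le> S t * (2 * N * \<bar>t - v\<bar>)"
        using S_pos[of t] N by (auto simp: mult.assoc)
      ultimately have "S t \<le> S v * (1 + 2 * N * \<bar>t - v\<bar>)" "S t \<le> S t * (1 + 2 * N * \<bar>t - v\<bar>)"
        by (simp_all only: distrib_left mult_1_right)
      then show ?thesis by (simp add: min_def)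
    qed
    then have "S t ^ i \<le> (?m * (1 + 2 * N * \<bar>t - v\<bar>)) ^ i" using S_pos[of t] by (intro power_mono) auto
    then have "\<bar>U t - U v\<bar> * S t ^ i \<le> \<bar>U t - U v\<bar> * (?m ^ i * (1 + 2 * N * \<bar>t - v\<bar>) ^ i)"
      by (intro mult_left_mono) (auto simp: power_mult_distrib)
    also have "\<dots> = (\<bar>U t - U v\<bar> * ?m ^ i) * (1 + 2 * N * \<bar>t - v\<bar>) ^ i" by simp
    also have "\<dots> \<le> (2 * E * \<bar>t - v\<bar>) * (1 + 2 * N * \<bar>t - v\<bar>) ^ i"
    proof (rule mult_right_mono)
      have "\<bar>U t - U v\<bar> * ?m ^ i \<le> 2 * E * \<bar>\<psi> t - \<psi> v\<bar>"
        unfolding U_def S_def by (rule wlip_angle[OF u E \<psi>(2) \<psi>(2)])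
      also have "\<dots> \<le> 2 * E * \<bar>t - v\<bar>" using \<psi>_lip E by (intro mult_left_mono) auto
      finally show "\<bar>U t - U v\<bar> * ?m ^ i \<le> 2 * E * \<bar>t - v\<bar>" .
    qed (use N in auto)
    finally show ?thesis by (simp only: mult.assoc)
  qed
  have contU: "continuous_on {0..pi} U"
  proof -
    have "continuous_on {-1<..<1} u"
      using wlip_isCont[OF u] by (intro continuous_at_imp_continuous_on) blast
    then show ?thesis unfolding U_def
    proof (rule continuous_on_compose2)
      show "continuous_on {0..pi} (\<lambda>x. cos (\<psi> x))" unfolding \<psi>_def by (intro continuous_intros)
      show "(\<lambda>x. cos (\<psi> x)) ` {0..pi} \<subseteq> {- 1<..<1}"
      proof clarsimp
        fix x
        show "- 1 < cos (\<psi> x) \<and> cos (\<psi> x) < 1"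
          using \<psi>(2)[of x] cos_monotone_0_pi[of 0 "\<psi> x"] cos_monotone_0_pi[of "\<psi> x" pi] by auto
      qed
    qed
  qed
  define K where "K w = dirichlet n w ^ (2 * p)" for w
  have K0: "K w \<ge> 0" for w by (simp add: K_def power_mult)
  have contK: "continuous_on T K" for T unfolding K_def dirichlet_def by (intro continuous_intros)
  have cosK: "cospoly (2 * p * n) K" unfolding K_def by (rule cospoly_power[OF cospoly_dirichlet])
  define c0 where "c0 = 2 * integral {0..pi} K"
  have "0 < (2 * real n + 1) ^ (2 * p) / (2 * real n + 1) / 4 ^ p" by simp
  then have c0: "c0 > 0" unfolding c0_def K_def using less_le_trans[OF _ dirichlet_power_total[of n p]]
    by (simp only: zero_less_mult_iff zero_less_numeral) simp
  obtain Q where Q: "degree Q \<le> 2 * p * n" "\<And>t. integral {0..pi} (\<lambda>v. (K (t - v) + K (t + v)) * U v) = poly Q (cos t)"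
    by (rule cospoly_convolution[OF cosK contU]) blast
  show ?thesis
  proof
    show "degree (smult (1 / c0) Q) \<le> 2 * p * n" using Q(1) degree_smult_le order_trans by blast
    fix x :: real assume x: "x \<in> {-1<..<1}"
    define t where "t = arccos x"
    have xt: "x = cos t" and t: "t \<in> {0<..<pi}" using x arccos_lt_bounded[of x] by (auto simp: t_def)
    have w: "weight x = sin t" unfolding xt by (rule weight_cos) (use t in auto)
    have st: "sin t > 0" using t by (auto simp: sin_gt_zero)
    have A: "\<bar>u x - U t\<bar> * sin t ^ i \<le> 2 * E / N"
    proof -
      have "\<bar>u (cos t) - u (cos (\<psi> t))\<bar> * min (sin t) (sin (\<psi> t)) ^ i \<le> 2 * E * \<bar>t - \<psi> t\<bar>"
        by (rule wlip_angle[OF u E t \<psi>(2)])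
      moreover have "min (sin t) (sin (\<psi> t)) = sin t" using S_sin[OF t] by (simp add: S_def)
      moreover have "2 * E * \<bar>t - \<psi> t\<bar> \<le> 2 * E * \<tau>"
        using t E \<tau> pi3 by (intro mult_left_mono) (auto simp: \<psi>_def)
      ultimately show ?thesis by (simp add: U_def xt \<tau>_def)
    qed
    have B: "\<bar>U t - poly (smult (1 / c0) Q) x\<bar> * S t ^ i \<le> 2 ^ i * 4 * 100 ^ p * E / N"
    proof -
      have int1: "(\<lambda>v. (K (t - v) + K (t + v)) * U t) integrable_on {0..pi}"
        "(\<lambda>v. (K (t - v) + K (t + v)) * U v) integrable_on {0..pi}"
        by (intro integrable_continuous_real continuous_intros continuous_on_compose2[OF contK[of UNIV]] contU; simp)+
      have "c0 * U t = integral {0..pi} (\<lambda>v. (K (t - v) + K (t + v)) * U t)"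
        unfolding integral_mult_left using cospoly_total[OF cosK, of t] by (simp add: c0_def)
      then have "c0 * U t - poly Q x = integral {0..pi} (\<lambda>v. (K (t - v) + K (t + v)) * U t - (K (t - v) + K (t + v)) * U v)"
        using Q(2)[of t] integral_diff[OF int1] by (simp add: xt)
      also have "\<dots> = integral {0..pi} (\<lambda>v. (K (t - v) + K (t + v)) * (U t - U v))"
        by (simp add: right_diff_distrib)
      finally have e: "c0 * U t - poly Q x = integral {0..pi} (\<lambda>v. (K (t - v) + K (t + v)) * (U t - U v))" .
      have "\<bar>c0 * U t - poly Q x\<bar> * S t ^ i = norm (integral {0..pi} (\<lambda>v. ((K (t - v) + K (t + v)) * (U t - U v)) * S t ^ i))"
        unfolding e integral_mult_left using S_pos[of t] by (simp add: abs_mult)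
      also have "\<dots> \<le> integral {0..pi} (\<lambda>v. (2 * E) * ((K (t - v) + K (t + v)) * (\<bar>t - v\<bar> * (1 + 2 * N * \<bar>t - v\<bar>) ^ i)))"
      proof (rule integral_norm_bound_integral)
        show "(\<lambda>v. ((K (t - v) + K (t + v)) * (U t - U v)) * S t ^ i) integrable_on {0..pi}"
          by (intro integrable_continuous_real continuous_intros continuous_on_compose2[OF contK[of UNIV]] contU; simp)
        show "(\<lambda>v. (2 * E) * ((K (t - v) + K (t + v)) * (\<bar>t - v\<bar> * (1 + 2 * N * \<bar>t - v\<bar>) ^ i))) integrable_on {0..pi}"
          by (intro integrable_continuous_real continuous_intros continuous_on_compose2[OF contK[of UNIV]]; simp)
        fix v
        have "norm (((K (t - v) + K (t + v)) * (U t - U v)) * S t ^ i) = (K (t - v) + K (t + v)) * (\<bar>U t - U v\<bar> * S t ^ i)"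
          using K0 S_pos[of t] by (simp add: abs_mult add_nonneg_nonneg)
        also have "\<dots> \<le> (K (t - v) + K (t + v)) * (2 * E * (\<bar>t - v\<bar> * (1 + 2 * N * \<bar>t - v\<bar>) ^ i))"
          using K0 by (intro mult_left_mono key) (simp add: add_nonneg_nonneg)
        finally show "norm (((K (t - v) + K (t + v)) * (U t - U v)) * S t ^ i) \<le>
          (2 * E) * ((K (t - v) + K (t + v)) * (\<bar>t - v\<bar> * (1 + 2 * N * \<bar>t - v\<bar>) ^ i))" by (simp only: mult_ac)
      qed
      also have "\<dots> = (2 * E) * integral {0..pi} (\<lambda>v. (K (t - v) + K (t + v)) * (\<bar>t - v\<bar> * (1 + 2 * N * \<bar>t - v\<bar>) ^ i))"
        by (rule integral_mult_right)
      also have "\<dots> \<le> (2 * E) * (2 ^ i * 4 * 100 ^ p / N * integral {0..pi} K)"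
        using jackson_moment[OF ip, of t n] t E unfolding K_def N_def by (intro mult_left_mono) auto
      also have "\<dots> = c0 * (2 ^ i * 4 * 100 ^ p * E / N)" by (simp add: c0_def)
      finally have "c0 * (\<bar>U t - poly (smult (1 / c0) Q) x\<bar> * S t ^ i) \<le> c0 * (2 ^ i * 4 * 100 ^ p * E / N)"
      proof -
        have "\<bar>c0 * U t - poly Q x\<bar> = c0 * \<bar>U t - poly (smult (1 / c0) Q) x\<bar>"
        proof -
          have "c0 * U t - poly Q x = c0 * (U t - poly (smult (1 / c0) Q) x)" using c0 by (simp add: field_simps)
          then show ?thesis using c0 by (simp only: abs_mult abs_of_pos)
        qed
        moreover assume "\<bar>c0 * U t - poly Q x\<bar> * S t ^ i \<le> c0 * (2 ^ i * 4 * 100 ^ p * E / N)"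
        ultimately show ?thesis by (simp only: mult.assoc)
      qed
      then show ?thesis using c0 by (simp only: mult_le_cancel_left_pos)
    qed
    have "\<bar>U t - poly (smult (1 / c0) Q) x\<bar> * sin t ^ i \<le> \<bar>U t - poly (smult (1 / c0) Q) x\<bar> * S t ^ i"
      using S_sin[OF t] st by (intro mult_left_mono power_mono) auto
    moreover have "\<bar>u x - poly (smult (1 / c0) Q) x\<bar> * sin t ^ i \<le>
       (\<bar>u x - U t\<bar> + \<bar>U t - poly (smult (1 / c0) Q) x\<bar>) * sin t ^ i"
      using st by (intro mult_right_mono) auto
    ultimately have "\<bar>u x - poly (smult (1 / c0) Q) x\<bar> * sin t ^ i \<le> 2 * E / N + 2 ^ i * 4 * 100 ^ p * E / N"
      using A B by (simp add: distrib_right)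
    also have "\<dots> \<le> 2 ^ i * 6 * 100 ^ p * E / N"
    proof -
      have "1 * 1 \<le> (2::real) ^ i * 100 ^ p" by (intro mult_mono one_le_power) auto
      then have "1 * (2 * E) \<le> (2 ^ i * 100 ^ p) * (2 * E)" using E by (intro mult_right_mono) auto
      then have "2 * E + 2 ^ i * 4 * 100 ^ p * E \<le> 2 ^ i * 6 * 100 ^ p * E" by (simp add: mult_ac)
      then show ?thesis using N by (simp add: divide_right_mono flip: add_divide_distrib)
    qed
    finally show "\<bar>u x - poly (smult (1 / c0) Q) x\<bar> * weight x ^ i \<le> 2 ^ i * 6 * 100 ^ p * E / (2 * real n + 1)"
      unfolding w N_def .
  qed
qed

text \<open>
  In terms of the derivatives u^(j), the condition reads \<bar>u^(j)\<bar> * weight^(i+j)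
  \<le> M for all j \<le> s, together with a weighted Lipschitz condition on u^(s) that stands
  for the bound of the derivative of order s + 1. The exponent i is a parameter of its own,
  since u' belongs to the class with exponent i + 1 whenever u belongs to the one with
  exponent i.
\<close>
primrec wsmooth :: "nat \<Rightarrow> nat \<Rightarrow> real \<Rightarrow> (real \<Rightarrow> real) \<Rightarrow> bool" where
  "wsmooth i 0 M u \<longleftrightarrow> (\<forall>x\<in>{-1<..<1}. \<bar>u x\<bar> * weight x ^ i \<le> M) \<and> wlip (Suc i) M u"
| "wsmooth i (Suc s) M u \<longleftrightarrow> (\<forall>x\<in>{-1<..<1}. \<bar>u x\<bar> * weight x ^ i \<le> M) \<and>
     (\<exists>u'. (\<forall>x\<in>{-1<..<1}. (u has_real_derivative u' x) (at x)) \<and> wsmooth (Suc i) s M u')"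

lemma poly_antiderivative:
  obtains Q :: "real poly" where "pderiv Q = q" "degree Q \<le> Suc (degree q)"
proof
  let ?Q = "\<Sum>k\<le>degree q. monom (coeff q k / real (Suc k)) (Suc k)"
  have "pderiv ?Q = (\<Sum>k\<le>degree q. monom (coeff q k) k)"
    unfolding higher_pderiv_sum[of 1, simplified] by (intro sum.cong refl) (simp add: pderiv_monom del: of_nat_Suc)
  then show "pderiv ?Q = q" by (simp only: poly_as_sum_of_monoms)
  show "degree ?Q \<le> Suc (degree q)"
    by (rule degree_sum_le) (auto intro: order_trans[OF degree_monom_le])
qed

text \<open>
  Favard's induction on s: approximate u' with the next higher weight exponent and integrate
  the approximating polynomial. The derivative of the remainder is of the order of the error
  for u', and weighted_jackson, applied to the remainder, gains one more factor 1/N. The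
  exponent p of the kernel is fixed beforehand, large enough for all the weight exponents up
  to i + s.
\<close>
theorem weighted_polynomial_approximation:
  "i + s + 3 \<le> 2 * p \<Longrightarrow> \<exists>C\<ge>0. \<forall>M u n. M \<ge> 0 \<longrightarrow> wsmooth i s M u \<longrightarrow>
     (\<exists>q. degree q \<le> 2 * p * n + s \<and>
        (\<forall>x\<in>{-1<..<1}. \<bar>u x - poly q x\<bar> * weight x ^ i \<le> C * M / (2 * real n + 1) ^ Suc s))"
proof (induction s arbitrary: i)
  case 0
  show ?case
  proof (intro exI[of _ "2 ^ i * 6 * 100 ^ p :: real"] conjI allI impI)
    fix M u n assume "0 \<le> M" "wsmooth i 0 M u"
    then obtain q where "degree q \<le> 2 * p * n"
      "\<And>x. x \<in> {-1<..<1} \<Longrightarrow> \<bar>u x - poly q x\<bar> * weight x ^ i \<le> 2 ^ i * 6 * 100 ^ p * M / (2 * real n + 1)"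
      using weighted_jackson[of i p M u n] 0 by auto
    then show "\<exists>q. degree q \<le> 2 * p * n + 0 \<and>
      (\<forall>x\<in>{-1<..<1}. \<bar>u x - poly q x\<bar> * weight x ^ i \<le> 2 ^ i * 6 * 100 ^ p * M / (2 * real n + 1) ^ Suc 0)"
      by (intro exI[of _ q]) auto
  qed auto
next
  case (Suc s)
  obtain C where C: "C \<ge> 0" "\<And>M u n. M \<ge> 0 \<Longrightarrow> wsmooth (Suc i) s M u \<Longrightarrow>
     (\<exists>q. degree q \<le> 2 * p * n + s \<and>
        (\<forall>x\<in>{-1<..<1}. \<bar>u x - poly q x\<bar> * weight x ^ Suc i \<le> C * M / (2 * real n + 1) ^ Suc s))"
    using Suc.IH[of "Suc i"] Suc.prems by auto
  let ?D = "2 ^ i * 6 * 100 ^ p * C"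
  show ?case
  proof (intro exI[of _ ?D] conjI allI impI)
    fix M u n assume M: "(0::real) \<le> M" and u: "wsmooth i (Suc s) M u"
    let ?N = "2 * real n + 1"
    obtain u' where u'0: "\<forall>x\<in>{-1<..<1}. (u has_real_derivative u' x) (at x)" and u': "wsmooth (Suc i) s M u'"
      using u unfolding wsmooth.simps by blast
    obtain q' where q': "degree q' \<le> 2 * p * n + s" "\<And>x. x \<in> {-1<..<1} \<Longrightarrow> \<bar>u' x - poly q' x\<bar> * weight x ^ Suc i \<le> C * M / ?N ^ Suc s"
      using C(2)[OF M u'] by blast
    obtain Q where Q: "pderiv Q = q'" "degree Q \<le> Suc (degree q')" by (rule poly_antiderivative)
    have "wlip (Suc i) (C * M / ?N ^ Suc s) (\<lambda>x. u x - poly Q x)"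
    proof (rule deriv_bound_imp_wlip[where u' = "\<lambda>x. u' x - poly q' x"])
      fix x :: real assume x: "x \<in> {-1<..<1}"
      show "((\<lambda>x. u x - poly Q x) has_real_derivative u' x - poly q' x) (at x)"
        using DERIV_diff[OF u'0[rule_format, OF x] poly_DERIV[of Q x]] Q(1) by simp
    qed (rule q'(2))
    moreover have "C * M / ?N ^ Suc s \<ge> 0" using C(1) M by (intro divide_nonneg_nonneg mult_nonneg_nonneg) auto
    ultimately obtain q2 where q2: "degree q2 \<le> 2 * p * n" "\<And>x. x \<in> {-1<..<1} \<Longrightarrow>
      \<bar>(u x - poly Q x) - poly q2 x\<bar> * weight x ^ i \<le> 2 ^ i * 6 * 100 ^ p * (C * M / ?N ^ Suc s) / ?N"
      using weighted_jackson[of i p "C * M / ?N ^ Suc s" "\<lambda>x. u x - poly Q x" n] Suc.prems by auto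
    show "\<exists>q. degree q \<le> 2 * p * n + Suc s \<and>
      (\<forall>x\<in>{-1<..<1}. \<bar>u x - poly q x\<bar> * weight x ^ i \<le> ?D * M / ?N ^ Suc (Suc s))"
    proof (intro exI[of _ "Q + q2"] conjI ballI)
      show "degree (Q + q2) \<le> 2 * p * n + Suc s" using Q(2) q'(1) q2(1) by (intro degree_add_le) auto
      fix x :: real assume "x \<in> {-1<..<1}"
      from q2(2)[OF this] show "\<bar>u x - poly (Q + q2) x\<bar> * weight x ^ i \<le> ?D * M / ?N ^ Suc (Suc s)"
        by (simp add: mult_ac diff_diff_eq)
    qed
  qed (use C(1) in simp)
qed

section \<open>Weighted smoothness classes\<close>

text \<open>
  The rule with m nodes is exact up to degree 2m - 1, so the approximation theorem may be used
  with n of the order of m; then the best approximation error is of the order m^(-s-1).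
\<close>
theorem gauss_error_wsmooth:
  "\<exists>C m1. C \<ge> 0 \<and> m1 \<ge> 1 \<and> (\<forall>M u m. M \<ge> 0 \<longrightarrow> continuous_on {-1..1} u \<longrightarrow> wsmooth 0 s M u \<longrightarrow> m \<ge> m1 \<longrightarrow>
     \<bar>integral {-1..1} u - (\<Sum>t\<in>gauss_nodes m. gauss_weight m t * u t)\<bar> \<le> C * M / real m ^ Suc s)"
proof -
  define p where "p = s + 3"
  have "0 + s + 3 \<le> 2 * p" by (simp add: p_def)
  from weighted_polynomial_approximation[OF this] obtain C where C: "C \<ge> 0" and C0: "\<forall>M u n. M \<ge> 0 \<longrightarrow> wsmooth 0 s M u \<longrightarrow>
     (\<exists>q. degree q \<le> 2 * p * n + s \<and>
        (\<forall>x\<in>{-1<..<1}. \<bar>u x - poly q x\<bar> * weight x ^ 0 \<le> C * M / (2 * real n + 1) ^ Suc s))"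
    by blast
  show ?thesis
  proof (intro exI[of _ "4 * C * (2 * real p) ^ Suc s"] exI[of _ "s + 2 * p + 1"] conjI allI impI)
    fix M u m assume M: "(0::real) \<le> M" and cont: "continuous_on {-1..1} u" and u: "wsmooth 0 s M u" and m: "s + 2 * p + 1 \<le> m"
    \<comment> \<open>The largest n for which polynomials of degree 2pn + s are integrated
      exactly.\<close>
    define n where "n = (2 * m - 1 - s) div (2 * p)"
    have n1: "2 * p * n \<le> 2 * m - 1 - s" by (simp add: n_def)
    have "2 * m - 1 - s < 2 * p * Suc n" using dividend_less_times_div[of "2 * p" "2 * m - 1 - s"] by (simp add: n_def p_def)
    then have n2: "2 * m < 2 * p * n + 2 * p + 1 + s" using m by simp
    have "m \<le> 2 * p * (2 * n + 1)"
    proof -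
      have "4 * m < 2 * (2 * p * n) + 4 * p + 2 + 2 * s" using n2 by linarith
      moreover have "2 * s + 2 * p + 2 \<le> 3 * m" using m by linarith
      ultimately have "m \<le> 2 * (2 * p * n) + 2 * p" by linarith
      then show ?thesis by (simp add: algebra_simps)
    qed
    then have mn: "real m \<le> 2 * real p * (2 * real n + 1)"
    proof -
      have "real m \<le> real (2 * p * (2 * n + 1))" using \<open>m \<le> 2 * p * (2 * n + 1)\<close> by (simp only: of_nat_le_iff)
      then show ?thesis by (simp only: of_nat_mult of_nat_add of_nat_numeral of_nat_1)
    qed
    obtain q where q: "degree q \<le> 2 * p * n + s" "\<And>x. x \<in> {-1<..<1} \<Longrightarrow> \<bar>u x - poly q x\<bar> \<le> C * M / (2 * real n + 1) ^ Suc s"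
      using C0[rule_format, OF M u, of n] unfolding power_0 mult_1_right by blast
    define d where "d = C * M / (2 * real n + 1) ^ Suc s"
    have d: "d \<le> C * M * (2 * real p) ^ Suc s / real m ^ Suc s"
    proof -
      have m0: "real m > 0" using m by simp
      have "real m ^ Suc s \<le> (2 * real p * (2 * real n + 1)) ^ Suc s" using mn by (intro power_mono) auto
      then have "C * M * real m ^ Suc s \<le> C * M * ((2 * real p) ^ Suc s * (2 * real n + 1) ^ Suc s)"
        unfolding power_mult_distrib[of "2 * real p"] using C M by (intro mult_left_mono) auto
      then have "C * M * real m ^ Suc s / real m ^ Suc s \<le> C * M * ((2 * real p) ^ Suc s * (2 * real n + 1) ^ Suc s) / real m ^ Suc s"
        using m0 by (intro divide_right_mono) auto
      then have "C * M \<le> C * M * (2 * real p) ^ Suc s / real m ^ Suc s * (2 * real n + 1) ^ Suc s"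
        using m0 by simp
      moreover have "0 < (2 * real n + 1) ^ Suc s" by (intro zero_less_power) simp
      ultimately show ?thesis unfolding d_def by (simp only: pos_divide_le_eq)
    qed
    have deg: "degree q < 2 * m" using q(1) n1 m by linarith
    have "\<bar>integral {-1..1} u - (\<Sum>t\<in>gauss_nodes m. gauss_weight m t * u t)\<bar> \<le> 4 * d"
      unfolding d_def by (rule gauss_error_le_approximation_error[OF cont deg q(2)])
    also have "\<dots> \<le> 4 * (C * M * (2 * real p) ^ Suc s / real m ^ Suc s)" using d by simp
    finally show "\<bar>integral {-1..1} u - (\<Sum>t\<in>gauss_nodes m. gauss_weight m t * u t)\<bar>
       \<le> 4 * C * (2 * real p) ^ Suc s * M / real m ^ Suc s" by (simp add: mult_ac)
  qed (use C in auto)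
qed

lemma wsmooth_bound: "wsmooth i s M u \<Longrightarrow> x \<in> {-1<..<1} \<Longrightarrow> \<bar>u x\<bar> * weight x ^ i \<le> M"
  by (cases s) auto

lemma wsmooth_SucI:
  assumes "\<And>x. x \<in> {-1<..<1} \<Longrightarrow> \<bar>u x\<bar> * weight x ^ i \<le> M"
    and "\<And>x. x \<in> {-1<..<1} \<Longrightarrow> (u has_real_derivative u' x) (at x)"
    and "wsmooth (Suc i) s M u'"
  shows "wsmooth i (Suc s) M u"
  unfolding wsmooth.simps using assms by blast

lemma wsmooth_nonneg: "wsmooth i s M u \<Longrightarrow> 0 \<le> M"
  using wsmooth_bound[of i s M u 0] by (simp add: weight_def)

lemma wlip_mono: "wlip p M u \<Longrightarrow> M \<le> N \<Longrightarrow> wlip p N u"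
  unfolding wlip_def by (meson abs_ge_zero mult_right_mono order_trans)

lemma wlip_raise:
  assumes "wlip p M u" shows "wlip (Suc p) M u"
  unfolding wlip_def
proof (intro ballI)
  fix y z :: real assume yz: "y \<in> {-1<..<1}" "z \<in> {-1<..<1}"
  let ?m = "min (weight y) (weight z)"
  have "0 \<le> ?m" "?m \<le> 1" using weight_pos yz weight_le_1[of y] by (auto simp: less_imp_le min_le_iff_disj)
  then have "?m ^ Suc p \<le> ?m ^ p" by (intro power_decreasing) auto
  then have "\<bar>u y - u z\<bar> * ?m ^ Suc p \<le> \<bar>u y - u z\<bar> * ?m ^ p" by (intro mult_left_mono) auto
  also have "\<dots> \<le> M * \<bar>y - z\<bar>" using assms yz unfolding wlip_def by blast
  finally show "\<bar>u y - u z\<bar> * ?m ^ Suc p \<le> M * \<bar>y - z\<bar>" .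
qed

lemma wsmooth_mono: "wsmooth i s M u \<Longrightarrow> M \<le> N \<Longrightarrow> wsmooth i s N u"
proof (induction s arbitrary: i u)
  case 0
  then show ?case using wlip_mono by (auto intro: order_trans)
next
  case (Suc s)
  then show ?case unfolding wsmooth.simps by (meson order_trans)
qed

lemma wsmooth_raise: "wsmooth i s M u \<Longrightarrow> wsmooth (Suc i) s M u"
proof (induction s arbitrary: i u)
  have bd: "\<bar>u x\<bar> * weight x ^ Suc i \<le> M" if "\<bar>u x\<bar> * weight x ^ i \<le> M" "x \<in> {-1<..<1}" for i and u :: "real \<Rightarrow> real" and x
  proof -
    have "weight x ^ Suc i \<le> weight x ^ i" using weight_pos[OF that(2)] weight_le_1[of x] by (intro power_decreasing) auto
    then have "\<bar>u x\<bar> * weight x ^ Suc i \<le> \<bar>u x\<bar> * weight x ^ i" by (intro mult_left_mono) auto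
    then show ?thesis using that(1) by linarith
  qed
  {
    case 0
    then show ?case using bd wlip_raise unfolding wsmooth.simps by blast
  next
    case (Suc s)
    then show ?case using bd unfolding wsmooth.simps by blast
  }
qed

lemma wsmooth_Suc_imp: "wsmooth i (Suc s) M u \<Longrightarrow> wsmooth i s M u"
proof (induction s arbitrary: i u)
  case 0
  then obtain u' where u': "\<And>x. x \<in> {-1<..<1} \<Longrightarrow> (u has_real_derivative u' x) (at x)" "wsmooth (Suc i) 0 M u'"
    unfolding wsmooth.simps by blast
  have "wlip (Suc i) M u" by (rule deriv_bound_imp_wlip[OF u'(1) wsmooth_bound[OF u'(2)]])
  then show ?case using 0 by simp
next
  case (Suc s)
  then obtain u' where "\<forall>x\<in>{-1<..<1}. (u has_real_derivative u' x) (at x)" "wsmooth (Suc i) s M u'"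
    using Suc.IH unfolding wsmooth.simps(2)[of i "Suc s"] by blast
  then show ?case using Suc.prems unfolding wsmooth.simps by blast
qed

lemma wsmooth_imp_wlip: "wsmooth i s M u \<Longrightarrow> wlip (Suc i) M u"
proof (induction s)
  case (Suc s)
  then show ?case using wsmooth_Suc_imp by blast
qed simp

lemma wsmooth_add: "wsmooth i s M u \<Longrightarrow> wsmooth i s N v \<Longrightarrow> wsmooth i s (M + N) (\<lambda>x. u x + v x)"
proof (induction s arbitrary: i u v)
  have bd: "\<bar>u x + v x\<bar> * weight x ^ i \<le> M + N" if "\<bar>u x\<bar> * weight x ^ i \<le> M" "\<bar>v x\<bar> * weight x ^ i \<le> N" "x \<in> {-1<..<1}"
    for i and u v :: "real \<Rightarrow> real" and x
  proof -
    have "\<bar>u x + v x\<bar> * weight x ^ i \<le> (\<bar>u x\<bar> + \<bar>v x\<bar>) * weight x ^ i"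
      using weight_pos[OF that(3)] by (intro mult_right_mono) auto
    then show ?thesis using that by (simp add: distrib_right)
  qed
  {
    case 0
    have "wlip (Suc i) (M + N) (\<lambda>x. u x + v x)" unfolding wlip_def
    proof (intro ballI)
      fix y z :: real assume yz: "y \<in> {-1<..<1}" "z \<in> {-1<..<1}"
      let ?m = "min (weight y) (weight z)"
      have m: "0 \<le> ?m" using weight_pos yz by (auto simp: less_imp_le)
      have "\<bar>u y + v y - (u z + v z)\<bar> * ?m ^ Suc i \<le> (\<bar>u y - u z\<bar> + \<bar>v y - v z\<bar>) * ?m ^ Suc i"
        using m by (intro mult_right_mono) auto
      also have "\<dots> \<le> M * \<bar>y - z\<bar> + N * \<bar>y - z\<bar>" unfolding distrib_right
        by (rule add_mono) (use 0 yz in \<open>simp_all only: wsmooth.simps wlip_def\<close>)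
      finally show "\<bar>u y + v y - (u z + v z)\<bar> * ?m ^ Suc i \<le> (M + N) * \<bar>y - z\<bar>" by (simp add: distrib_right)
    qed
    then show ?case using 0 bd unfolding wsmooth.simps by blast
  next
    case (Suc s)
    obtain u' v' where "\<forall>x\<in>{-1<..<1}. (u has_real_derivative u' x) (at x)" "wsmooth (Suc i) s M u'"
      "\<forall>x\<in>{-1<..<1}. (v has_real_derivative v' x) (at x)" "wsmooth (Suc i) s N v'"
      using Suc.prems unfolding wsmooth.simps by blast
    then have 1: "\<forall>x\<in>{-1<..<1}. ((\<lambda>x. u x + v x) has_real_derivative u' x + v' x) (at x)" "wsmooth (Suc i) s (M + N) (\<lambda>x. u' x + v' x)"
      using Suc.IH by (auto intro: DERIV_add)
    show ?case
    proof (rule wsmooth_SucI[where u' = "\<lambda>x. u' x + v' x"])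
      fix x :: real assume x: "x \<in> {-1<..<1}"
      show "\<bar>u x + v x\<bar> * weight x ^ i \<le> M + N"
        by (rule bd[where u = u and v = v, OF wsmooth_bound[OF Suc.prems(1) x] wsmooth_bound[OF Suc.prems(2) x] x])
      show "((\<lambda>x. u x + v x) has_real_derivative u' x + v' x) (at x)" using 1(1) x by blast
    qed (rule 1(2))
  }
qed

text \<open>
  Leibniz' rule produces one factor 2 for each derivative, and one more in the final Lipschitz
  estimate; the weight exponents of the two factors add up.
\<close>
lemma wsmooth_mult: "wsmooth i s M u \<Longrightarrow> wsmooth j s N v \<Longrightarrow> wsmooth (i + j) s (2 ^ Suc s * (M * N)) (\<lambda>x. u x * v x)"
proof (induction s arbitrary: i j u v)
  have bd: "\<bar>u x * v x\<bar> * weight x ^ (i + j) \<le> 2 ^ k * (M * N)"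
    if "\<bar>u x\<bar> * weight x ^ i \<le> M" "\<bar>v x\<bar> * weight x ^ j \<le> N" "x \<in> {-1<..<1}"
    for i j k and u v :: "real \<Rightarrow> real" and x
  proof -
    have M: "0 \<le> M" "0 \<le> N" using that weight_pos[OF that(3)] by (smt (verit) mult_nonneg_nonneg zero_le_power)+
    have "\<bar>u x * v x\<bar> * weight x ^ (i + j) = (\<bar>u x\<bar> * weight x ^ i) * (\<bar>v x\<bar> * weight x ^ j)"
      by (simp add: power_add abs_mult)
    also have "\<dots> \<le> 1 * (M * N)" unfolding mult_1_left using that weight_pos[OF that(3)] M by (intro mult_mono) auto
    also have "\<dots> \<le> 2 ^ k * (M * N)" using M by (intro mult_right_mono) auto
    finally show ?thesis .
  qed
  {
    case 0
    have "wlip (Suc (i + j)) (2 * (M * N)) (\<lambda>x. u x * v x)" unfolding wlip_def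
    proof (intro ballI)
      fix y z :: real assume yz: "y \<in> {-1<..<1}" "z \<in> {-1<..<1}"
      let ?m = "min (weight y) (weight z)"
      have m: "0 \<le> ?m" using weight_pos yz by (auto simp: less_imp_le)
      have M: "0 \<le> M" "0 \<le> N" using wsmooth_nonneg 0 by blast+
      have uy: "\<bar>u y\<bar> * ?m ^ i \<le> M"
      proof -
        have "\<bar>u y\<bar> * ?m ^ i \<le> \<bar>u y\<bar> * weight y ^ i" using m by (intro mult_left_mono power_mono) auto
        then show ?thesis using wsmooth_bound[OF 0(1) yz(1)] by linarith
      qed
      have vz: "\<bar>v z\<bar> * ?m ^ j \<le> N"
      proof -
        have "\<bar>v z\<bar> * ?m ^ j \<le> \<bar>v z\<bar> * weight z ^ j" using m by (intro mult_left_mono power_mono) auto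
        then show ?thesis using wsmooth_bound[OF 0(2) yz(2)] by linarith
      qed
      have lu: "\<bar>u y - u z\<bar> * ?m ^ Suc i \<le> M * \<bar>y - z\<bar>" and lv: "\<bar>v y - v z\<bar> * ?m ^ Suc j \<le> N * \<bar>y - z\<bar>"
        using 0 yz by (simp_all only: wsmooth.simps wlip_def)
      have "u y * v y - u z * v z = u y * (v y - v z) + v z * (u y - u z)" by (simp add: algebra_simps)
      then have "\<bar>u y * v y - u z * v z\<bar> * ?m ^ Suc (i + j) \<le> (\<bar>u y\<bar> * \<bar>v y - v z\<bar> + \<bar>v z\<bar> * \<bar>u y - u z\<bar>) * ?m ^ Suc (i + j)"
        using m by (intro mult_right_mono) (auto simp: abs_mult intro: order_trans[OF abs_triangle_ineq])
      also have "\<dots> = (\<bar>u y\<bar> * ?m ^ i) * (\<bar>v y - v z\<bar> * ?m ^ Suc j) + (\<bar>v z\<bar> * ?m ^ j) * (\<bar>u y - u z\<bar> * ?m ^ Suc i)"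
        by (simp add: power_add algebra_simps)
      also have "\<dots> \<le> M * (N * \<bar>y - z\<bar>) + N * (M * \<bar>y - z\<bar>)"
        using m M by (intro add_mono mult_mono uy vz lu lv) auto
      finally show "\<bar>u y * v y - u z * v z\<bar> * ?m ^ Suc (i + j) \<le> 2 * (M * N) * \<bar>y - z\<bar>" by (simp add: mult_ac)
    qed
    moreover have "\<forall>x\<in>{-1<..<1}. \<bar>u x * v x\<bar> * weight x ^ (i + j) \<le> 2 ^ Suc 0 * (M * N)"
      using bd wsmooth_bound[OF 0(1)] wsmooth_bound[OF 0(2)] by blast
    ultimately show ?case by simp
  next
    case (Suc s)
    obtain u' v' where uv': "\<forall>x\<in>{-1<..<1}. (u has_real_derivative u' x) (at x)" "wsmooth (Suc i) s M u'"
      "\<forall>x\<in>{-1<..<1}. (v has_real_derivative v' x) (at x)" "wsmooth (Suc j) s N v'"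
      using Suc.prems unfolding wsmooth.simps by blast
    have der: "\<forall>x\<in>{-1<..<1}. ((\<lambda>x. u x * v x) has_real_derivative u x * v' x + u' x * v x) (at x)"
      using uv' by (auto intro: DERIV_mult')
    have "wsmooth (i + Suc j) s (2 ^ Suc s * (M * N)) (\<lambda>x. u x * v' x)"
      by (rule Suc.IH[OF wsmooth_Suc_imp[OF Suc.prems(1)] uv'(4)])
    moreover have "wsmooth (Suc i + j) s (2 ^ Suc s * (M * N)) (\<lambda>x. u' x * v x)"
      by (rule Suc.IH[OF uv'(2) wsmooth_Suc_imp[OF Suc.prems(2)]])
    ultimately have "wsmooth (Suc (i + j)) s (2 ^ Suc (Suc s) * (M * N)) (\<lambda>x. u x * v' x + u' x * v x)"
      using wsmooth_add[of "Suc (i + j)" s "2 ^ Suc s * (M * N)" "\<lambda>x. u x * v' x" "2 ^ Suc s * (M * N)" "\<lambda>x. u' x * v x"]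
      by (simp add: mult_ac)
    note w' = this
    show ?case
    proof (rule wsmooth_SucI[where u' = "\<lambda>x. u x * v' x + u' x * v x"])
      fix x :: real assume x: "x \<in> {-1<..<1}"
      show "\<bar>u x * v x\<bar> * weight x ^ (i + j) \<le> 2 ^ Suc (Suc s) * (M * N)"
        by (rule bd[where u = u and v = v, OF wsmooth_bound[OF Suc.prems(1) x] wsmooth_bound[OF Suc.prems(2) x] x])
      show "((\<lambda>x. u x * v x) has_real_derivative u x * v' x + u' x * v x) (at x)" using der x by blast
    qed (rule w')
  }
qed

lemma integral_bounded_const:
  fixes f :: "real \<Rightarrow> real"
  assumes "f integrable_on {-1..1}" "\<And>x. x \<in> {-1..1} \<Longrightarrow> \<bar>f x\<bar> * c \<le> d" "c \<ge> 0"
  shows "\<bar>integral {-1..1} f\<bar> * c \<le> 2 * d"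
proof -
  have "norm (integral {-1..1} (\<lambda>x. f x * c)) \<le> integral {-1..1} (\<lambda>x::real. d)"
    by (rule integral_norm_bound_integral) (use assms in \<open>auto simp: abs_mult intro: integrable_on_mult_left\<close>)
  then show ?thesis using assms(3) by (simp add: abs_mult)
qed

text \<open>
  Differentiation under the integral sign by dominated convergence: in a compact neighbourhood
  of y the weight has a positive lower bound c, so the difference quotients are bounded by M /
  c^(i+1).
\<close>
lemma wsmooth_integral:
  fixes F :: "real \<Rightarrow> real \<Rightarrow> real"
  shows "(\<And>x. x \<in> {-1..1} \<Longrightarrow> wsmooth i s M (F x)) \<Longrightarrow>
   (\<And>y. y \<in> {-1<..<1} \<Longrightarrow> (\<lambda>x. F x y) integrable_on {-1..1}) \<Longrightarrow>
   wsmooth i s (2 * M) (\<lambda>y. integral {-1..1} (\<lambda>x. F x y))"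
proof (induction s arbitrary: i F)
  have bd: "\<bar>integral {-1..1} (\<lambda>x. F x y)\<bar> * weight y ^ i \<le> 2 * M"
    if "\<And>x. x \<in> {-1..1} \<Longrightarrow> wsmooth i s M (F x)" "(\<lambda>x. F x y) integrable_on {-1..1}" "y \<in> {-1<..<1}"
    for i s and F :: "real \<Rightarrow> real \<Rightarrow> real" and y
    by (rule integral_bounded_const[OF that(2) wsmooth_bound[OF that(1) that(3)]]) (use weight_pos[OF that(3)] in auto)
  {
    case 0
    have "wlip (Suc i) (2 * M) (\<lambda>y. integral {-1..1} (\<lambda>x. F x y))" unfolding wlip_def
    proof (intro ballI)
      fix y z :: real assume yz: "y \<in> {-1<..<1}" "z \<in> {-1<..<1}"
      have "\<bar>integral {-1..1} (\<lambda>x. F x y - F x z)\<bar> * min (weight y) (weight z) ^ Suc i \<le> 2 * (M * \<bar>y - z\<bar>)"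
      proof (rule integral_bounded_const)
        show "(\<lambda>x. F x y - F x z) integrable_on {-1..1}" using 0(2) yz by (intro integrable_diff) auto
        fix x :: real assume "x \<in> {-1..1}"
        then show "\<bar>F x y - F x z\<bar> * min (weight y) (weight z) ^ Suc i \<le> M * \<bar>y - z\<bar>"
          using 0(1)[of x] yz by (simp only: wsmooth.simps wlip_def)
      qed (use weight_pos yz in \<open>auto simp: less_imp_le\<close>)
      then show "\<bar>integral {-1..1} (\<lambda>x. F x y) - integral {-1..1} (\<lambda>x. F x z)\<bar> * min (weight y) (weight z) ^ Suc i \<le> 2 * M * \<bar>y - z\<bar>"
        using integral_diff[OF 0(2)[OF yz(1)] 0(2)[OF yz(2)]] by (simp add: mult.assoc)
    qed
    then show ?case using bd[OF 0(1) 0(2)] by simp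
  next
    case (Suc s)
    have "\<forall>x\<in>{-1..1}. \<exists>u'. (\<forall>y\<in>{-1<..<1}. (F x has_real_derivative u' y) (at y)) \<and> wsmooth (Suc i) s M u'"
      using Suc.prems(1) unfolding wsmooth.simps by blast
    then obtain F' where F'0: "\<forall>x\<in>{-1..1}. (\<forall>y\<in>{-1<..<1}. (F x has_real_derivative F' x y) (at y)) \<and> wsmooth (Suc i) s M (F' x)"
      by metis
    have F': "(F x has_real_derivative F' x y) (at y)" if "x \<in> {-1..1}" "y \<in> {-1<..<1}" for x y using F'0 that by blast
    have F'w: "wsmooth (Suc i) s M (F' x)" if "x \<in> {-1..1}" for x using F'0 that by blast
    have lip: "\<bar>F x y - F x z\<bar> * min (weight y) (weight z) ^ Suc i \<le> M * \<bar>y - z\<bar>"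
      if "x \<in> {-1..1}" "y \<in> {-1<..<1}" "z \<in> {-1<..<1}" for x y z
      using wsmooth_imp_wlip[OF Suc.prems(1)[OF that(1)]] that unfolding wlip_def by blast
    have main: "(\<lambda>x. F' x y) integrable_on {-1..1} \<and>
      ((\<lambda>y. integral {-1..1} (\<lambda>x. F x y)) has_real_derivative integral {-1..1} (\<lambda>x. F' x y)) (at y)"
      if y: "y \<in> {-1<..<1}" for y
    proof -
      define e where "e = (1 - \<bar>y\<bar>) / 2"
      have e: "0 < e" "y - e \<in> {-1<..<1}" "y + e \<in> {-1<..<1}" using y by (auto simp: e_def abs_if field_simps)
      define c where "c = min (weight (y - e)) (weight (y + e))"
      have c: "0 < c" using weight_pos e by (simp add: c_def)
      have near: "z \<in> {-1<..<1}" "c \<le> weight z" if "z \<in> {y - e<..<y + e}" for z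
        using weight_between[OF e(2,3), of z] that e by (auto simp: c_def)
      have lim: "(\<lambda>x. F' x y) integrable_on {-1..1} \<and>
         (\<lambda>n. (integral {-1..1} (\<lambda>x. F x (X n)) - integral {-1..1} (\<lambda>x. F x y)) / (X n - y)) \<longlonglongrightarrow> integral {-1..1} (\<lambda>x. F' x y)"
        if X: "\<And>n. X n \<in> {y - e<..<y + e} - {y}" "X \<longlonglongrightarrow> y" for X
      proof -
        have int: "(\<lambda>x. (F x (X n) - F x y) / (X n - y)) integrable_on {-1..1}" for n
        proof -
          have "X n \<in> {-1<..<1}" using near(1)[of "X n"] X(1)[of n] by blast
          then have "(\<lambda>x. F x (X n) - F x y) integrable_on {-1..1}" by (intro integrable_diff Suc.prems(2) y)
          then have "(\<lambda>x. (F x (X n) - F x y) * inverse (X n - y)) integrable_on {-1..1}" by (rule integrable_on_mult_left)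
          then show ?thesis by (simp only: divide_inverse)
        qed
        have bnd: "norm ((F x (X n) - F x y) / (X n - y)) \<le> M / c ^ Suc i" if x: "x \<in> {-1..1}" for n x
        proof -
          have Xn: "X n \<in> {-1<..<1}" "c \<le> weight (X n)" "X n \<noteq> y" using near[of "X n"] X(1)[of n] by auto
          have "c \<le> weight y" using near(2)[of y] e(1) by simp
          then have "c ^ Suc i \<le> min (weight (X n)) (weight y) ^ Suc i" using Xn c by (intro power_mono) auto
          then have "\<bar>F x (X n) - F x y\<bar> * c ^ Suc i \<le> \<bar>F x (X n) - F x y\<bar> * min (weight (X n)) (weight y) ^ Suc i"
            by (intro mult_left_mono) auto
          also have "\<dots> \<le> M * \<bar>X n - y\<bar>" by (rule lip[OF x Xn(1) y])
          finally have "\<bar>F x (X n) - F x y\<bar> * c ^ Suc i \<le> M * \<bar>X n - y\<bar>" .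
          then show ?thesis using Xn(3) c by (simp add: divide_simps mult_ac)
        qed
        have conv: "(\<lambda>n. (F x (X n) - F x y) / (X n - y)) \<longlonglongrightarrow> F' x y" if x: "x \<in> {-1..1}" for x
        proof -
          have "((\<lambda>z. (F x z - F x y) / (z - y)) \<longlongrightarrow> F' x y) (at y)"
            using F'[OF x y] by (simp add: has_field_derivative_iff)
          moreover have "filterlim X (at y) sequentially"
            using X by (auto simp: filterlim_at)
          ultimately show ?thesis by (rule filterlim_compose)
        qed
        have "(\<lambda>x::real. M / c ^ Suc i) integrable_on {-1..1}" by (rule integrable_const_ivl)
        note dc = dominated_convergence[OF int this bnd conv]
        have "integral {-1..1} (\<lambda>x. (F x (X n) - F x y) / (X n - y)) =
          (integral {-1..1} (\<lambda>x. F x (X n)) - integral {-1..1} (\<lambda>x. F x y)) / (X n - y)" for n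
        proof -
          have "X n \<in> {-1<..<1}" using near(1)[of "X n"] X(1)[of n] by blast
          then show ?thesis using integral_diff[OF Suc.prems(2) Suc.prems(2)[OF y], of "X n"]
            by (simp only: divide_inverse integral_mult_left)
        qed
        then show ?thesis using dc by (simp only:)
      qed
      \<comment> \<open>Dominated convergence along this one sequence makes the limit
        integrable.\<close>
      have "(\<lambda>n. y + e / (real n + 2)) \<longlonglongrightarrow> y + 0"
        by (intro tendsto_add tendsto_const) (real_asymp)
      then have "(\<lambda>n. y + e / (real n + 2)) \<longlonglongrightarrow> y" by simp
      then have "(\<lambda>x. F' x y) integrable_on {-1..1}"
      proof -
        assume "(\<lambda>n. y + e / (real n + 2)) \<longlonglongrightarrow> y"
        moreover have "y + e / (real n + 2) \<in> {y - e<..<y + e} - {y}" for n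
        proof -
          have "0 < e / (real n + 2)" "e / (real n + 2) < e" using e(1) by (simp_all add: pos_divide_less_eq algebra_simps add_pos_nonneg)
          then show ?thesis by auto
        qed
        ultimately show ?thesis using lim[of "\<lambda>n. y + e / (real n + 2)"] by (simp only:)
      qed
      moreover have "((\<lambda>z. (integral {-1..1} (\<lambda>x. F x z) - integral {-1..1} (\<lambda>x. F x y)) / (z - y))
         \<longlongrightarrow> integral {-1..1} (\<lambda>x. F' x y)) (at y within {y - e<..<y + e})"
        unfolding tendsto_at_iff_sequentially comp_def using lim by blast
      then have "((\<lambda>z. (integral {-1..1} (\<lambda>x. F x z) - integral {-1..1} (\<lambda>x. F x y)) / (z - y))
         \<longlongrightarrow> integral {-1..1} (\<lambda>x. F' x y)) (at y)"
        using e(1) at_within_open[of y "{y - e<..<y + e}"] by simp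
      ultimately show ?thesis by (simp add: has_field_derivative_iff)
    qed
    have w': "wsmooth (Suc i) s (2 * M) (\<lambda>y. integral {-1..1} (\<lambda>x. F' x y))"
      by (rule Suc.IH) (use F'w main in blast)+
    show ?case
    proof (rule wsmooth_SucI[where u' = "\<lambda>y. integral {-1..1} (\<lambda>x. F' x y)"])
      fix y :: real assume y: "y \<in> {-1<..<1}"
      show "\<bar>integral {-1..1} (\<lambda>x. F x y)\<bar> * weight y ^ i \<le> 2 * M"
        by (rule bd[OF Suc.prems(1) Suc.prems(2)[OF y] y])
      show "((\<lambda>y. integral {-1..1} (\<lambda>x. F x y)) has_real_derivative integral {-1..1} (\<lambda>x. F' x y)) (at y)"
        using main[OF y] by blast
    qed (rule w')
  }
qed

text \<open>
  By wlip_angle, v is Lipschitz in the angle, and two angles differ by less than 4. The weight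
  at \<xi> is at least 1/2, which is where the factor 2^j comes from.
\<close>
lemma wlip_imp_bound:
  assumes v: "wlip (Suc j) E v" and E: "E \<ge> 0" and xi: "\<xi> \<in> {-1/2<..<1/2}" "\<bar>v \<xi>\<bar> \<le> B" and x: "x \<in> {-1<..<1}"
  shows "\<bar>v x\<bar> * weight x ^ j \<le> B + 2 ^ j * 8 * E"
proof -
  define a where "a = arccos x"
  define b where "b = arccos \<xi>"
  have a: "x = cos a" "a \<in> {0<..<pi}" using x arccos_lt_bounded[of x] by (auto simp: a_def)
  have b: "\<xi> = cos b" "b \<in> {0<..<pi}" using xi arccos_lt_bounded[of \<xi>] by (auto simp: b_def)
  have wa: "weight x = sin a" "weight \<xi> = sin b" unfolding a(1) b(1) by (rule weight_cos; use a b in auto)+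
  have sb: "1 / 2 \<le> sin b"
  proof -
    have "\<xi>\<^sup>2 \<le> (1/2)\<^sup>2" using xi(1) by (subst abs_le_square_iff[symmetric]) auto
    then have "(1/2)\<^sup>2 \<le> 1 - \<xi>\<^sup>2" by (simp add: power2_eq_square)
    then have "1 / 2 \<le> weight \<xi>" unfolding weight_def by (rule real_le_rsqrt)
    then show ?thesis using wa by simp
  qed
  have sa: "0 < sin a" using a(2) by (auto simp: sin_gt_zero)
  have "sin a \<le> 2 * min (sin a) (sin b)"
  proof (cases "sin a \<le> sin b")
    case False
    have "sin a \<le> 2 * sin b" using sb sin_le_one[of a] by linarith
    then show ?thesis using False by (simp add: min_def)
  qed (use sa in simp)
  then have "sin a ^ j \<le> (2 * min (sin a) (sin b)) ^ j" using sa by (intro power_mono) auto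
  then have "\<bar>v x - v \<xi>\<bar> * sin a ^ j \<le> \<bar>v x - v \<xi>\<bar> * (2 ^ j * min (sin a) (sin b) ^ j)"
    by (intro mult_left_mono) (auto simp: power_mult_distrib)
  also have "\<dots> = 2 ^ j * (\<bar>v x - v \<xi>\<bar> * min (sin a) (sin b) ^ j)" by simp
  also have "\<dots> \<le> 2 ^ j * (2 * E * \<bar>a - b\<bar>)"
    unfolding a(1) b(1) by (intro mult_left_mono wlip_angle[OF v E a(2) b(2)]) auto
  also have "\<dots> \<le> 2 ^ j * (2 * E * 4)"
    using a(2) b(2) pi_less_4 E by (intro mult_left_mono) auto
  finally have 1: "\<bar>v x - v \<xi>\<bar> * sin a ^ j \<le> 2 ^ j * 8 * E" by simp
  have 2: "\<bar>v \<xi>\<bar> * sin a ^ j \<le> B * 1"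
    using xi(2) sa by (intro mult_mono power_le_one) auto
  have "\<bar>v x\<bar> * sin a ^ j \<le> (\<bar>v x - v \<xi>\<bar> + \<bar>v \<xi>\<bar>) * sin a ^ j" using sa by (intro mult_right_mono) auto
  then show ?thesis using 1 2 by (simp add: wa distrib_right)
qed

primrec mean_value_const :: "nat \<Rightarrow> real" where
  "mean_value_const 0 = 1"
| "mean_value_const (Suc j) = 2 * 3 ^ Suc j * mean_value_const j"

lemma mean_value_const_pos: "mean_value_const j > 0"
  by (induction j) auto

text \<open>
  Here D j is the derivative of order j. The induction picks points in the two outer thirds of
  the interval where D j is small; the mean value theorem between them gives the point for D
  (j + 1).
\<close>
lemma iterated_mean_value:
  assumes der: "\<And>j x. j < s \<Longrightarrow> x \<in> {-1<..<1} \<Longrightarrow> (D j has_real_derivative D (Suc j) x) (at x)"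
    and bd: "\<And>x. x \<in> {-1<..<1} \<Longrightarrow> \<bar>D 0 x\<bar> \<le> M"
  shows "j \<le> s \<Longrightarrow> -1 < a \<Longrightarrow> a < b \<Longrightarrow> b < 1 \<Longrightarrow> \<exists>\<xi>. a < \<xi> \<and> \<xi> < b \<and> \<bar>D j \<xi>\<bar> * (b - a) ^ j \<le> mean_value_const j * M"
proof (induction j arbitrary: a b)
  case 0
  then show ?case using bd[of "(a + b) / 2"] by (intro exI[of _ "(a + b) / 2"]) auto
next
  case (Suc j)
  define l where "l = (b - a) / 3"
  have l: "l > 0" using Suc.prems by (simp add: l_def)
  obtain x where x: "a < x" "x < a + l" "\<bar>D j x\<bar> * (a + l - a) ^ j \<le> mean_value_const j * M"
    using Suc.IH[of a "a + l"] Suc.prems l by (auto simp: l_def field_simps)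
  obtain y where y: "b - l < y" "y < b" "\<bar>D j y\<bar> * (b - (b - l)) ^ j \<le> mean_value_const j * M"
    using Suc.IH[of "b - l" b] Suc.prems l by (auto simp: l_def field_simps)
  have xy: "l \<le> y - x" using x(2) y(1) by (simp add: l_def field_simps)
  then have "x < y" using l by linarith
  obtain z where z: "x < z" "z < y" "D j y - D j x = (y - x) * D (Suc j) z"
  proof -
    have "(D j has_real_derivative D (Suc j) t) (at t)" if "x \<le> t" "t \<le> y" for t
      by (rule der) (use Suc.prems that x y in auto)
    then show ?thesis using MVT2[OF \<open>x < y\<close>, of "D j" "D (Suc j)"] that by blast
  qed
  have "l * \<bar>D (Suc j) z\<bar> \<le> (y - x) * \<bar>D (Suc j) z\<bar>" using xy by (intro mult_right_mono) auto
  also have "\<dots> = \<bar>D j y - D j x\<bar>" using z(3) \<open>x < y\<close> by (simp add: abs_mult)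
  finally have "l * \<bar>D (Suc j) z\<bar> * l ^ j \<le> \<bar>D j y - D j x\<bar> * l ^ j" using l by (intro mult_right_mono) auto
  also have "\<dots> \<le> (\<bar>D j y\<bar> + \<bar>D j x\<bar>) * l ^ j" using l by (intro mult_right_mono) auto
  also have "\<dots> \<le> 2 * mean_value_const j * M" using x(3) y(3) by (simp add: distrib_right)
  finally have "\<bar>D (Suc j) z\<bar> * l ^ Suc j \<le> 2 * mean_value_const j * M" by (simp add: mult_ac)
  then have "3 ^ Suc j * (\<bar>D (Suc j) z\<bar> * l ^ Suc j) \<le> 3 ^ Suc j * (2 * mean_value_const j * M)" by (intro mult_left_mono) auto
  moreover have "3 ^ Suc j * l ^ Suc j = (b - a) ^ Suc j" 
  proof -
    have "3 * l = b - a" by (simp add: l_def)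
    then show ?thesis unfolding power_mult_distrib[symmetric] by (simp only:)
  qed
  ultimately have "\<bar>D (Suc j) z\<bar> * (b - a) ^ Suc j \<le> mean_value_const (Suc j) * M"
    by (simp only: mean_value_const.simps mult.left_commute[of "3 ^ Suc j"] mult.assoc)
  then show ?case using z x y by (intro exI[of _ z]) auto
qed

text \<open>
  The intermediate derivatives are controlled by the two ends of the chain. In the induction,
  which goes down from order s, iterated_mean_value bounds the derivative at one point by the
  maximum of D 0, and wlip_imp_bound propagates this bound by means of the next higher
  derivative.
\<close>
lemma derivative_chain_wsmooth:
  "k \<le> s \<Longrightarrow> \<exists>A\<ge>0. \<forall>M D. (\<forall>j<s. \<forall>x\<in>{-1<..<1}. (D j has_real_derivative D (Suc j) x) (at x)) \<longrightarrow>
     (\<forall>x\<in>{-1<..<1}. \<bar>D 0 x\<bar> \<le> M) \<longrightarrow> wlip (Suc s) M (D s) \<longrightarrow> wsmooth (s - k) k (A * M) (D (s - k))"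
proof (induction k)
  case 0
  show ?case
  proof (intro exI[of _ "mean_value_const s + 2 ^ s * 8 + 1"] conjI allI impI)
    fix M and D :: "nat \<Rightarrow> real \<Rightarrow> real"
    assume D: "\<forall>j<s. \<forall>x\<in>{-1<..<1}. (D j has_real_derivative D (Suc j) x) (at x)"
      and M: "\<forall>x\<in>{-1<..<1}. \<bar>D 0 x\<bar> \<le> M" and lip: "wlip (Suc s) M (D s)"
    have M0: "0 \<le> M" using M[rule_format, of 0] by auto
    obtain \<xi> where xi: "-1/2 < \<xi>" "\<xi> < 1/2" "\<bar>D s \<xi>\<bar> * (1/2 - (-1/2)) ^ s \<le> mean_value_const s * M"
      using iterated_mean_value[of s D M s "-1/2" "1/2"] D M by auto
    have bd: "\<bar>D s x\<bar> * weight x ^ s \<le> mean_value_const s * M + 2 ^ s * 8 * M" if "x \<in> {-1<..<1}" for x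
      by (rule wlip_imp_bound[OF lip M0 _ _ that, of \<xi>]) (use xi in auto)
    have "0 \<le> mean_value_const s * M" "0 \<le> 2 ^ s * 8 * M" using M0 mean_value_const_pos[of s] by auto
    then have "mean_value_const s * M + 2 ^ s * 8 * M \<le> (mean_value_const s + 2 ^ s * 8 + 1) * M"
      "M \<le> (mean_value_const s + 2 ^ s * 8 + 1) * M" using M0 by (auto simp: distrib_right)
    then show "wsmooth (s - 0) 0 ((mean_value_const s + 2 ^ s * 8 + 1) * M) (D (s - 0))"
      using bd wlip_mono[OF lip] by (simp, intro ballI) (rule order_trans, auto)
  qed (use mean_value_const_pos[of s] in auto)
next
  case (Suc k)
  then obtain A where A: "A \<ge> 0" "\<And>M D. (\<forall>j<s. \<forall>x\<in>{-1<..<1}. (D j has_real_derivative D (Suc j) x) (at x)) \<Longrightarrow>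
     (\<forall>x\<in>{-1<..<1}. \<bar>D 0 x\<bar> \<le> M) \<Longrightarrow> wlip (Suc s) M (D s) \<Longrightarrow> wsmooth (s - k) k (A * M) (D (s - k))"
    by auto
  define i where "i = s - Suc k"
  have i: "s - k = Suc i" "i < s" using Suc.prems by (auto simp: i_def)
  let ?A = "mean_value_const i + 2 ^ i * 8 * A + A"
  show ?case unfolding i_def[symmetric]
  proof (intro exI[of _ ?A] conjI allI impI)
    fix M and D :: "nat \<Rightarrow> real \<Rightarrow> real"
    assume D: "\<forall>j<s. \<forall>x\<in>{-1<..<1}. (D j has_real_derivative D (Suc j) x) (at x)"
      and M: "\<forall>x\<in>{-1<..<1}. \<bar>D 0 x\<bar> \<le> M" and lip: "wlip (Suc s) M (D s)"
    have M0: "0 \<le> M" using M[rule_format, of 0] by auto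
    have AM: "0 \<le> A * M" using A(1) M0 by simp
    have S: "wsmooth (Suc i) k (A * M) (D (Suc i))" using A(2)[OF D M lip] i by simp
    have d: "(D i has_real_derivative D (Suc i) x) (at x)" if "x \<in> {-1<..<1}" for x using D i(2) that by blast
    have lip': "wlip (Suc i) (A * M) (D i)" by (rule deriv_bound_imp_wlip[OF d wsmooth_bound[OF S]])
    obtain \<xi> where xi: "-1/2 < \<xi>" "\<xi> < 1/2" "\<bar>D i \<xi>\<bar> * (1/2 - (-1/2)) ^ i \<le> mean_value_const i * M"
      using iterated_mean_value[of s D M i "-1/2" "1/2"] D M i by auto
    have bd: "\<bar>D i x\<bar> * weight x ^ i \<le> mean_value_const i * M + 2 ^ i * 8 * (A * M)" if "x \<in> {-1<..<1}" for x
      by (rule wlip_imp_bound[OF lip' AM _ _ that, of \<xi>]) (use xi in auto)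
    have "0 \<le> mean_value_const i * M" "0 \<le> 2 ^ i * 8 * (A * M)" using M0 AM mean_value_const_pos[of i] by auto
    then have le: "mean_value_const i * M + 2 ^ i * 8 * (A * M) \<le> ?A * M" "A * M \<le> ?A * M"
      using AM by (simp_all only: distrib_right mult.assoc)
    have "\<forall>x\<in>{-1<..<1}. \<bar>D i x\<bar> * weight x ^ i \<le> ?A * M" using bd le(1) by (blast intro: order_trans)
    moreover have "wsmooth (Suc i) k (?A * M) (D (Suc i))" by (rule wsmooth_mono[OF S le(2)])
    ultimately show "wsmooth i (Suc k) (?A * M) (D i)" using d unfolding wsmooth.simps by blast
  qed (use A(1) mean_value_const_pos[of i] in \<open>auto intro!: add_nonneg_nonneg\<close>)
qed

lemma max_norm_ge:
  assumes "continuous_on {-1..1} f" "x \<in> {-1..1}"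
  shows "\<bar>f x\<bar> \<le> max_norm f"
proof -
  have "compact ((\<lambda>x. \<bar>f x\<bar>) ` {-1..1})"
    using assms(1) by (intro compact_continuous_image continuous_on_rabs) auto
  then have "bdd_above ((\<lambda>x. \<bar>f x\<bar>) ` {-1..1})" by (intro bounded_imp_bdd_above compact_imp_bounded)
  then show ?thesis unfolding max_norm_def using assms(2) by (intro cSUP_upper)
qed

lemma max_norm_le: "(\<And>x. x \<in> {-1..1} \<Longrightarrow> \<bar>f x\<bar> \<le> d) \<Longrightarrow> max_norm f \<le> d"
  unfolding max_norm_def by (rule cSUP_least) auto

lemma weighted_deriv_norm_ae:
  assumes "weighted_deriv_norm r f \<le> ereal M"
  obtains N where "negligible N" "\<And>x. x \<in> {-1<..<1} - N \<Longrightarrow> \<bar>(deriv ^^ r) f x * weight x ^ r\<bar> \<le> M"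
proof -
  let ?L = "lebesgue_on {-1<..<1::real}"
  have "AE x in ?L. ereal \<bar>(deriv ^^ r) f x * weight x ^ r\<bar> \<le> weighted_deriv_norm r f"
    unfolding weighted_deriv_norm_def by (rule esssup_AE)
  then have "AE x in ?L. \<bar>(deriv ^^ r) f x * weight x ^ r\<bar> \<le> M"
    by (rule AE_mp) (use assms in \<open>auto intro!: AE_I2 dest: order_trans\<close>)
  then obtain N where N: "N \<in> null_sets ?L" "{x \<in> space ?L. \<not> \<bar>(deriv ^^ r) f x * weight x ^ r\<bar> \<le> M} \<subseteq> N"
    by (auto simp: eventually_ae_filter)
  have "N \<in> null_sets lebesgue" using N(1) by (auto simp: null_sets_restrict_space)
  then have "negligible N" by (simp add: negligible_iff_null_sets)
  then show ?thesis using N(2) that by (auto simp: space_restrict_space)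
qed

lemma weighted_deriv_norm_nonneg: "0 \<le> weighted_deriv_norm r f"
proof (rule ccontr)
  assume neg: "\<not> ?thesis"
  let ?L = "lebesgue_on {-1<..<1::real}"
  have "AE x in ?L. ereal \<bar>(deriv ^^ r) f x * weight x ^ r\<bar> \<le> weighted_deriv_norm r f"
    unfolding weighted_deriv_norm_def by (rule esssup_AE)
  then have "AE x in ?L. False"
  proof (rule AE_mp, intro AE_I2 impI)
    fix x assume "ereal \<bar>(deriv ^^ r) f x * weight x ^ r\<bar> \<le> weighted_deriv_norm r f"
    moreover have "weighted_deriv_norm r f < 0" using neg by (simp only: not_le)
    ultimately have "ereal \<bar>(deriv ^^ r) f x * weight x ^ r\<bar> < 0" by (rule order_le_less_trans)
    then show False by simp
  qed
  then have "emeasure ?L (space ?L) = 0" by (subst (asm) AE_iff_measurable[OF sets.top]) auto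
  then show False by (simp add: emeasure_restrict_space space_restrict_space)
qed

lemma absolutely_continuous_on_subset:
  assumes "absolutely_continuous_on S f" "T \<subseteq> S"
  shows "absolutely_continuous_on T f"
  unfolding absolutely_continuous_on_def
proof (intro allI impI)
  fix e :: real assume "e > 0"
  then obtain d where d: "d > 0" and D: "\<And>P. finite P \<Longrightarrow> (\<forall>(a, b)\<in>P. a < b \<and> {a..b} \<subseteq> S) \<Longrightarrow>
        disjoint_family_on (\<lambda>(a, b). {a<..<b}) P \<Longrightarrow>
        (\<Sum>(a, b)\<in>P. b - a) < d \<Longrightarrow> (\<Sum>(a, b)\<in>P. \<bar>f b - f a\<bar>) < e"
    using assms(1) unfolding absolutely_continuous_on_def by blast
  show "\<exists>d>0. \<forall>P. finite P \<longrightarrow> (\<forall>(a, b)\<in>P. a < b \<and> {a..b} \<subseteq> T) \<longrightarrow>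
      disjoint_family_on (\<lambda>(a, b). {a<..<b}) P \<longrightarrow> (\<Sum>(a, b)\<in>P. b - a) < d \<longrightarrow> (\<Sum>(a, b)\<in>P. \<bar>f b - f a\<bar>) < e"
  proof (intro exI[of _ d] conjI allI impI)
    fix P assume P: "finite P" "\<forall>(a, b)\<in>P. a < b \<and> {a..b} \<subseteq> T"
      "disjoint_family_on (\<lambda>(a, b). {a<..<b}) P" "(\<Sum>(a, b)\<in>P. b - a) < d"
    have "\<forall>(a, b)\<in>P. a < b \<and> {a..b} \<subseteq> S"
    proof
      fix p assume "p \<in> P"
      then have "fst p < snd p \<and> {fst p..snd p} \<subseteq> T" using P(2) by (simp add: case_prod_beta)
      then show "case p of (a, b) \<Rightarrow> a < b \<and> {a..b} \<subseteq> S" using assms(2) by (simp add: case_prod_beta) (meson order_trans)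
    qed
    then show "(\<Sum>(a, b)\<in>P. \<bar>f b - f a\<bar>) < e" by (rule D[OF P(1) _ P(3,4)])
  qed (rule d)
qed

text \<open>
  On a compact subinterval the essential bound of the derivative of order s + 1 is a Lipschitz
  constant for the derivative of order s, by absolute continuity; this is the weighted
  Lipschitz condition. The other derivatives are supplied by derivative_chain_wsmooth.
\<close>
theorem Wspace_wsmooth:
  "\<exists>A. \<forall>u M. u \<in> Wspace (Suc s) \<longrightarrow> Wnorm (Suc s) u \<le> ereal M \<longrightarrow> wsmooth 0 s (A * M) u"
proof -
  obtain A where A: "A \<ge> 0" "\<And>M D. (\<forall>j<s. \<forall>x\<in>{-1<..<1}. (D j has_real_derivative D (Suc j) x) (at x)) \<Longrightarrow>
     (\<forall>x\<in>{-1<..<1}. \<bar>D 0 x\<bar> \<le> M) \<Longrightarrow> wlip (Suc s) M (D s) \<Longrightarrow> wsmooth 0 s (A * M) (D 0)"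
    using derivative_chain_wsmooth[of s s] by auto
  show ?thesis
  proof (intro exI[of _ A] allI impI)
    fix u M assume u: "u \<in> Wspace (Suc s)" and norm: "Wnorm (Suc s) u \<le> ereal M"
    have cont: "continuous_on {-1..1} u" using u by (simp add: Wspace_def C0_def)
    have max0: "0 \<le> max_norm u" using max_norm_ge[OF cont, of 0] by auto
    have m1: "max_norm u \<le> M"
    proof -
      have "ereal (max_norm u) + 0 \<le> Wnorm (Suc s) u" unfolding Wnorm_def
        by (intro add_left_mono weighted_deriv_norm_nonneg)
      then show ?thesis using norm by (metis add.right_neutral ereal_less_eq(3) order_trans)
    qed
    have m2: "weighted_deriv_norm (Suc s) u \<le> ereal M"
    proof -
      have "0 + weighted_deriv_norm (Suc s) u \<le> Wnorm (Suc s) u" unfolding Wnorm_def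
        using max0 by (intro add_right_mono) simp
      then show ?thesis using norm by (metis add_0 order_trans)
    qed
    define D where "D j = (deriv ^^ j) u" for j
    have "(D j has_real_derivative D (Suc j) x) (at x)" if "j < s" "x \<in> {-1<..<1}" for j x
    proof -
      have "D j field_differentiable at x" using u that by (simp add: Wspace_def D_def)
      then show ?thesis by (simp add: D_def DERIV_deriv_iff_field_differentiable)
    qed
    moreover have "\<bar>D 0 x\<bar> \<le> M" if "x \<in> {-1<..<1}" for x
      using max_norm_ge[OF cont, of x] that m1 by (simp add: D_def)
    moreover have "wlip (Suc s) M (D s)"
    proof -
      obtain N where N: "negligible N" "\<And>x. x \<in> {-1<..<1} - N \<Longrightarrow> \<bar>(deriv ^^ Suc s) u x * weight x ^ Suc s\<bar> \<le> M"
        using weighted_deriv_norm_ae[OF m2] by blast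
      have ac: "absolutely_continuous_on {-1<..<1} (D s)" using u by (simp add: Wspace_def D_def)
      have main: "\<bar>D s z - D s y\<bar> * min (weight y) (weight z) ^ Suc s \<le> M * (z - y)"
        if yz: "y \<in> {-1<..<1}" "z \<in> {-1<..<1}" "y < z" for y z
      proof -
        let ?m = "min (weight y) (weight z)"
        have m: "?m > 0" using weight_pos yz by simp
        have "absolutely_continuous_on {y..z} (D s)"
        proof -
          have "{y..z} \<subseteq> {-1<..<1}" using yz by auto
          with ac show ?thesis by (rule absolutely_continuous_on_subset)
        qed
        then have "\<bar>D s z - D s y\<bar> \<le> (M / ?m ^ Suc s) * (z - y)"
        proof (rule ae_deriv_bound_imp_Lipschitz[OF yz(3) _ N(1)])
          fix x d assume x: "x \<in> {y<..<z} - N" and d: "(D s has_real_derivative d) (at x)"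
          have xI: "x \<in> {-1<..<1} - N" using x yz by auto
          have "d = (deriv ^^ Suc s) u x" using DERIV_imp_deriv[OF d] by (simp add: D_def)
          then have 1: "\<bar>d\<bar> * weight x ^ Suc s \<le> M" using N(2)[OF xI] weight_pos[of x] xI by (simp add: abs_mult)
          have "?m ^ Suc s \<le> weight x ^ Suc s" using weight_between[of y z x] yz x m by (intro power_mono) auto
          then have "\<bar>d\<bar> * ?m ^ Suc s \<le> \<bar>d\<bar> * weight x ^ Suc s" by (intro mult_left_mono) auto
          then have "\<bar>d\<bar> * ?m ^ Suc s \<le> M" using 1 by linarith
          then show "\<bar>d\<bar> \<le> M / ?m ^ Suc s" using m by (simp only: pos_le_divide_eq zero_less_power)
        qed
        then have "\<bar>D s z - D s y\<bar> * ?m ^ Suc s \<le> (M / ?m ^ Suc s) * (z - y) * ?m ^ Suc s"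
          using m by (intro mult_right_mono) auto
        then show ?thesis using m by simp
      qed
      show ?thesis unfolding wlip_def
      proof (intro ballI)
        fix y z :: real assume yz: "y \<in> {-1<..<1}" "z \<in> {-1<..<1}"
        show "\<bar>D s y - D s z\<bar> * min (weight y) (weight z) ^ Suc s \<le> M * \<bar>y - z\<bar>"
          using main[of y z] main[of z y] yz
          by (cases y z rule: linorder_cases) (simp_all add: abs_minus_commute min.commute)
      qed
    qed
    ultimately have "wsmooth 0 s (A * M) (D 0)" using A(2)[of D M] by blast
    then show "wsmooth 0 s (A * M) u" by (simp add: D_def)
  qed
qed

section \<open>Composition with functions of bounded mixed partial derivatives\<close>

text \<open>
  A quantitative form of the argument for the symmetry of mixed partial derivatives: apply the
  mean value theorem to the second difference of a over a rectangle with sides k and t - v,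
  first in the second variable and then in the first, divide by k and let k tend to 0. With c
  = 0 this is a Lipschitz bound for ax in the second variable; with c = bx x v and a small B,
  it gives the derivative of ax there.
\<close>
lemma mixed_partial_swap:
  fixes a ax b bx :: "real \<Rightarrow> real \<Rightarrow> real"
  assumes e: "0 < e"
    and a_der: "\<And>s t. \<bar>s - x\<bar> < e \<Longrightarrow> \<bar>t - v\<bar> < e \<Longrightarrow> ((\<lambda>t. a s t) has_real_derivative b s t) (at t)"
    and ax: "\<And>t. \<bar>t - v\<bar> < e \<Longrightarrow> ((\<lambda>s. a s t) has_real_derivative ax x t) (at x)"
    and b_der: "\<And>s t. \<bar>s - x\<bar> < e \<Longrightarrow> \<bar>t - v\<bar> < e \<Longrightarrow> ((\<lambda>s. b s t) has_real_derivative bx s t) (at s)"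
    and B: "\<And>s t. \<bar>s - x\<bar> < e \<Longrightarrow> \<bar>t - v\<bar> < e \<Longrightarrow> \<bar>bx s t - c\<bar> \<le> B"
    and t: "\<bar>t - v\<bar> < e"
  shows "\<bar>ax x t - ax x v - c * (t - v)\<bar> \<le> B * \<bar>t - v\<bar>"
proof -
  have ball: "s \<in> ball y e \<longleftrightarrow> \<bar>s - y\<bar> < e" for s y :: real by (auto simp: dist_real_def abs_minus_commute)
  have quot: "\<bar>(a (x + k) t - a x t) / k - (a (x + k) v - a x v) / k - c * (t - v)\<bar> \<le> B * \<bar>t - v\<bar>"
    if k: "k \<noteq> 0" "\<bar>k\<bar> < e" for k
  proof -
    have xk: "\<bar>x + k - x\<bar> < e" "\<bar>x - x\<bar> < e" using k e by auto
    have b_diff: "\<bar>b (x + k) w - b x w - c * k\<bar> \<le> B * \<bar>k\<bar>" if w: "\<bar>w - v\<bar> < e" for w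
    proof -
      have "norm ((b (x + k) w - c * (x + k)) - (b x w - c * x)) \<le> B * norm ((x + k) - x)"
      proof (rule field_differentiable_bound[where S = "ball x e" and f' = "\<lambda>s. bx s w - c"])
        fix s assume "s \<in> ball x e"
        then have s: "\<bar>s - x\<bar> < e" by (simp only: ball)
        have "((\<lambda>s. b s w - c * s) has_real_derivative bx s w - c * 1) (at s)"
          by (rule DERIV_diff[OF b_der[OF s w] DERIV_cmult[OF DERIV_ident]])
        then show "((\<lambda>s. b s w - c * s) has_real_derivative bx s w - c) (at s within ball x e)"
          by (simp only: mult_1_right has_field_derivative_at_within)
        show "norm (bx s w - c) \<le> B" using B[OF s w] by simp
      qed (use xk in \<open>simp_all only: ball convex_ball\<close>)
      then show ?thesis by (simp add: algebra_simps)
    qed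
    have "norm ((a (x + k) t - a x t - c * k * t) - (a (x + k) v - a x v - c * k * v)) \<le> (B * \<bar>k\<bar>) * norm (t - v)"
    proof (rule field_differentiable_bound[where S = "ball v e" and f' = "\<lambda>w. b (x + k) w - b x w - c * k"])
      fix w assume "w \<in> ball v e"
      then have w: "\<bar>w - v\<bar> < e" by (simp only: ball)
      have "((\<lambda>w. a (x + k) w - a x w - c * k * w) has_real_derivative b (x + k) w - b x w - c * k * 1) (at w)"
        by (rule DERIV_diff[OF DERIV_diff[OF a_der[OF xk(1) w] a_der[OF xk(2) w]] DERIV_cmult[OF DERIV_ident]])
      then show "((\<lambda>w. a (x + k) w - a x w - c * k * w) has_real_derivative b (x + k) w - b x w - c * k) (at w within ball v e)"
        by (simp only: mult_1_right has_field_derivative_at_within)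
      show "norm (b (x + k) w - b x w - c * k) \<le> B * \<bar>k\<bar>" using b_diff[OF w] by simp
    next
      show "v \<in> ball v e" using e by simp
    qed (use t in \<open>simp_all only: ball convex_ball\<close>)
    then have "\<bar>(a (x + k) t - a x t - c * k * t) - (a (x + k) v - a x v - c * k * v)\<bar> / \<bar>k\<bar> \<le> B * \<bar>k\<bar> * \<bar>t - v\<bar> / \<bar>k\<bar>"
      unfolding real_norm_def by (rule divide_right_mono) simp
    also have "\<dots> = B * \<bar>t - v\<bar>" using k(1) by simp
    finally have 1: "\<bar>(a (x + k) t - a x t - c * k * t) - (a (x + k) v - a x v - c * k * v)\<bar> / \<bar>k\<bar> \<le> B * \<bar>t - v\<bar>" .
    have "(p - q) / k - (p' - q') / k - c * (t - v) = ((p - q - c * k * t) - (p' - q' - c * k * v)) / k" for p q p' q'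
      using k(1) by (simp add: field_simps)
    then show ?thesis using 1 by (simp only: abs_divide)
  qed
  have vv: "\<bar>v - v\<bar> < e" using e by simp
  have "((\<lambda>k. \<bar>(a (x + k) t - a x t) / k - (a (x + k) v - a x v) / k - c * (t - v)\<bar>) \<longlongrightarrow> \<bar>ax x t - ax x v - c * (t - v)\<bar>) (at 0)"
    by (intro tendsto_rabs tendsto_diff tendsto_const ax[OF t, unfolded DERIV_def] ax[OF vv, unfolded DERIV_def])
  moreover have "\<forall>\<^sub>F k in at 0. \<bar>(a (x + k) t - a x t) / k - (a (x + k) v - a x v) / k - c * (t - v)\<bar> \<le> B * \<bar>t - v\<bar>"
    unfolding eventually_at
  proof (intro exI[of _ e] conjI ballI impI)
    fix k :: real assume "k \<noteq> 0 \<and> dist k 0 < e"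
    then show "\<bar>(a (x + k) t - a x t) / k - (a (x + k) v - a x v) / k - c * (t - v)\<bar> \<le> B * \<bar>t - v\<bar>"
      by (intro quot) (auto simp: dist_real_def)
  qed (rule e)
  ultimately show ?thesis by (rule tendsto_upperbound) simp
qed

text \<open>
  The function mixed_partial l1 l2 h is formed by l2 derivatives in the second variable,
  followed by l1 derivatives in the first. Differentiability in the second variable is
  therefore part of Wspace2 only for l1 = 0; for l1 > 0 it has to be derived.
\<close>
locale bounded_partials =
  fixes r :: nat and \<Omega> :: "(real \<times> real) set" and h :: "real \<Rightarrow> real \<Rightarrow> real" and B :: real
  assumes open_Omega: "open \<Omega>"
    and D1: "\<And>l1 l2 x v. l1 + l2 < r \<Longrightarrow> (x, v) \<in> \<Omega> \<Longrightarrow>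
       ((\<lambda>s. mixed_partial l1 l2 h s v) has_real_derivative mixed_partial (Suc l1) l2 h x v) (at x)"
    and D2: "\<And>l2 x v. l2 < r \<Longrightarrow> (x, v) \<in> \<Omega> \<Longrightarrow>
       ((\<lambda>t. mixed_partial 0 l2 h x t) has_real_derivative mixed_partial 0 (Suc l2) h x v) (at v)"
    and bound: "\<And>l1 l2 x v. l1 + l2 \<le> r \<Longrightarrow> (x, v) \<in> \<Omega> \<Longrightarrow> \<bar>mixed_partial l1 l2 h x v\<bar> \<le> B"
begin

lemma square_nbhd:
  assumes "(x, v) \<in> \<Omega>"
  obtains e where "e > 0" "\<And>s t. \<bar>s - x\<bar> < e \<Longrightarrow> \<bar>t - v\<bar> < e \<Longrightarrow> (s, t) \<in> \<Omega>"
proof -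
  obtain d where d: "d > 0" "ball (x, v) d \<subseteq> \<Omega>" using open_Omega assms open_contains_ball by blast
  show ?thesis
  proof
    show "d / 2 > 0" using d by simp
    fix s t assume st: "\<bar>s - x\<bar> < d / 2" "\<bar>t - v\<bar> < d / 2"
    have "dist (x, v) (s, t) \<le> \<bar>x - s\<bar> + \<bar>v - t\<bar>"
      unfolding dist_prod_def dist_real_def by (rule order_trans[OF sqrt_sum_squares_le_sum_abs]) simp
    then have "dist (x, v) (s, t) < d" using st by linarith
    then show "(s, t) \<in> \<Omega>" using d(2) by auto
  qed
qed

lemma lipschitz1:
  assumes "l1 + l2 < r" and sub: "\<And>s. min x y \<le> s \<Longrightarrow> s \<le> max x y \<Longrightarrow> (s, v) \<in> \<Omega>"
  shows "\<bar>mixed_partial l1 l2 h x v - mixed_partial l1 l2 h y v\<bar> \<le> B * \<bar>x - y\<bar>"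
proof -
  have "norm (mixed_partial l1 l2 h x v - mixed_partial l1 l2 h y v) \<le> B * norm (x - y)"
  proof (rule field_differentiable_bound[where S = "{min x y..max x y}" and f' = "\<lambda>s. mixed_partial (Suc l1) l2 h s v"])
    fix s assume "s \<in> {min x y..max x y}"
    then have s: "(s, v) \<in> \<Omega>" using sub by simp
    show "((\<lambda>s. mixed_partial l1 l2 h s v) has_real_derivative mixed_partial (Suc l1) l2 h s v) (at s within {min x y..max x y})"
      by (rule has_field_derivative_at_within[OF D1[OF assms(1) s]])
    have "Suc l1 + l2 \<le> r" using assms(1) by simp
    from bound[OF this s] show "norm (mixed_partial (Suc l1) l2 h s v) \<le> B" by simp
  qed auto
  then show ?thesis by simp
qed

text \<open>
  Up to order r - 2, the mixed partials with l1 > 0 are differentiable in the second variable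
  as well, and up to order r - 1 they satisfy a local Lipschitz condition there. Both follow
  from mixed_partial_swap by induction on l1; the Lipschitz condition for bx provides the
  continuity at (x,v) that the differentiability of ax requires.
\<close>
lemma partial2_of_mixed_partial:
  shows "(l1 + l2 + 1 < r \<or> (l1 = 0 \<and> l2 < r) \<longrightarrow> (x, v) \<in> \<Omega> \<longrightarrow>
      ((\<lambda>t. mixed_partial l1 l2 h x t) has_real_derivative mixed_partial l1 (Suc l2) h x v) (at v)) \<and>
    (l1 + l2 < r \<longrightarrow> (x, v) \<in> \<Omega> \<longrightarrow> (\<exists>e>0. \<forall>t. \<bar>t - v\<bar> < e \<longrightarrow> 
      \<bar>mixed_partial l1 l2 h x t - mixed_partial l1 l2 h x v\<bar> \<le> B * \<bar>t - v\<bar>))"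
proof (induction l1 arbitrary: l2 x v)
  case 0
  have "\<exists>e>0. \<forall>t. \<bar>t - v\<bar> < e \<longrightarrow> \<bar>mixed_partial 0 l2 h x t - mixed_partial 0 l2 h x v\<bar> \<le> B * \<bar>t - v\<bar>"
    if l: "0 + l2 < r" and xv: "(x, v) \<in> \<Omega>"
  proof -
    obtain e where e: "e > 0" "\<And>s t. \<bar>s - x\<bar> < e \<Longrightarrow> \<bar>t - v\<bar> < e \<Longrightarrow> (s, t) \<in> \<Omega>" using square_nbhd[OF xv] by blast
    have "norm (mixed_partial 0 l2 h x t - mixed_partial 0 l2 h x v) \<le> B * norm (t - v)" if t: "\<bar>t - v\<bar> < e" for t
    proof (rule field_differentiable_bound[where S = "ball v e" and f' = "\<lambda>t. mixed_partial 0 (Suc l2) h x t"])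
      fix w assume "w \<in> ball v e"
      then have w: "(x, w) \<in> \<Omega>" using e by (auto simp: dist_real_def abs_minus_commute)
      show "((\<lambda>t. mixed_partial 0 l2 h x t) has_real_derivative mixed_partial 0 (Suc l2) h x w) (at w within ball v e)"
        by (rule has_field_derivative_at_within[OF D2[OF _ w]]) (use l in simp)
      show "norm (mixed_partial 0 (Suc l2) h x w) \<le> B" using bound[OF _ w, of 0 "Suc l2"] l by simp
    qed (use e t in \<open>auto simp: dist_real_def abs_minus_commute\<close>)
    then show ?thesis using e(1) by auto
  qed
  then show ?case using D2 by auto
next
  case (Suc l1)
  have lip: "\<exists>e>0. \<forall>t. \<bar>t - v\<bar> < e \<longrightarrow> \<bar>mixed_partial (Suc l1) k h x t - mixed_partial (Suc l1) k h x v\<bar> \<le> B * \<bar>t - v\<bar>"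
    if l: "Suc l1 + k < r" and xv: "(x, v) \<in> \<Omega>" for k x v
  proof -
    obtain e where e: "e > 0" "\<And>s t. \<bar>s - x\<bar> < e \<Longrightarrow> \<bar>t - v\<bar> < e \<Longrightarrow> (s, t) \<in> \<Omega>" using square_nbhd[OF xv] by blast
    have "\<bar>mixed_partial (Suc l1) k h x t - mixed_partial (Suc l1) k h x v - 0 * (t - v)\<bar> \<le> B * \<bar>t - v\<bar>" if t: "\<bar>t - v\<bar> < e" for t
    proof (rule mixed_partial_swap[where a = "mixed_partial l1 k h" and b = "mixed_partial l1 (Suc k) h" and
           ax = "mixed_partial (Suc l1) k h" and bx = "mixed_partial (Suc l1) (Suc k) h", OF e(1) _ _ _ _ t])
      have ll: "l1 + k < r" "l1 + Suc k < r" "Suc l1 + Suc k \<le> r" "l1 + k + 1 < r \<or> (l1 = 0 \<and> k < r)" using l by auto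
      fix s t assume s: "\<bar>s - x\<bar> < e" and t: "\<bar>t - v\<bar> < e"
      note st = e(2)[OF s t]
      show "((\<lambda>t. mixed_partial l1 k h s t) has_real_derivative mixed_partial l1 (Suc k) h s t) (at t)"
        using Suc.IH[THEN conjunct1, rule_format, OF ll(4) st] .
      show "((\<lambda>s. mixed_partial l1 (Suc k) h s t) has_real_derivative mixed_partial (Suc l1) (Suc k) h s t) (at s)"
        by (rule D1[OF ll(2) st])
      show "\<bar>mixed_partial (Suc l1) (Suc k) h s t - 0\<bar> \<le> B" using bound[OF ll(3) st] by simp
    next
      fix t assume t: "\<bar>t - v\<bar> < e"
      have "l1 + k < r" using l by simp
      then show "((\<lambda>s. mixed_partial l1 k h s t) has_real_derivative mixed_partial (Suc l1) k h x t) (at x)"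
        by (rule D1) (use e t in simp)
    qed
    then show ?thesis using e(1) by (intro exI[of _ e]) simp
  qed
  have der: "((\<lambda>t. mixed_partial (Suc l1) l2 h x t) has_real_derivative mixed_partial (Suc l1) (Suc l2) h x v) (at v)"
    if l: "Suc l1 + l2 + 1 < r" and xv: "(x, v) \<in> \<Omega>"
  proof -
    define c where "c = mixed_partial (Suc l1) (Suc l2) h x v"
    obtain e where e: "e > 0" "\<And>s t. \<bar>s - x\<bar> < e \<Longrightarrow> \<bar>t - v\<bar> < e \<Longrightarrow> (s, t) \<in> \<Omega>" using square_nbhd[OF xv] by blast
    obtain d where d: "d > 0" "\<forall>t. \<bar>t - v\<bar> < d \<longrightarrow> \<bar>mixed_partial (Suc l1) (Suc l2) h x t - mixed_partial (Suc l1) (Suc l2) h x v\<bar> \<le> B * \<bar>t - v\<bar>"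
    proof -
      have "Suc l1 + Suc l2 < r" using l by simp
      from lip[OF this xv] show ?thesis using that by blast
    qed
    have B0: "0 \<le> B" using bound[OF _ xv, of 0 0] by auto
    have close: "\<bar>mixed_partial (Suc l1) (Suc l2) h s t - c\<bar> \<le> 2 * B * \<rho>"
      if "\<bar>s - x\<bar> < \<rho>" "\<bar>t - v\<bar> < \<rho>" "\<rho> \<le> min d e" for s t \<rho>
    proof -
      have "\<bar>mixed_partial (Suc l1) (Suc l2) h s t - mixed_partial (Suc l1) (Suc l2) h x t\<bar> \<le> B * \<bar>s - x\<bar>"
      proof (rule lipschitz1)
        show "Suc l1 + Suc l2 < r" using l by simp
        fix s' assume "min s x \<le> s'" "s' \<le> max s x"
        then have "\<bar>s' - x\<bar> < e" "\<bar>t - v\<bar> < e" using that by (auto simp: min_def max_def split: if_splits)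
        then show "(s', t) \<in> \<Omega>" by (rule e(2))
      qed
      moreover have "\<bar>mixed_partial (Suc l1) (Suc l2) h x t - c\<bar> \<le> B * \<bar>t - v\<bar>" unfolding c_def
        by (rule d(2)[rule_format]) (use that in simp)
      moreover have "B * \<bar>s - x\<bar> \<le> B * \<rho>" "B * \<bar>t - v\<bar> \<le> B * \<rho>" using B0 that by (auto intro!: mult_left_mono)
      ultimately show ?thesis by linarith
    qed
    have main: "\<bar>mixed_partial (Suc l1) l2 h x t - mixed_partial (Suc l1) l2 h x v - c * (t - v)\<bar> \<le> 2 * B * \<rho> * \<bar>t - v\<bar>"
      if t: "\<bar>t - v\<bar> < \<rho>" and \<rho>: "0 < \<rho>" "\<rho> \<le> min d e" for t \<rho>
    proof (rule mixed_partial_swap[where a = "mixed_partial l1 l2 h" and b = "mixed_partial l1 (Suc l2) h" and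
           ax = "mixed_partial (Suc l1) l2 h" and bx = "mixed_partial (Suc l1) (Suc l2) h", OF \<rho>(1) _ _ _ _ t])
      have ll: "l1 + l2 < r" "l1 + Suc l2 < r" "l1 + l2 + 1 < r \<or> (l1 = 0 \<and> l2 < r)" using l by auto
      fix s t assume s: "\<bar>s - x\<bar> < \<rho>" and t: "\<bar>t - v\<bar> < \<rho>"
      have st: "(s, t) \<in> \<Omega>" by (rule e(2)) (use s t \<rho> in auto)
      show "((\<lambda>t. mixed_partial l1 l2 h s t) has_real_derivative mixed_partial l1 (Suc l2) h s t) (at t)"
        using Suc.IH[THEN conjunct1, rule_format, OF ll(3) st] .
      show "((\<lambda>s. mixed_partial l1 (Suc l2) h s t) has_real_derivative mixed_partial (Suc l1) (Suc l2) h s t) (at s)"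
        by (rule D1[OF ll(2) st])
      show "\<bar>mixed_partial (Suc l1) (Suc l2) h s t - c\<bar> \<le> 2 * B * \<rho>" by (rule close[OF s t \<rho>(2)])
    next
      fix t assume t: "\<bar>t - v\<bar> < \<rho>"
      have "l1 + l2 < r" using l by simp
      then show "((\<lambda>s. mixed_partial l1 l2 h s t) has_real_derivative mixed_partial (Suc l1) l2 h x t) (at x)"
        by (rule D1) (use e t \<rho> in simp)
    qed
    show ?thesis unfolding has_field_derivative_iff c_def[symmetric]
    proof (rule LIM_I)
      fix \<epsilon> :: real assume \<epsilon>: "\<epsilon> > 0"
      define \<rho> where "\<rho> = min (min d e) (\<epsilon> / (4 * B + 1))"
      have \<rho>: "0 < \<rho>" "\<rho> \<le> min d e" using d e \<epsilon> B0 by (auto simp: \<rho>_def)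
      have "2 * B * \<rho> < \<epsilon>"
      proof -
        have "\<rho> \<le> \<epsilon> / (4 * B + 1)" by (simp add: \<rho>_def)
        moreover have "0 < 4 * B + 1" using B0 by simp
        ultimately have "\<rho> * (4 * B + 1) \<le> \<epsilon>" by (simp only: pos_le_divide_eq)
        moreover have "0 \<le> B * \<rho>" using B0 \<rho> by simp
        ultimately show ?thesis using \<rho>(1) by (simp add: algebra_simps)
      qed
      show "\<exists>s>0. \<forall>t. t \<noteq> v \<and> norm (t - v) < s \<longrightarrow>
          norm ((mixed_partial (Suc l1) l2 h x t - mixed_partial (Suc l1) l2 h x v) / (t - v) - c) < \<epsilon>"
      proof (intro exI[of _ \<rho>] conjI allI impI)
        fix t assume t: "t \<noteq> v \<and> norm (t - v) < \<rho>"
        have quot: "norm (p / d - c) \<le> K" if "d \<noteq> 0" "\<bar>p - c * d\<bar> \<le> K * \<bar>d\<bar>" for p d K :: real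
        proof -
          have "p / d - c = (p - c * d) / d" using that(1) by (simp add: field_simps)
          then show ?thesis using that by (simp add: abs_divide pos_divide_le_eq)
        qed
        have "norm ((mixed_partial (Suc l1) l2 h x t - mixed_partial (Suc l1) l2 h x v) / (t - v) - c) \<le> 2 * B * \<rho>"
          by (rule quot, use t in simp, rule main[OF _ \<rho>], use t in simp)
        then show "norm ((mixed_partial (Suc l1) l2 h x t - mixed_partial (Suc l1) l2 h x v) / (t - v) - c) < \<epsilon>"
          using \<open>2 * B * \<rho> < \<epsilon>\<close> by linarith
      qed (rule \<rho>(1))
    qed
  qed
  show ?case using lip[of l2 x v] der by blast
qed

text \<open>
  The Lipschitz bound of partial2_of_mixed_partial holds near each point, within a radius that
  depends on the point; such bounds add up along a segment.
\<close>
lemma lipschitz2: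
  assumes l: "l1 + l2 < r" and sub: "\<And>t. t \<in> {v..w} \<Longrightarrow> (x, t) \<in> \<Omega>" and vw: "v \<le> w"
  shows "\<bar>mixed_partial l1 l2 h x w - mixed_partial l1 l2 h x v\<bar> \<le> B * (w - v)"
proof -
  define P where "P s t \<longleftrightarrow> (v \<le> s \<and> s \<le> t \<and> t \<le> w \<longrightarrow> \<bar>mixed_partial l1 l2 h x t - mixed_partial l1 l2 h x s\<bar> \<le> B * (t - s))" for s t
  have "P v w"
    using vw
  proof (induction rule: Bolzano)
    case (trans a b c)
    then show ?case by (auto simp: P_def right_diff_distrib)
  next
    case (local t)
    obtain e where e: "e > 0" "\<forall>s. \<bar>s - t\<bar> < e \<longrightarrow> \<bar>mixed_partial l1 l2 h x s - mixed_partial l1 l2 h x t\<bar> \<le> B * \<bar>s - t\<bar>"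
      using partial2_of_mixed_partial[of l1 l2 x t] l sub[of t] local by auto
    show ?case
    proof (intro exI[of _ e] conjI allI impI)
      fix a b assume ab: "a \<le> t \<and> t \<le> b \<and> b - a < e"
      then have "\<bar>mixed_partial l1 l2 h x a - mixed_partial l1 l2 h x t\<bar> \<le> B * \<bar>a - t\<bar>"
        "\<bar>mixed_partial l1 l2 h x b - mixed_partial l1 l2 h x t\<bar> \<le> B * \<bar>b - t\<bar>"
        by (intro e(2)[rule_format]; simp)+
      then show "P a b" using ab by (auto simp: P_def right_diff_distrib)
    qed (rule e(1))
  qed
  then show ?thesis using vw by (simp add: P_def)
qed

end

lemma Wspace2_bounded_partials:
  assumes h: "h \<in> Wspace2 r \<Omega>" and o: "open \<Omega>"
  obtains B where "bounded_partials r \<Omega> h B"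
proof -
  let ?L = "{l :: nat \<times> nat. fst l + snd l \<le> r}"
  have "?L \<subseteq> {..r} \<times> {..r}" by auto
  then have fin: "finite ?L" using finite_subset by blast
  have "\<forall>l\<in>?L. \<exists>b. \<forall>x v. (x, v) \<in> \<Omega> \<longrightarrow> \<bar>mixed_partial (fst l) (snd l) h x v\<bar> \<le> b"
  proof
    fix l assume "l \<in> ?L"
    then have "bdd_above ((\<lambda>(x, v). \<bar>mixed_partial (fst l) (snd l) h x v\<bar>) ` \<Omega>)" using h by (simp add: Wspace2_def)
    then obtain b where b: "\<forall>p\<in>\<Omega>. (case p of (x, v) \<Rightarrow> \<bar>mixed_partial (fst l) (snd l) h x v\<bar>) \<le> b"
      by (auto simp: bdd_above_def)
    show "\<exists>b. \<forall>x v. (x, v) \<in> \<Omega> \<longrightarrow> \<bar>mixed_partial (fst l) (snd l) h x v\<bar> \<le> b"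
      using b by (intro exI[of _ b]) auto
  qed
  from bchoice[OF this] obtain b where
    b: "\<forall>l\<in>?L. \<forall>x v. (x, v) \<in> \<Omega> \<longrightarrow> \<bar>mixed_partial (fst l) (snd l) h x v\<bar> \<le> b l" by blast
  have ex: "mixed_partial_exists \<Omega> l1 l2 h" if "l1 + l2 \<le> r" for l1 l2 using h that by (simp add: Wspace2_def)
  have "bounded_partials r \<Omega> h (Max (b ` ?L))"
  proof
    fix l1 l2 :: nat and x v
    assume xv: "(x, v) \<in> \<Omega>"
    {
      assume "l1 + l2 < r"
      then have "mixed_partial_exists \<Omega> (Suc l1) l2 h" by (intro ex) simp
      then have "(\<lambda>s. mixed_partial l1 l2 h s v) field_differentiable at x"
        using xv unfolding mixed_partial_exists_def by blast
      moreover have "mixed_partial (Suc l1) l2 h x v = deriv (\<lambda>s. mixed_partial l1 l2 h s v) x"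
        by (simp add: mixed_partial_def partial1_def)
      ultimately show "((\<lambda>s. mixed_partial l1 l2 h s v) has_real_derivative mixed_partial (Suc l1) l2 h x v) (at x)"
        by (simp add: DERIV_deriv_iff_field_differentiable)
    }
    {
      assume "l2 < r"
      then have "mixed_partial_exists \<Omega> 0 (Suc l2) h" by (intro ex) simp
      then have "(\<lambda>t. mixed_partial 0 l2 h x t) field_differentiable at v"
        using xv unfolding mixed_partial_exists_def by blast
      moreover have "mixed_partial 0 (Suc l2) h x v = deriv (\<lambda>t. mixed_partial 0 l2 h x t) v"
        by (simp add: mixed_partial_def partial2_def)
      ultimately show "((\<lambda>t. mixed_partial 0 l2 h x t) has_real_derivative mixed_partial 0 (Suc l2) h x v) (at v)"
        by (simp add: DERIV_deriv_iff_field_differentiable)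
    }
    {
      assume l: "l1 + l2 \<le> r"
      then have "\<bar>mixed_partial l1 l2 h x v\<bar> \<le> b (l1, l2)" using b[rule_format, of "(l1, l2)" x v] xv by simp
      also have "\<dots> \<le> Max (b ` ?L)" using fin l by (intro Max_ge) auto
      finally show "\<bar>mixed_partial l1 l2 h x v\<bar> \<le> Max (b ` ?L)" .
    }
  qed (rule o)
  then show ?thesis by (rule that)
qed

text \<open>
  With the constant weight of the two end points, local Lipschitz bounds add up along the
  interval between them, and this weight is at most the weight at any point in between.
\<close>
lemma wlip_local:
  assumes loc: "\<And>x. x \<in> {-1<..<1} \<Longrightarrow> \<exists>d>0. \<forall>y z. y \<in> {-1<..<1} \<longrightarrow> z \<in> {-1<..<1} \<longrightarrow> \<bar>y - x\<bar> < d \<longrightarrow> \<bar>z - x\<bar> < d \<longrightarrow> 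
     \<bar>u y - u z\<bar> * min (weight y) (weight z) ^ p \<le> M * \<bar>y - z\<bar>"
  shows "wlip p M u"
proof -
  have main: "\<bar>u b - u a\<bar> * min (weight a) (weight b) ^ p \<le> M * (b - a)"
    if ab: "a \<in> {-1<..<1}" "b \<in> {-1<..<1}" "a \<le> b" for a b
  proof -
    define c where "c = min (weight a) (weight b) ^ p"
    have c: "0 \<le> c" using weight_pos ab by (simp add: c_def less_imp_le)
    define P where "P s t \<longleftrightarrow> (a \<le> s \<and> s \<le> t \<and> t \<le> b \<longrightarrow> \<bar>u t - u s\<bar> * c \<le> M * (t - s))" for s t
    have "P a b"
      using ab(3)
    proof (induction rule: Bolzano)
      case (trans r s t)
      show ?case unfolding P_def
      proof (intro impI)
        assume rt: "a \<le> r \<and> r \<le> t \<and> t \<le> b"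
        then have "\<bar>u s - u r\<bar> * c \<le> M * (s - r)" "\<bar>u t - u s\<bar> * c \<le> M * (t - s)"
          using trans by (auto simp: P_def)
        moreover have "\<bar>u t - u r\<bar> * c \<le> (\<bar>u s - u r\<bar> + \<bar>u t - u s\<bar>) * c"
          using c by (intro mult_right_mono) auto
        ultimately show "\<bar>u t - u r\<bar> * c \<le> M * (t - r)" by (simp add: algebra_simps)
      qed
    next
      case (local x)
      then have "x \<in> {-1<..<1}" using ab by auto
      from loc[OF this] obtain d where d: "d > 0" "\<And>y z. y \<in> {-1<..<1} \<Longrightarrow> z \<in> {-1<..<1} \<Longrightarrow> \<bar>y - x\<bar> < d \<Longrightarrow> \<bar>z - x\<bar> < d \<Longrightarrow>
        \<bar>u y - u z\<bar> * min (weight y) (weight z) ^ p \<le> M * \<bar>y - z\<bar>" by blast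
      show ?case
      proof (intro exI[of _ d] conjI allI impI)
        fix s t assume st: "s \<le> x \<and> x \<le> t \<and> t - s < d"
        show "P s t" unfolding P_def
        proof (intro impI)
          assume "a \<le> s \<and> s \<le> t \<and> t \<le> b"
          then have st': "s \<in> {-1<..<1}" "t \<in> {-1<..<1}" "a \<le> s" "s \<le> t" "t \<le> b" using ab by auto
          have "min (weight a) (weight b) \<le> weight s" "min (weight a) (weight b) \<le> weight t"
            using weight_between[OF ab(1,2)] st' by auto
          then have "c \<le> min (weight t) (weight s) ^ p" unfolding c_def
            using weight_pos ab by (intro power_mono) (auto simp: less_imp_le)
          then have "\<bar>u t - u s\<bar> * c \<le> \<bar>u t - u s\<bar> * min (weight t) (weight s) ^ p" by (intro mult_left_mono) auto
          also have "\<dots> \<le> M * \<bar>t - s\<bar>" by (rule d(2)) (use st st' in auto)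
          finally show "\<bar>u t - u s\<bar> * c \<le> M * (t - s)" using st' by simp
        qed
      qed (rule d(1))
    qed
    then show ?thesis using ab by (simp add: P_def c_def)
  qed
  show ?thesis unfolding wlip_def
  proof (intro ballI)
    fix y z :: real assume yz: "y \<in> {-1<..<1}" "z \<in> {-1<..<1}"
    show "\<bar>u y - u z\<bar> * min (weight y) (weight z) ^ p \<le> M * \<bar>y - z\<bar>"
    proof (cases "y \<le> z")
      case True
      then show ?thesis using main[OF yz True] by (simp add: abs_minus_commute)
    next
      case False
      then show ?thesis using main[OF yz(2,1)] by (simp add: min.commute)
    qed
  qed
qed

context bounded_partials
begin

lemma composition_wlip:
  assumes l: "l1 + l2 < r" and f: "wlip 1 M f" and graph: "\<And>x. x \<in> {-1<..<1} \<Longrightarrow> (x, f x) \<in> \<Omega>"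
  shows "wlip 1 (B * (1 + M)) (\<lambda>x. mixed_partial l1 l2 h x (f x))"
proof (rule wlip_local)
  fix x :: real assume x: "x \<in> {-1<..<1}"
  obtain e where e: "e > 0" "\<And>s t. \<bar>s - x\<bar> < e \<Longrightarrow> \<bar>t - f x\<bar> < e \<Longrightarrow> (s, t) \<in> \<Omega>" using square_nbhd[OF graph[OF x]] by blast
  have B0: "0 \<le> B" using bound[OF _ graph[OF x], of 0 0] by auto
  have "isCont f x" by (rule wlip_isCont[of 0 M]) (use f x in auto)
  then obtain d where d: "d > 0" "\<And>y. \<bar>y - x\<bar> < d \<Longrightarrow> \<bar>f y - f x\<bar> < e"
    using e(1) unfolding continuous_at_eps_delta dist_real_def by blast
  show "\<exists>d>0. \<forall>y z. y \<in> {-1<..<1} \<longrightarrow> z \<in> {-1<..<1} \<longrightarrow> \<bar>y - x\<bar> < d \<longrightarrow> \<bar>z - x\<bar> < d \<longrightarrow>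
     \<bar>mixed_partial l1 l2 h y (f y) - mixed_partial l1 l2 h z (f z)\<bar> * min (weight y) (weight z) ^ 1 \<le> B * (1 + M) * \<bar>y - z\<bar>"
  proof (intro exI[of _ "min d e"] conjI allI impI)
    fix y z assume yz: "y \<in> {-1<..<1}" "z \<in> {-1<..<1}" "\<bar>y - x\<bar> < min d e" "\<bar>z - x\<bar> < min d e"
    have fy: "\<bar>f y - f x\<bar> < e" "\<bar>f z - f x\<bar> < e" using d(2) yz by auto
    let ?m = "min (weight y) (weight z)"
    have m: "0 \<le> ?m" "?m \<le> 1" using weight_pos yz weight_le_1[of y] by (auto simp: less_imp_le min_le_iff_disj)
    have 1: "\<bar>mixed_partial l1 l2 h y (f y) - mixed_partial l1 l2 h z (f y)\<bar> \<le> B * \<bar>y - z\<bar>"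
      by (rule lipschitz1[OF l]) (use e(2) yz fy in \<open>auto simp: abs_less_iff min_def max_def split: if_splits\<close>)
    have 2: "\<bar>mixed_partial l1 l2 h z (f y) - mixed_partial l1 l2 h z (f z)\<bar> \<le> B * \<bar>f y - f z\<bar>"
    proof (cases "f z \<le> f y")
      case True
      have "\<bar>mixed_partial l1 l2 h z (f y) - mixed_partial l1 l2 h z (f z)\<bar> \<le> B * (f y - f z)"
        by (rule lipschitz2[OF l _ True]) (use e(2) yz fy in auto)
      then show ?thesis using True by simp
    next
      case False
      then have le: "f y \<le> f z" by simp
      have "\<bar>mixed_partial l1 l2 h z (f z) - mixed_partial l1 l2 h z (f y)\<bar> \<le> B * (f z - f y)"
        by (rule lipschitz2[OF l _ le]) (use e(2) yz fy in auto)
      then show ?thesis using le by (simp add: abs_minus_commute)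
    qed
    have "\<bar>mixed_partial l1 l2 h y (f y) - mixed_partial l1 l2 h z (f z)\<bar> * ?m \<le> (B * \<bar>y - z\<bar> + B * \<bar>f y - f z\<bar>) * ?m"
      using 1 2 m by (intro mult_right_mono) linarith+
    also have "\<dots> = B * (\<bar>y - z\<bar> * ?m + \<bar>f y - f z\<bar> * ?m)" by (simp add: algebra_simps)
    also have "\<dots> \<le> B * (\<bar>y - z\<bar> * 1 + M * \<bar>y - z\<bar>)"
    proof (intro mult_left_mono add_mono B0)
      show "\<bar>f y - f z\<bar> * ?m \<le> M * \<bar>y - z\<bar>" using f yz unfolding wlip_def by auto
    qed (use m in auto)
    finally show "\<bar>mixed_partial l1 l2 h y (f y) - mixed_partial l1 l2 h z (f z)\<bar> * ?m ^ 1 \<le> B * (1 + M) * \<bar>y - z\<bar>"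
      by (simp add: algebra_simps)
  qed (use d e in auto)
qed

text \<open>
  Change the two arguments one after the other. The first argument is changed while the second
  one is f y instead of f x; this makes no difference in the limit, because the derivative in
  the first variable is Lipschitz in both variables.
\<close>
lemma composition_chain_rule:
  assumes l: "l1 + l2 + 1 < r" and f: "(f has_real_derivative f') (at x)" and xf: "(x, f x) \<in> \<Omega>"
  shows "((\<lambda>x. mixed_partial l1 l2 h x (f x)) has_real_derivative
     mixed_partial (Suc l1) l2 h x (f x) + mixed_partial l1 (Suc l2) h x (f x) * f') (at x)"
proof -
  let ?A = "mixed_partial l1 l2 h" and ?A1 = "mixed_partial (Suc l1) l2 h"
  obtain e where e: "e > 0" "\<And>s t. \<bar>s - x\<bar> < e \<Longrightarrow> \<bar>t - f x\<bar> < e \<Longrightarrow> (s, t) \<in> \<Omega>" using square_nbhd[OF xf] by blast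
  have A2: "((\<lambda>t. ?A x t) has_real_derivative mixed_partial l1 (Suc l2) h x (f x)) (at (f x))"
    using partial2_of_mixed_partial[of l1 l2 x "f x"] l xf by auto
  obtain d2 where d2: "d2 > 0" "\<forall>t. \<bar>t - f x\<bar> < d2 \<longrightarrow> \<bar>?A1 x t - ?A1 x (f x)\<bar> \<le> B * \<bar>t - f x\<bar>"
  proof -
    have "Suc l1 + l2 < r" using l by simp
    from partial2_of_mixed_partial[THEN conjunct2, rule_format, OF this xf] show ?thesis using that by blast
  qed
  have fcont: "(f \<longlongrightarrow> f x) (at x)" using DERIV_isCont[OF f] by (simp add: isCont_def)
  have "((\<lambda>y. ?A x (f y)) has_real_derivative mixed_partial l1 (Suc l2) h x (f x) * f') (at x)"
    using DERIV_chain2[OF A2 f] .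
  then have 1: "((\<lambda>y. (?A x (f y) - ?A x (f x)) / (y - x)) \<longlongrightarrow> mixed_partial l1 (Suc l2) h x (f x) * f') (at x)"
    by (simp add: has_field_derivative_iff)
  have 2: "((\<lambda>y. (?A y (f y) - ?A x (f y)) / (y - x)) \<longlongrightarrow> ?A1 x (f x)) (at x)"
  proof -
    have "\<forall>\<^sub>F y in at x. \<bar>f y - f x\<bar> < min d2 e"
      using tendstoD[OF fcont, of "min d2 e"] d2 e by (simp add: dist_real_def)
    moreover have "\<forall>\<^sub>F y in at x. \<bar>y - x\<bar> < e \<and> y \<noteq> x" unfolding eventually_at using e(1)
      by (intro exI[of _ e]) (auto simp: dist_real_def)
    ultimately have ev: "\<forall>\<^sub>F y in at x. norm ((?A y (f y) - ?A x (f y)) / (y - x) - ?A1 x (f x)) \<le> B * \<bar>y - x\<bar> + B * \<bar>f y - f x\<bar>"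
    proof eventually_elim
      case (elim y)
      have seg: "(s, f y) \<in> \<Omega>" if "min x y \<le> s" "s \<le> max x y" for s
        by (rule e(2)) (use elim that in \<open>auto simp: abs_less_iff min_def max_def split: if_splits\<close>)
      have "norm ((?A y (f y) - ?A1 x (f y) * y) - (?A x (f y) - ?A1 x (f y) * x)) \<le> B * \<bar>y - x\<bar> * norm (y - x)"
      proof (rule field_differentiable_bound[where S = "{min x y..max x y}" and f' = "\<lambda>s. ?A1 s (f y) - ?A1 x (f y)"])
        fix s assume s: "s \<in> {min x y..max x y}"
        show "((\<lambda>s. ?A s (f y) - ?A1 x (f y) * s) has_real_derivative ?A1 s (f y) - ?A1 x (f y)) (at s within {min x y..max x y})"
        proof -
          have "(s, f y) \<in> \<Omega>" using seg s by simp
          then have D: "((\<lambda>s. ?A s (f y)) has_real_derivative ?A1 s (f y)) (at s)" using l by (intro D1) simp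
          have "((\<lambda>s. ?A s (f y) - ?A1 x (f y) * s) has_real_derivative ?A1 s (f y) - ?A1 x (f y) * 1) (at s)"
            by (rule DERIV_diff[OF D DERIV_cmult[OF DERIV_ident]])
          then show ?thesis by (simp only: mult_1_right has_field_derivative_at_within)
        qed
        have "\<bar>?A1 s (f y) - ?A1 x (f y)\<bar> \<le> B * \<bar>s - x\<bar>"
          by (rule lipschitz1) (use l s seg in \<open>auto simp: min_def max_def split: if_splits\<close>)
        also have "\<dots> \<le> B * \<bar>y - x\<bar>" using s bound[OF _ xf, of 0 0]
          by (intro mult_left_mono) (auto simp: min_def max_def split: if_splits)
        finally show "norm (?A1 s (f y) - ?A1 x (f y)) \<le> B * \<bar>y - x\<bar>" by simp
      qed auto
      then have "\<bar>(?A y (f y) - ?A x (f y)) - ?A1 x (f y) * (y - x)\<bar> \<le> B * \<bar>y - x\<bar> * \<bar>y - x\<bar>" by (simp add: algebra_simps)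
      moreover have "(?A y (f y) - ?A x (f y)) / (y - x) - ?A1 x (f y) = ((?A y (f y) - ?A x (f y)) - ?A1 x (f y) * (y - x)) / (y - x)"
        using elim by (simp add: diff_divide_distrib)
      ultimately have "\<bar>(?A y (f y) - ?A x (f y)) / (y - x) - ?A1 x (f y)\<bar> \<le> B * \<bar>y - x\<bar>"
      proof -
        assume num: "\<bar>(?A y (f y) - ?A x (f y)) - ?A1 x (f y) * (y - x)\<bar> \<le> B * \<bar>y - x\<bar> * \<bar>y - x\<bar>"
          and eq: "(?A y (f y) - ?A x (f y)) / (y - x) - ?A1 x (f y) = ((?A y (f y) - ?A x (f y)) - ?A1 x (f y) * (y - x)) / (y - x)"
        have pos: "0 < \<bar>y - x\<bar>" using elim by simp
        show ?thesis unfolding eq abs_divide pos_divide_le_eq[OF pos] by (rule num)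
      qed
      moreover have "\<bar>?A1 x (f y) - ?A1 x (f x)\<bar> \<le> B * \<bar>f y - f x\<bar>" using d2(2) elim by auto
      ultimately show ?case by simp
    qed
    have "((\<lambda>y. B * \<bar>y - x\<bar> + B * \<bar>f y - f x\<bar>) \<longlongrightarrow> B * \<bar>x - x\<bar> + B * \<bar>f x - f x\<bar>) (at x)"
      by (intro tendsto_intros fcont)
    then have "((\<lambda>y. (?A y (f y) - ?A x (f y)) / (y - x) - ?A1 x (f x)) \<longlongrightarrow> 0) (at x)"
      by (intro Lim_null_comparison[OF ev]) simp
    then show ?thesis by (simp add: LIM_zero_iff)
  qed
  have split: "(a - c) / d = (a - b) / d + (b - c) / d" for a b c d :: real
    by (simp add: diff_divide_distrib)
  have e: "(\<lambda>y. (?A y (f y) - ?A x (f x)) / (y - x)) = (\<lambda>y. (?A y (f y) - ?A x (f y)) / (y - x) + (?A x (f y) - ?A x (f x)) / (y - x))"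
    by (rule ext) (rule split)
  show ?thesis unfolding has_field_derivative_iff e by (rule tendsto_add[OF 2 1])
qed

text \<open>
  Induction on s, for all mixed partials of h at the same time: the derivative of such a
  composition is a sum of two compositions of the same kind, one of them multiplied by f'.
\<close>
theorem composition_wsmooth:
  assumes f: "wsmooth 0 n M f" and graph: "\<And>x. x \<in> {-1<..<1} \<Longrightarrow> (x, f x) \<in> \<Omega>"
  shows "s \<le> n \<Longrightarrow> l1 + l2 + s < r \<Longrightarrow> \<exists>N. wsmooth 0 s N (\<lambda>x. mixed_partial l1 l2 h x (f x))"
proof (induction s arbitrary: l1 l2)
  case 0
  have "wlip 1 (B * (1 + M)) (\<lambda>x. mixed_partial l1 l2 h x (f x))"
    by (rule composition_wlip) (use 0 graph wsmooth_imp_wlip[OF f] in auto)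
  then have "wlip 1 (max B (B * (1 + M))) (\<lambda>x. mixed_partial l1 l2 h x (f x))" by (rule wlip_mono) simp
  moreover have "\<bar>mixed_partial l1 l2 h x (f x)\<bar> \<le> max B (B * (1 + M))" if "x \<in> {-1<..<1}" for x
    using bound[OF _ graph[OF that], of l1 l2] 0 by auto
  ultimately have "wsmooth 0 0 (max B (B * (1 + M))) (\<lambda>x. mixed_partial l1 l2 h x (f x))" by simp
  then show ?case by blast
next
  case (Suc s)
  obtain k where k: "n = Suc k" "s \<le> k" using Suc.prems by (cases n) auto
  obtain f' where f': "\<And>x. x \<in> {-1<..<1} \<Longrightarrow> (f has_real_derivative f' x) (at x)" "wsmooth 1 k M f'"
    using f unfolding k wsmooth.simps One_nat_def by blast
  have lower: "wsmooth i a M u" if "wsmooth i b M u" "a \<le> b" for i a b u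
    using that(2,1)
  proof (induction rule: dec_induct)
    case (step b)
    then show ?case using wsmooth_Suc_imp by blast
  qed
  obtain N1 where N1: "wsmooth 0 s N1 (\<lambda>x. mixed_partial (Suc l1) l2 h x (f x))" using Suc.IH[of "Suc l1" l2] Suc.prems by auto
  obtain N2 where N2: "wsmooth 0 s N2 (\<lambda>x. mixed_partial l1 (Suc l2) h x (f x))" using Suc.IH[of l1 "Suc l2"] Suc.prems by auto
  have "wsmooth (0 + 1) s (2 ^ Suc s * (N2 * M)) (\<lambda>x. mixed_partial l1 (Suc l2) h x (f x) * f' x)"
    by (rule wsmooth_mult[OF N2 lower[OF f'(2) k(2)]])
  then have w: "wsmooth 1 s (N1 + 2 ^ Suc s * (N2 * M)) (\<lambda>x. mixed_partial (Suc l1) l2 h x (f x) + mixed_partial l1 (Suc l2) h x (f x) * f' x)"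
    using wsmooth_add[of 1 s N1 _ "2 ^ Suc s * (N2 * M)"] wsmooth_raise[OF N1] by simp
  have B0: "0 \<le> B" using bound[OF _ graph[of 0], of 0 0] by auto
  let ?N = "max B (N1 + 2 ^ Suc s * (N2 * M))"
  have "wsmooth 0 (Suc s) ?N (\<lambda>x. mixed_partial l1 l2 h x (f x))"
  proof (rule wsmooth_SucI[where u' = "\<lambda>x. mixed_partial (Suc l1) l2 h x (f x) + mixed_partial l1 (Suc l2) h x (f x) * f' x"])
    fix x :: real assume x: "x \<in> {-1<..<1}"
    show "\<bar>mixed_partial l1 l2 h x (f x)\<bar> * weight x ^ 0 \<le> ?N"
      using bound[OF _ graph[OF x], of l1 l2] Suc.prems by auto
    show "((\<lambda>x. mixed_partial l1 l2 h x (f x)) has_real_derivative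
       mixed_partial (Suc l1) l2 h x (f x) + mixed_partial l1 (Suc l2) h x (f x) * f' x) (at x)"
      by (rule composition_chain_rule[OF _ f'(1)[OF x] graph[OF x]]) (use Suc.prems in auto)
  next
    show "wsmooth (Suc 0) s ?N (\<lambda>x. mixed_partial (Suc l1) l2 h x (f x) + mixed_partial l1 (Suc l2) h x (f x) * f' x)"
      using wsmooth_mono[OF w, of ?N] by simp
  qed
  then show ?case by blast
qed

end

section \<open>Fixed points of discretized operators\<close>

text \<open>
  The map w \<mapsto> w - K w sends the finite-dimensional space span B into itself and is
  injective, hence it is onto. If w - K w = K y with w in span B, then y + w is the desired
  preimage of y.
\<close>
lemma finite_rank_surj:
  fixes K :: "'a::real_vector \<Rightarrow> 'a"
  assumes lin: "linear K" and fin: "finite B" and range: "\<And>x. K x \<in> span B"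
    and inj: "\<And>x. x - K x = 0 \<Longrightarrow> x = 0"
  shows "\<exists>x. x - K x = y"
proof -
  define T where "T x = x - K x" for x
  have linT: "linear T" unfolding T_def by (intro linear_compose_sub linear_id[unfolded id_def] lin)
  obtain B0 where B0: "B0 \<subseteq> B" "independent B0" "B \<subseteq> span B0" using maximal_independent_subset[of B] by blast
  have finB0: "finite B0" using B0(1) fin finite_subset by blast
  have span: "span B0 = span B"
  proof (rule subset_antisym)
    show "span B0 \<subseteq> span B" by (rule span_mono[OF B0(1)])
    show "span B \<subseteq> span B0" by (rule span_minimal[OF B0(3) subspace_span])
  qed
  have injT: "inj_on T X" for X
  proof (rule inj_onI)
    fix x y assume "T x = T y"
    then have "T (x - y) = 0" by (simp add: linear_diff[OF linT])
    then have "x - y = 0" by (rule inj[unfolded T_def[symmetric]])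
    then show "x = y" by simp
  qed
  have indep: "independent (T ` B0)" by (rule linear_independent_injective_image[OF linT B0(2) injT])
  have sub: "T ` B0 \<subseteq> span B0" 
  proof
    fix z assume "z \<in> T ` B0"
    then obtain x where x: "x \<in> B0" "z = x - K x" by (auto simp: T_def)
    show "z \<in> span B0" unfolding x(2) span by (rule span_diff[OF _ range]) (use x(1) B0(1) in \<open>auto intro: span_base\<close>)
  qed
  have card: "card (T ` B0) = card B0" by (rule card_image[OF injT])
  have "B0 \<subseteq> span (T ` B0)"
  proof (rule ccontr)
    assume "\<not> B0 \<subseteq> span (T ` B0)"
    then obtain b where b: "b \<in> B0" "b \<notin> span (T ` B0)" by blast
    have "independent (insert b (T ` B0))" using b indep by (simp add: independent_insert)
    moreover have "insert b (T ` B0) \<subseteq> span B0" using sub b(1) by (auto intro: span_base)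
    ultimately have "card (insert b (T ` B0)) \<le> card B0" using independent_span_bound[OF finB0] by blast
    moreover have "b \<notin> T ` B0" using contrapos_nn[OF b(2) span_base] by this
    ultimately show False using card finB0 by simp
  qed
  then have "span B0 \<subseteq> span (T ` B0)" by (rule span_minimal[OF _ subspace_span])
  also have "span (T ` B0) = T ` span B0" by (rule linear_span_image[OF linT])
  finally have sub2: "span B0 \<subseteq> T ` span B0" .
  have "K y \<in> span B0" unfolding span by (rule range)
  then have "K y \<in> T ` span B0" by (rule subsetD[OF sub2])
  then obtain w where w: "K y = T w" by (rule imageE)
  have "T (y + w) = T y + T w" by (rule linear_add[OF linT])
  also have "\<dots> = (y - K y) + K y" unfolding w[symmetric] by (simp only: T_def[of y])
  also have "\<dots> = y" by simp
  finally have "(y + w) - K (y + w) = y" by (simp only: T_def)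
  then show ?thesis by blast
qed

text \<open>
  The map x \<mapsto> x - (1 - K)^(-1) (x - G x) of the simplified Newton method has the same
  fixed points as G. The inverse has norm at most 1/c, so that the map is a contraction with
  factor 1/2, and the distance from x0 to the fixed point is at most twice the length of the
  first step.
\<close>
lemma newton_fixed_point:
  fixes G K :: "'a::{real_normed_vector, complete_space} \<Rightarrow> 'a"
  assumes lin: "linear K" and surj: "\<And>y. \<exists>x. x - K x = y" and c: "c > 0" "\<And>x. c * norm x \<le> norm (x - K x)"
    and \<epsilon>: "\<epsilon> > 0"
    and diff: "\<And>x y. x \<in> cball x0 \<epsilon> \<Longrightarrow> y \<in> cball x0 \<epsilon> \<Longrightarrow> norm (G x - G y - K (x - y)) \<le> c / 2 * norm (x - y)"
    and start: "norm (x0 - G x0) \<le> c * \<epsilon> / 2"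
  shows "\<exists>x\<in>cball x0 \<epsilon>. G x = x \<and> (\<forall>y\<in>cball x0 \<epsilon>. G y = y \<longrightarrow> y = x) \<and> norm (x - x0) \<le> 2 / c * norm (x0 - G x0)"
proof -
  define T where "T x = x - K x" for x
  have linT: "linear T" unfolding T_def by (intro linear_compose_sub linear_id[unfolded id_def] lin)
  obtain R where R: "\<And>y. T (R y) = y" using surj unfolding T_def by metis
  have T0: "T x = T y \<Longrightarrow> x = y" for x y
  proof -
    assume "T x = T y"
    then have "T (x - y) = 0" using linear_diff[OF linT] by simp
    then have "c * norm (x - y) \<le> 0" using c(2)[of "x - y"] by (simp add: T_def)
    then show "x = y" using c(1) by (simp add: mult_le_0_iff)
  qed
  have RT: "R (T x) = x" for x using R T0 by blast
  have Rdiff: "R x - R y = R (x - y)" for x y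
    by (rule T0) (simp add: linear_diff[OF linT] R)
  have Rn: "norm (R y) \<le> norm y / c" for y
    using c(2)[of "R y"] R[of y] c(1) by (simp add: T_def pos_le_divide_eq mult.commute)
  define \<Psi> where "\<Psi> x = x - R (x - G x)" for x
  have fix_iff: "\<Psi> x = x \<longleftrightarrow> G x = x" for x
  proof -
    have "R (x - G x) = 0 \<longleftrightarrow> x - G x = 0"
      using R[of "x - G x"] RT[of 0] linear_0[OF linT] by metis
    then show ?thesis by (auto simp: \<Psi>_def)
  qed
  have contr: "norm (\<Psi> x - \<Psi> y) \<le> 1/2 * norm (x - y)" if "x \<in> cball x0 \<epsilon>" "y \<in> cball x0 \<epsilon>" for x y
  proof -
    have "\<Psi> x - \<Psi> y = R (T (x - y)) - (R (x - G x) - R (y - G y))" by (simp add: \<Psi>_def RT)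
    also have "\<dots> = R (T (x - y) - ((x - G x) - (y - G y)))" by (simp only: Rdiff)
    also have "T (x - y) - ((x - G x) - (y - G y)) = G x - G y - K (x - y)" by (simp add: T_def)
    finally have "norm (\<Psi> x - \<Psi> y) \<le> norm (G x - G y - K (x - y)) / c" using Rn by simp
    also have "\<dots> \<le> (c / 2 * norm (x - y)) / c" using diff[OF that] c(1) by (intro divide_right_mono) auto
    finally show ?thesis using c(1) by simp
  qed
  have x0: "x0 \<in> cball x0 \<epsilon>" using \<epsilon> by simp
  have s0: "norm (\<Psi> x0 - x0) \<le> norm (x0 - G x0) / c" using Rn[of "x0 - G x0"] by (simp add: \<Psi>_def)
  also have "\<dots> \<le> (c * \<epsilon> / 2) / c" using start c(1) by (intro divide_right_mono) auto
  finally have s1: "norm (\<Psi> x0 - x0) \<le> \<epsilon> / 2" using c(1) by simp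
  have near: "norm (\<Psi> x - x0) \<le> 1/2 * norm (x - x0) + norm (\<Psi> x0 - x0)" if "x \<in> cball x0 \<epsilon>" for x
    using contr[OF that x0] norm_triangle_ineq[of "\<Psi> x - \<Psi> x0" "\<Psi> x0 - x0"] by simp
  have "\<exists>!x. x \<in> cball x0 \<epsilon> \<and> \<Psi> x = x"
  proof (rule Banach_fix)
    show "complete (cball x0 \<epsilon>)" by (simp add: complete_eq_closed)
    show "\<Psi> ` cball x0 \<epsilon> \<subseteq> cball x0 \<epsilon>"
    proof
      fix z assume "z \<in> \<Psi> ` cball x0 \<epsilon>"
      then obtain x where x: "x \<in> cball x0 \<epsilon>" "z = \<Psi> x" by blast
      have "norm (x - x0) \<le> \<epsilon>" using x(1) by (simp add: dist_norm norm_minus_commute)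
      then show "z \<in> cball x0 \<epsilon>" using near[OF x(1)] s1 x(2) by (simp add: dist_norm norm_minus_commute)
    qed
    show "dist (\<Psi> x) (\<Psi> y) \<le> 1/2 * dist x y" if "x \<in> cball x0 \<epsilon>" "y \<in> cball x0 \<epsilon>" for x y
      using contr[OF that] by (simp add: dist_norm)
  qed (use \<epsilon> in auto)
  then obtain x where x: "x \<in> cball x0 \<epsilon>" "\<Psi> x = x" "\<And>y. y \<in> cball x0 \<epsilon> \<Longrightarrow> \<Psi> y = y \<Longrightarrow> y = x" by blast
  have "norm (x - x0) \<le> 2 / c * norm (x0 - G x0)" using near[OF x(1)] s0 x(2) by simp
  then show ?thesis using x fix_iff by blast
qed

definition clip :: "real \<Rightarrow> real" where "clip x = max (-1) (min 1 x)"

lemma clip: "clip x \<in> {-1..1}" "x \<in> {-1..1} \<Longrightarrow> clip x = x"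
  and clip_bounds [simp]: "-1 \<le> clip x" "clip x \<le> 1" "-1 \<le> x \<Longrightarrow> x \<le> 1 \<Longrightarrow> clip x = x"
  by (auto simp: clip_def)

text \<open>
  Constant extension beyond the end points embeds the continuous functions on [-1,1]
  isometrically into the Banach space of bounded continuous functions on the real line.
\<close>
definition const_extend :: "(real \<Rightarrow> real) \<Rightarrow> real \<Rightarrow>\<^sub>C real" where
  "const_extend u = Bcontfun (\<lambda>x. u (clip x))"

lemma apply_const_extend:
  assumes "continuous_on {-1..1} u"
  shows "apply_bcontfun (const_extend u) x = u (clip x)"
proof -
  have "(\<lambda>x. u (clip x)) \<in> bcontfun"
  proof (rule bcontfun_normI)
    show "continuous_on UNIV (\<lambda>x. u (clip x))"
      by (rule continuous_on_compose2[OF assms]) (auto simp: clip_def intro!: continuous_intros)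
    show "norm (u (clip x)) \<le> max_norm u" for x using max_norm_ge[OF assms clip(1)] by simp
  qed
  then show ?thesis by (simp add: const_extend_def Bcontfun_inverse)
qed

lemma gauss_quadrature_mult_le:
  assumes m: "m > 0" and a: "\<And>t. t \<in> {-1..1} \<Longrightarrow> \<bar>f t\<bar> \<le> a" and b: "\<And>t. t \<in> {-1..1} \<Longrightarrow> \<bar>g t\<bar> \<le> b"
  shows "\<bar>\<Sum>t\<in>gauss_nodes m. gauss_weight m t * (f t * g t)\<bar> \<le> 2 * (a * b)"
proof (rule gauss_quadrature_le[OF m])
  fix t :: real assume "t \<in> {-1<..<1}"
  then have t: "t \<in> {-1..1}" by simp
  have "0 \<le> a" using a[OF t] by linarith
  then show "\<bar>f t * g t\<bar> \<le> a * b" unfolding abs_mult by (intro mult_mono a[OF t] b[OF t]) auto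
qed

text \<open>
  By Weierstrass' theorem, u is within e/5 of a polynomial, which costs at most 4e/5.
\<close>
lemma gauss_quadrature_tendsto:
  assumes u: "continuous_on {-1..1} u"
  shows "(\<lambda>m. \<Sum>t\<in>gauss_nodes m. gauss_weight m t * u t) \<longlonglongrightarrow> integral {-1..1} u"
proof (rule LIMSEQ_I)
  fix e :: real assume e: "e > 0"
  obtain g where g: "real_polynomial_function g" "\<And>x. x \<in> {-1..1} \<Longrightarrow> \<bar>u x - g x\<bar> < e / 5"
    using Stone_Weierstrass_real_polynomial_function[OF compact_Icc u, of "e / 5"] e by auto
  obtain a n where "g = (\<lambda>x. \<Sum>i\<le>n. a i * x ^ i)" using g(1) real_polynomial_function_iff_sum by blast
  then have "g = poly (\<Sum>i\<le>n. monom (a i) i)" by (simp add: fun_eq_iff poly_sum poly_monom)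
  then obtain q where q: "g = poly q" by blast
  have "norm ((\<Sum>t\<in>gauss_nodes m. gauss_weight m t * u t) - integral {-1..1} u) < e" if m: "m \<ge> Suc (degree q)" for m
  proof -
    have "\<bar>integral {-1..1} u - (\<Sum>t\<in>gauss_nodes m. gauss_weight m t * u t)\<bar> \<le> 4 * (e / 5)"
      by (rule gauss_error_le_approximation_error[OF u, of q]) (use m g(2) q in \<open>auto intro: less_imp_le\<close>)
    then show ?thesis unfolding real_norm_def using e by linarith
  qed
  then show "\<exists>no. \<forall>m\<ge>no. norm ((\<Sum>t\<in>gauss_nodes m. gauss_weight m t * u t) - integral {-1..1} u) < e" by blast
qed

locale continuous_kernel =
  fixes \<kappa> :: "real \<Rightarrow> real \<Rightarrow> real"
  assumes cont: "continuous_on ({-1..1} \<times> {-1..1}) (\<lambda>(x, y). \<kappa> x y)"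
begin

lemma cont_y: "x \<in> {-1..1} \<Longrightarrow> continuous_on {-1..1} (\<kappa> x)"
  by (rule continuous_on_compose2[OF cont, of _ "\<lambda>y. (x, y)", simplified]) (auto intro!: continuous_intros)

lemma cont_x: "y \<in> {-1..1} \<Longrightarrow> continuous_on {-1..1} (\<lambda>x. \<kappa> x y)"
  by (rule continuous_on_compose2[OF cont, of _ "\<lambda>x. (x, y)", simplified]) (auto intro!: continuous_intros)

lemma kernel_bound:
  obtains b where "b \<ge> 0" "\<And>x y. x \<in> {-1..1} \<Longrightarrow> y \<in> {-1..1} \<Longrightarrow> \<bar>\<kappa> x y\<bar> \<le> b"
proof -
  have "compact ((\<lambda>(x, y). \<kappa> x y) ` ({-1..1} \<times> {-1..1}))"
    by (intro compact_continuous_image cont compact_Times compact_Icc)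
  then obtain b where b: "\<And>z. z \<in> (\<lambda>(x, y). \<kappa> x y) ` ({-1..1} \<times> {-1..1}) \<Longrightarrow> norm z \<le> b"
    using compact_imp_bounded bounded_iff by metis
  have *: "\<bar>\<kappa> x y\<bar> \<le> b" if "x \<in> {-1..1}" "y \<in> {-1..1}" for x y
    using b[of "\<kappa> x y"] that by force
  have "b \<ge> 0" using *[of 0 0] by simp
  then show ?thesis using * that by blast
qed

lemma kernel_equicontinuous:
  assumes "e > 0"
  obtains d where "d > 0" "\<And>x y z. x \<in> {-1..1} \<Longrightarrow> y \<in> {-1..1} \<Longrightarrow> z \<in> {-1..1} \<Longrightarrow> \<bar>y - z\<bar> < d \<Longrightarrow> \<bar>\<kappa> x y - \<kappa> x z\<bar> < e"
proof -
  have "uniformly_continuous_on ({-1..1} \<times> {-1..1}) (\<lambda>(x, y). \<kappa> x y)"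
    by (intro compact_uniformly_continuous cont compact_Times compact_Icc)
  then obtain d where d: "d > 0" "\<And>p q. p \<in> {-1..1} \<times> {-1..1} \<Longrightarrow> q \<in> {-1..1} \<times> {-1..1} \<Longrightarrow> dist q p < d \<Longrightarrow>
     dist ((\<lambda>(x, y). \<kappa> x y) q) ((\<lambda>(x, y). \<kappa> x y) p) < e"
    using assms unfolding uniformly_continuous_on_def by metis
  show ?thesis
  proof
    fix x y z :: real assume "x \<in> {-1..1}" "y \<in> {-1..1}" "z \<in> {-1..1}" "\<bar>y - z\<bar> < d"
    then show "\<bar>\<kappa> x y - \<kappa> x z\<bar> < e" using d(2)[of "(x, z)" "(x, y)"] by (simp add: dist_Pair_Pair dist_real_def)
  qed (rule d(1))
qed

definition nystrom :: "nat \<Rightarrow> (real \<Rightarrow> real) \<Rightarrow> real \<Rightarrow> real" where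
  "nystrom m u y = (\<Sum>t\<in>gauss_nodes m. gauss_weight m t * (\<kappa> t y * u t))"

definition nystrom_op :: "nat \<Rightarrow> (real \<Rightarrow>\<^sub>C real) \<Rightarrow> (real \<Rightarrow>\<^sub>C real)" where
  "nystrom_op m F = const_extend (nystrom m (apply_bcontfun F))"

lemma node_in: "t \<in> gauss_nodes m \<Longrightarrow> t \<in> {-1..1}"
  using gauss_nodes(3)[of m] by auto

lemma nystrom_cont: "continuous_on {-1..1} (nystrom m u)"
  unfolding nystrom_def by (intro continuous_intros cont_y node_in)

lemma apply_nystrom_op: "apply_bcontfun (nystrom_op m F) y = nystrom m (apply_bcontfun F) (clip y)"
  unfolding nystrom_op_def by (rule apply_const_extend[OF nystrom_cont])

lemma linear_nystrom_op: "linear (nystrom_op m)"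
proof (rule linearI)
  show "nystrom_op m (F + H) = nystrom_op m F + nystrom_op m H" for F H
    by (rule bcontfun_eqI) (simp add: apply_nystrom_op nystrom_def algebra_simps sum.distrib)
  show "nystrom_op m (r *\<^sub>R F) = r *\<^sub>R nystrom_op m F" for r F
    by (rule bcontfun_eqI) (simp add: apply_nystrom_op nystrom_def sum_distrib_left algebra_simps)
qed

lemma nystrom_op_range: "nystrom_op m F \<in> span ((\<lambda>t. const_extend (\<kappa> t)) ` gauss_nodes m)"
proof -
  have sumapp: "apply_bcontfun (\<Sum>t\<in>A. c t *\<^sub>R const_extend (\<kappa> t)) y = (\<Sum>t\<in>A. c t * \<kappa> t (clip y))"
    if "A \<subseteq> {-1..1}" "finite A" for A c y
    using that(2,1) by (induction A rule: finite_induct) (auto simp: apply_const_extend[OF cont_y])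
  have "nystrom_op m F = (\<Sum>t\<in>gauss_nodes m. (gauss_weight m t * apply_bcontfun F t) *\<^sub>R const_extend (\<kappa> t))"
    by (rule bcontfun_eqI)
       (subst sumapp, use node_in gauss_nodes(1) in \<open>auto simp: apply_nystrom_op nystrom_def mult_ac\<close>)
  also have "\<dots> \<in> span ((\<lambda>t. const_extend (\<kappa> t)) ` gauss_nodes m)"
    by (intro span_sum span_scale span_base) auto
  finally show ?thesis .
qed

text \<open>
  If the bound failed, there would be functions F_j of norm 1 with F_j - K_(M j) F_j tending
  to 0 and M j tending to infinity, where K_m stands for nystrom_op m. The functions K_(M j)
  F_j are bounded and equicontinuous, uniformly in j, since the weights are nonnegative with
  sum 2; hence a subsequence converges uniformly to some g, and so does F_j. The quadrature
  rules converge on continuous functions, so g is an eigenfunction of the integral operator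
  for the eigenvalue 1, and it has norm 1: a contradiction.
\<close>
theorem nystrom_stability:
  assumes noeig: "\<And>\<phi>. continuous_on {-1..1} \<phi> \<Longrightarrow> (\<And>y. y \<in> {-1..1} \<Longrightarrow> integral {-1..1} (\<lambda>x. \<kappa> x y * \<phi> x) = \<phi> y) \<Longrightarrow>
     (\<And>y. y \<in> {-1..1} \<Longrightarrow> \<phi> y = 0)"
  obtains c m0 where "c > 0" "\<And>m F. m \<ge> m0 \<Longrightarrow> c * norm F \<le> norm (F - nystrom_op m F)"
proof (rule ccontr)
  assume "\<not> thesis"
  note T = that
  have neg: "\<not> (\<forall>m F. m \<ge> n \<longrightarrow> c * norm F \<le> norm (F - nystrom_op m F))" if "c > 0" for c n
    using \<open>\<not> thesis\<close> T[OF that, of n] by blast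
  have "\<exists>m F. m \<ge> Suc j \<and> norm F = 1 \<and> norm (F - nystrom_op m F) < 1 / real (Suc j)" for j
  proof -
    obtain m F where mF: "m \<ge> Suc j" "norm (F - nystrom_op m F) < 1 / real (Suc j) * norm F"
      using neg[of "1 / real (Suc j)" "Suc j"] by (auto simp: not_le)
    have F0: "norm F > 0" using mF(2) norm_ge_zero[of "F - nystrom_op m F"] by (cases "F = 0") auto
    define H where "H = (1 / norm F) *\<^sub>R F"
    have "H - nystrom_op m H = (1 / norm F) *\<^sub>R (F - nystrom_op m F)"
      unfolding H_def linear_cmul[OF linear_nystrom_op] by (simp add: scaleR_diff_right)
    then have "norm (H - nystrom_op m H) = norm (F - nystrom_op m F) / norm F" using F0 by simp
    also have "\<dots> < 1 / real (Suc j)" using mF(2) F0 by (simp only: pos_divide_less_eq)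
    finally have "norm (H - nystrom_op m H) < 1 / real (Suc j)" .
    moreover have "norm H = 1" using F0 by (simp add: H_def)
    ultimately show ?thesis using mF(1) by blast
  qed
  then obtain M F where MF: "\<And>j. M j \<ge> Suc j" "\<And>j. norm (F j) = 1" "\<And>j. norm (F j - nystrom_op (M j) (F j)) < 1 / real (Suc j)"
    by metis
  define P where "P j = nystrom (M j) (apply_bcontfun (F j))" for j
  obtain b where b: "b \<ge> 0" "\<And>x y. x \<in> {-1..1} \<Longrightarrow> y \<in> {-1..1} \<Longrightarrow> \<bar>\<kappa> x y\<bar> \<le> b" using kernel_bound by blast
  have F1: "\<bar>apply_bcontfun (F j) x\<bar> \<le> 1" for j x using norm_bounded[of "F j" x] MF(2) by simp
  have Mpos: "M j > 0" for j using MF(1)[of j] by simp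
  have Pb: "norm (P j y) \<le> 2 * (b * 1)" if "y \<in> {-1..1}" for j y
    unfolding P_def nystrom_def real_norm_def
    by (rule gauss_quadrature_mult_le[OF Mpos b(2)[OF _ that] F1])
  have Peq: "\<exists>d>0. \<forall>n y. y \<in> {-1..1} \<and> norm (x - y) < d \<longrightarrow> norm (P n x - P n y) < e"
    if x: "x \<in> {-1..1}" and e: "e > 0" for x e
  proof -
    obtain d where d: "d > 0" "\<And>x y z. x \<in> {-1..1} \<Longrightarrow> y \<in> {-1..1} \<Longrightarrow> z \<in> {-1..1} \<Longrightarrow> \<bar>y - z\<bar> < d \<Longrightarrow> \<bar>\<kappa> x y - \<kappa> x z\<bar> < e / 4"
      using kernel_equicontinuous[of "e / 4"] e by auto
    have "norm (P n x - P n y) < e" if y: "y \<in> {-1..1}" "norm (x - y) < d" for n y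
    proof -
      have "P n x - P n y = (\<Sum>t\<in>gauss_nodes (M n). gauss_weight (M n) t * ((\<kappa> t x - \<kappa> t y) * apply_bcontfun (F n) t))"
        by (simp add: P_def nystrom_def algebra_simps sum_subtractf)
      then have "norm (P n x - P n y) \<le> 2 * (e / 4 * 1)" unfolding real_norm_def
        by (simp only:) (rule gauss_quadrature_mult_le[OF Mpos less_imp_le[OF d(2)[OF _ x y(1)]] F1], use y in simp_all)
      then show ?thesis using e by simp
    qed
    then show ?thesis using d(1) by blast
  qed
  obtain g k where g: "continuous_on {-1..1} g" and k: "strict_mono (k :: nat \<Rightarrow> nat)"
    and lim: "\<And>e. 0 < e \<Longrightarrow> \<exists>N. \<forall>n x. n \<ge> N \<and> x \<in> {-1..1} \<longrightarrow> norm (P (k n) x - g x) < e"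
    using Arzela_Ascoli[of "{-1..1}" P "2 * (b * 1)", OF compact_Icc Pb Peq] by blast
  have kn: "n \<le> k n" for n using k by (rule seq_suble)
  have close: "\<exists>N. \<forall>n\<ge>N. norm (F (k n) - const_extend g) < e" if e: "e > 0" for e
  proof -
    obtain N1 where N1: "\<And>n x. n \<ge> N1 \<Longrightarrow> x \<in> {-1..1} \<Longrightarrow> norm (P (k n) x - g x) < e / 4" using lim[of "e / 4"] e by auto
    obtain N2 where N2: "1 / real (Suc N2) < e / 4" using reals_Archimedean[of "e / 4"] e by (auto simp: inverse_eq_divide)
    have "norm (F (k n) - const_extend g) < e" if n: "n \<ge> max N1 N2" for n
    proof -
      have "norm (nystrom_op (M (k n)) (F (k n)) - const_extend g) \<le> e / 4"
      proof (rule norm_bound)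
        fix x
        show "norm (apply_bcontfun (nystrom_op (M (k n)) (F (k n)) - const_extend g) x) \<le> e / 4"
          using N1[OF _ clip(1), of n x] n by (simp add: apply_nystrom_op apply_const_extend[OF g] P_def less_imp_le)
      qed
      moreover have "norm (F (k n) - nystrom_op (M (k n)) (F (k n))) < e / 4"
      proof -
        have "norm (F (k n) - nystrom_op (M (k n)) (F (k n))) < 1 / real (Suc (k n))" by (rule MF(3))
        also have "\<dots> \<le> 1 / real (Suc N2)" using n kn[of n] by (intro divide_left_mono) auto
        finally show ?thesis using N2 by simp
      qed
      moreover have "F (k n) - const_extend g = (F (k n) - nystrom_op (M (k n)) (F (k n))) + (nystrom_op (M (k n)) (F (k n)) - const_extend g)" by simp
      ultimately show ?thesis using norm_triangle_ineq[of "F (k n) - nystrom_op (M (k n)) (F (k n))" "nystrom_op (M (k n)) (F (k n)) - const_extend g"] e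
        by simp
    qed
    then show ?thesis by blast
  qed
  have eig: "integral {-1..1} (\<lambda>x. \<kappa> x y * g x) = g y" if y: "y \<in> {-1..1}" for y
  proof -
    have "(\<lambda>n. P (k n) y) \<longlonglongrightarrow> g y"
      by (rule LIMSEQ_I) (use lim y in blast)
    moreover have "(\<lambda>n. P (k n) y) \<longlonglongrightarrow> integral {-1..1} (\<lambda>x. \<kappa> x y * g x)"
    proof -
      have contg: "continuous_on {-1..1} (\<lambda>x. \<kappa> x y * g x)" by (intro continuous_intros cont_x y g)
      have Mlim: "filterlim (\<lambda>n. M (k n)) at_top sequentially"
        unfolding filterlim_at_top
      proof
        fix Z :: nat
        have "Z \<le> M (k n)" if "Z \<le> n" for n using MF(1)[of "k n"] kn[of n] that by linarith
        then show "\<forall>\<^sub>F n in sequentially. Z \<le> M (k n)" by (auto simp: eventually_sequentially)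
      qed
      have 1: "(\<lambda>n. nystrom (M (k n)) g y) \<longlonglongrightarrow> integral {-1..1} (\<lambda>x. \<kappa> x y * g x)"
        unfolding nystrom_def by (rule filterlim_compose[OF gauss_quadrature_tendsto[OF contg] Mlim])
      have 2: "(\<lambda>n. P (k n) y - nystrom (M (k n)) g y) \<longlonglongrightarrow> 0"
      proof (rule LIMSEQ_I)
        fix e :: real assume e: "e > 0"
        obtain N where N: "\<And>n. n \<ge> N \<Longrightarrow> norm (F (k n) - const_extend g) < e / (4 * (b + 1))"
          using close[of "e / (4 * (b + 1))"] e b(1) by auto
        have "norm (P (k n) y - nystrom (M (k n)) g y - 0) < e" if n: "n \<ge> N" for n
        proof -
          have diff: "\<bar>apply_bcontfun (F (k n)) t - g t\<bar> \<le> e / (4 * (b + 1))" if t: "t \<in> {-1..1}" for t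
            using norm_bounded[of "F (k n) - const_extend g" t] N[OF n] t by (simp add: apply_const_extend[OF g])
          have "P (k n) y - nystrom (M (k n)) g y = (\<Sum>t\<in>gauss_nodes (M (k n)). gauss_weight (M (k n)) t * (\<kappa> t y * (apply_bcontfun (F (k n)) t - g t)))"
            by (simp add: P_def nystrom_def algebra_simps sum_subtractf)
          then have "norm (P (k n) y - nystrom (M (k n)) g y) \<le> 2 * (b * (e / (4 * (b + 1))))" unfolding real_norm_def
            by (simp only:) (rule gauss_quadrature_mult_le[OF Mpos b(2)[OF _ y] diff])
          also have "\<dots> < e"
          proof -
            have "b * (e / (4 * (b + 1))) \<le> (b + 1) * (e / (4 * (b + 1)))" using e b(1) by (intro mult_right_mono) auto
            also have "(b + 1) * (e / (4 * (b + 1))) = e / 4" using b(1) by (simp add: divide_simps)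
            finally have "2 * (b * (e / (4 * (b + 1)))) \<le> e / 2" by linarith
            then show ?thesis using e by linarith
          qed
          finally show ?thesis by simp
        qed
        then show "\<exists>no. \<forall>n\<ge>no. norm (P (k n) y - nystrom (M (k n)) g y - 0) < e" by blast
      qed
      show ?thesis using tendsto_add[OF 1 2] by simp
    qed
    ultimately show ?thesis using LIMSEQ_unique by blast
  qed
  have "g y = 0" if "y \<in> {-1..1}" for y using noeig[OF g eig that] .
  then have "const_extend g = 0" by (intro bcontfun_eqI) (simp only: apply_const_extend[OF g] clip(1) zero_bcontfun.rep_eq)
  moreover obtain n where "norm (F (k n) - const_extend g) < 1" using close[of 1] by auto
  ultimately show False using MF(2)[of "k n"] by simp
qed

end

section \<open>Convergence of the discrete fixed points\<close>

lemma wsmooth_const: "wsmooth i s \<bar>c\<bar> (\<lambda>x. c)"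
proof (induction s arbitrary: i c)
  have bd: "\<bar>c\<bar> * weight x ^ i \<le> \<bar>c\<bar>" if "x \<in> {-1<..<1}" for x c i
  proof -
    have "weight x ^ i \<le> 1" using weight_pos[OF that] weight_le_1 by (intro power_le_one) (auto simp: less_imp_le)
    then show ?thesis by (simp add: mult_left_le)
  qed
  {
    case 0
    then show ?case using bd by (simp add: wlip_def)
  next
    case (Suc s)
    have "wsmooth (Suc i) s \<bar>c\<bar> (\<lambda>x. 0)" by (rule wsmooth_mono[OF Suc.IH[of "Suc i" 0]]) simp
    then show ?case by (rule wsmooth_SucI[rotated -1]) (use bd in auto)
  }
qed

lemma wsmooth_cong:
  assumes "wsmooth i s M u" "\<And>x. x \<in> {-1<..<1} \<Longrightarrow> v x = u x"
  shows "wsmooth i s M v"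
proof (cases s)
  case 0
  then show ?thesis using assms by (simp add: wlip_def)
next
  case (Suc s')
  then obtain u' where u': "\<forall>x\<in>{-1<..<1}. (u has_real_derivative u' x) (at x)" "wsmooth (Suc i) s' M u'"
    using assms(1) unfolding Suc wsmooth.simps by blast
  show ?thesis unfolding Suc
  proof (rule wsmooth_SucI[OF _ _ u'(2)])
    fix x :: real assume x: "x \<in> {-1<..<1}"
    show "\<bar>v x\<bar> * weight x ^ i \<le> M" using wsmooth_bound[OF assms(1) x] assms(2)[OF x] by simp
    show "(v has_real_derivative u' x) (at x)"
      by (rule has_field_derivative_transform_within_open[of u _ _ "{-1<..<1}"]) (use u'(1) x assms(2) in auto)
  qed
qed

lemma SUP_Wnorm_bound:
  assumes "(SUP x\<in>S. Wnorm r (f x)) < \<infinity>"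
  obtains M where "\<And>x. x \<in> S \<Longrightarrow> Wnorm r (f x) \<le> ereal M"
proof -
  obtain M where M: "(SUP x\<in>S. Wnorm r (f x)) \<le> ereal M"
    using assms by (cases "SUP x\<in>S. Wnorm r (f x)") (auto intro: that)
  show ?thesis
  proof
    fix x assume "x \<in> S"
    then have "Wnorm r (f x) \<le> (SUP x\<in>S. Wnorm r (f x))" by (rule SUP_upper)
    then show "Wnorm r (f x) \<le> ereal M" using M by (rule order_trans)
  qed
qed

lemma Wspace_Wnorm_finite:
  assumes "u \<in> Wspace r"
  obtains M where "Wnorm r u \<le> ereal M"
proof -
  have "weighted_deriv_norm r u < \<infinity>" using assms by (simp add: Wspace_def)
  then obtain M where "weighted_deriv_norm r u \<le> ereal M"
    by (cases "weighted_deriv_norm r u") auto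
  then have "Wnorm r u \<le> ereal (max_norm u) + ereal M" unfolding Wnorm_def by (rule add_left_mono)
  then show ?thesis using that by simp
qed

text \<open>
  Multiplying k x by the constant w x does not change its smoothness in y, so that the
  smoothness of the integral in y is that of the kernel, for every continuous w.
\<close>
lemma integral_operator_wsmooth:
  fixes k :: "real \<Rightarrow> real \<Rightarrow> real" and w :: "real \<Rightarrow> real"
  assumes k: "continuous_on ({-1..1} \<times> {-1..1}) (\<lambda>(x, y). k x y)" and w: "continuous_on {-1..1} w"
    and kW: "\<And>x. x \<in> {-1..1} \<Longrightarrow> (\<lambda>y. k x y) \<in> Wspace (Suc s)"
    and kb: "(SUP x\<in>{-1..1}. Wnorm (Suc s) (\<lambda>y. k x y)) < \<infinity>"
  obtains M where "wsmooth 0 s M (\<lambda>y. integral {-1..1} (\<lambda>x. k x y * w x))"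
proof -
  interpret continuous_kernel k by unfold_locales (rule k)
  obtain A where A': "\<forall>u M. u \<in> Wspace (Suc s) \<longrightarrow> Wnorm (Suc s) u \<le> ereal M \<longrightarrow> wsmooth 0 s (A * M) u"
    using Wspace_wsmooth by blast
  note A = A'[rule_format]
  obtain M where M: "\<And>x. x \<in> {-1..1} \<Longrightarrow> Wnorm (Suc s) (\<lambda>y. k x y) \<le> ereal M"
    using SUP_Wnorm_bound[OF kb] by blast
  have sm: "wsmooth 0 s (2 ^ Suc s * (A * M * max_norm w)) (\<lambda>y. k x y * w x)" if x: "x \<in> {-1..1}" for x
  proof -
    have "wsmooth 0 s (max_norm w) (\<lambda>y. w x)" by (rule wsmooth_mono[OF wsmooth_const max_norm_ge[OF w x]])
    from wsmooth_mult[OF A[OF kW[OF x] M[OF x]] this] show ?thesis by simp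
  qed
  have "wsmooth 0 s (2 * (2 ^ Suc s * (A * M * max_norm w))) (\<lambda>y. integral {-1..1} (\<lambda>x. k x y * w x))"
    by (rule wsmooth_integral[where F = "\<lambda>x y. k x y * w x", OF sm])
       (auto intro!: integrable_continuous_real continuous_intros cont_x w)
  then show ?thesis by (rule that)
qed

lemma compact_tube:
  assumes "continuous_on {-1..1} f"
  shows "compact (tube f d)"
proof -
  have "tube f d = (\<lambda>(x, t). (x, f x + t)) ` ({-1..1} \<times> {-d..d})"
  proof
    show "tube f d \<subseteq> (\<lambda>(x, t). (x, f x + t)) ` ({-1..1} \<times> {-d..d})"
    proof
      fix p assume "p \<in> tube f d"
      then obtain x v where p: "p = (x, v)" "x \<in> {-1..1}" "\<bar>v - f x\<bar> \<le> d" by (auto simp: tube_def)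
      then show "p \<in> (\<lambda>(x, t). (x, f x + t)) ` ({-1..1} \<times> {-d..d})"
        by (intro image_eqI[of _ _ "(x, v - f x)"]) auto
    qed
    show "(\<lambda>(x, t). (x, f x + t)) ` ({-1..1} \<times> {-d..d}) \<subseteq> tube f d" by (auto simp: tube_def)
  qed
  moreover have "continuous_on ({-1..1} \<times> {-d..d}) (\<lambda>(x, t). (x, f x + t))"
    unfolding case_prod_beta by (intro continuous_intros continuous_on_compose2[OF assms]) auto
  ultimately show ?thesis by (simp add: compact_continuous_image compact_Times)
qed

text \<open>
  On the compact tube, the derivative of h in v is uniformly continuous. Close to the graph of
  f it therefore differs from its value on the graph by at most \<eta>, uniformly in x.
\<close>
lemma linearization_small:
  assumes f: "continuous_on {-1..1} f" and d: "d > 0" and H2: "cond_H2 h f d" and \<eta>: "\<eta> > 0"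
  obtains \<epsilon> where "0 < \<epsilon>" "\<epsilon> \<le> d" "\<And>x v w. x \<in> {-1..1} \<Longrightarrow> \<bar>v - f x\<bar> \<le> \<epsilon> \<Longrightarrow> \<bar>w - f x\<bar> \<le> \<epsilon> \<Longrightarrow>
     \<bar>h x v - h x w - partial2 h x (f x) * (v - w)\<bar> \<le> \<eta> * \<bar>v - w\<bar>"
proof -
  have der: "\<And>x v. (x, v) \<in> tube f d \<Longrightarrow> (\<lambda>t. h x t) field_differentiable at v"
    and cont: "continuous_on (tube f d) (\<lambda>(x, v). partial2 h x v)" using H2 by (auto simp: cond_H2_def)
  have "uniformly_continuous_on (tube f d) (\<lambda>(x, v). partial2 h x v)"
    by (intro compact_uniformly_continuous cont compact_tube f)
  then obtain e where e: "e > 0" "\<And>p q. p \<in> tube f d \<Longrightarrow> q \<in> tube f d \<Longrightarrow> dist q p < e \<Longrightarrow>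
     dist ((\<lambda>(x, v). partial2 h x v) q) ((\<lambda>(x, v). partial2 h x v) p) < \<eta>"
    using \<eta> unfolding uniformly_continuous_on_def by blast
  define \<epsilon> where "\<epsilon> = min d (e / 2)"
  have \<epsilon>: "0 < \<epsilon>" "\<epsilon> \<le> d" "\<epsilon> < e" using d e(1) by (auto simp: \<epsilon>_def)
  show ?thesis
  proof (rule that[OF \<epsilon>(1,2)])
    fix x v w assume x: "x \<in> {-1..1}" and v: "\<bar>v - f x\<bar> \<le> \<epsilon>" and w: "\<bar>w - f x\<bar> \<le> \<epsilon>"
    define c where "c = partial2 h x (f x)"
    have "norm ((h x v - c * v) - (h x w - c * w)) \<le> \<eta> * norm (v - w)"
    proof (rule field_differentiable_bound[where S = "{f x - \<epsilon>..f x + \<epsilon>}" and f' = "\<lambda>t. partial2 h x t - c"])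
      fix t assume t: "t \<in> {f x - \<epsilon>..f x + \<epsilon>}"
      have tt: "(x, t) \<in> tube f d" "(x, f x) \<in> tube f d" using x t \<epsilon> by (auto simp: tube_def)
      have D: "((\<lambda>t. h x t) has_real_derivative partial2 h x t) (at t)"
        using der[OF tt(1)] by (simp add: partial2_def DERIV_deriv_iff_field_differentiable)
      have "((\<lambda>t. h x t - c * t) has_real_derivative partial2 h x t - c * 1) (at t)"
        by (rule DERIV_diff[OF D DERIV_cmult[OF DERIV_ident]])
      then show "((\<lambda>t. h x t - c * t) has_real_derivative partial2 h x t - c) (at t within {f x - \<epsilon>..f x + \<epsilon>})"
        by (simp only: mult_1_right has_field_derivative_at_within)
      have "dist (x, t) (x, f x) < e" using t \<epsilon> by (auto simp: dist_Pair_Pair dist_real_def)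
      from e(2)[OF tt(2,1) this] show "norm (partial2 h x t - c) \<le> \<eta>" by (simp add: c_def dist_real_def)
    qed (use v w in auto)
    then show "\<bar>h x v - h x w - partial2 h x (f x) * (v - w)\<bar> \<le> \<eta> * \<bar>v - w\<bar>" by (simp add: c_def algebra_simps)
  qed
qed

theorem theorem4p3:
  fixes k1 k2 h :: "real \<Rightarrow> real \<Rightarrow> real" and g fstar :: "real \<Rightarrow> real"
    and \<delta> :: real and r :: nat and \<Omega> :: "(real \<times> real) set"
  assumes k1_cont: "continuous_on ({-1..1} \<times> {-1..1}) (\<lambda>(x, y). k1 x y)"
    and k2_cont: "continuous_on ({-1..1} \<times> {-1..1}) (\<lambda>(x, y). k2 x y)"
    and delta_pos: "\<delta> > 0"
    and fstar_C0: "fstar \<in> C0"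
    and fixed_point: "unique_fixed_point_in (op_G k1 k2 h g) fstar (C0_ball fstar \<delta>)"
    and K1: "cond_K1 k1" "cond_K1 k2"
    and H1: "continuous_on ({-1..1} \<times> UNIV) (\<lambda>(x, v). h x v)"
    and G1: "continuous_on {-1..1} g"
    and H2: "cond_H2 h fstar \<delta>"
    and H3: "cond_H3 h fstar \<delta>"
    and not_eigenvalue: "\<not> is_eigenvalue (op_G_deriv k1 k2 h fstar) 1"
    and r_ge_1: "r \<ge> 1"
    and k_y: "\<And>k x. k \<in> {k1, k2} \<Longrightarrow> x \<in> {-1..1} \<Longrightarrow> (\<lambda>y. k x y) \<in> Wspace r"
    and k_y_bound: "\<And>k. k \<in> {k1, k2} \<Longrightarrow> (SUP x\<in>{-1..1}. Wnorm r (\<lambda>y. k x y)) < \<infinity>"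
    and k_x: "\<And>k y. k \<in> {k1, k2} \<Longrightarrow> y \<in> {-1..1} \<Longrightarrow> (\<lambda>x. k x y) \<in> Wspace r"
    and k_x_bound: "\<And>k. k \<in> {k1, k2} \<Longrightarrow> (SUP y\<in>{-1..1}. Wnorm r (\<lambda>x. k x y)) < \<infinity>"
    and g_W: "g \<in> Wspace r"
    and Omega: "open \<Omega>" "\<Omega> \<subseteq> {-1<..<1} \<times> UNIV" "\<And>x. x \<in> {-1<..<1} \<Longrightarrow> (x, fstar x) \<in> \<Omega>"
    and h_W: "h \<in> Wspace2 r \<Omega>"
  shows "\<exists>\<epsilon> m0 f. 0 < \<epsilon> \<and> \<epsilon> \<le> \<delta> \<and>
    (\<forall>m\<ge>m0. unique_fixed_point_in (op_Gm k1 k2 h g m) (f m) (C0_ball fstar \<epsilon>)) \<and>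
    (\<lambda>m. max_norm (\<lambda>x. fstar x - f m x)) \<in> O(\<lambda>m. 1 / real m ^ r)"
proof -
  obtain s where r: "r = Suc s" using r_ge_1 by (cases r) auto
  interpret K1: continuous_kernel k1 by unfold_locales (rule k1_cont)
  interpret K2: continuous_kernel k2 by unfold_locales (rule k2_cont)
  have fcont: "continuous_on {-1..1} fstar" using fstar_C0 by (simp add: C0_def)
  have f_fix: "op_G k1 k2 h g fstar y = fstar y" if "y \<in> {-1..1}" for y
    using fixed_point that by (simp add: unique_fixed_point_in_def eq_C0_def)
  have hcont: "continuous_on {-1..1} (\<lambda>x. h x (u x))" if "continuous_on {-1..1} u" for u
    by (rule continuous_on_compose2[OF H1, of _ "\<lambda>x. (x, u x)", simplified]) (use that in \<open>auto intro!: continuous_intros\<close>)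
  define hf where "hf x = h x (fstar x)" for x
  have hfcont: "continuous_on {-1..1} hf" unfolding hf_def by (rule hcont[OF fcont])

  \<comment> \<open>The fixed point equation makes fstar as smooth as g is and as the kernels
    are in y; hence the composition of h with fstar is smooth as well. The constant A is the
    same for all functions, which makes the bounds for the kernels uniform in x and in
    y.\<close>
  obtain A where A': "\<forall>u M. u \<in> Wspace (Suc s) \<longrightarrow> Wnorm (Suc s) u \<le> ereal M \<longrightarrow> wsmooth 0 s (A * M) u"
    using Wspace_wsmooth by blast
  note A = A'[rule_format]
  obtain Mf where f_smooth: "wsmooth 0 s Mf fstar"
  proof -
    obtain M1 where M1: "wsmooth 0 s M1 (\<lambda>y. integral {-1..1} (\<lambda>x. k1 x y * fstar x))"
      by (rule integral_operator_wsmooth[OF k1_cont fcont, of s]) (use k_y[of k1] k_y_bound[of k1] r in auto)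
    obtain M2 where M2: "wsmooth 0 s M2 (\<lambda>y. integral {-1..1} (\<lambda>x. k2 x y * hf x))"
      by (rule integral_operator_wsmooth[OF k2_cont hfcont, of s]) (use k_y[of k2] k_y_bound[of k2] r in auto)
    obtain Mg where "Wnorm (Suc s) g \<le> ereal Mg" using Wspace_Wnorm_finite[OF g_W] r by blast
    then have M3: "wsmooth 0 s (A * Mg) g" using A g_W r by blast
    have "wsmooth 0 s (M1 + M2 + A * Mg) fstar"
      by (rule wsmooth_cong[OF wsmooth_add[OF wsmooth_add[OF M1 M2] M3]])
         (use f_fix in \<open>simp add: op_G_def hf_def\<close>)
    then show ?thesis by (rule that)
  qed
  obtain Mh where h_smooth: "wsmooth 0 s Mh hf"
  proof -
    obtain B where "bounded_partials r \<Omega> h B" by (rule Wspace2_bounded_partials[OF h_W Omega(1)])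
    then interpret bounded_partials r \<Omega> h B .
    have "\<exists>N. wsmooth 0 s N (\<lambda>x. mixed_partial 0 0 h x (fstar x))"
      by (rule composition_wsmooth[OF f_smooth Omega(3)]) (use r in auto)
    then show ?thesis using that unfolding hf_def by (auto simp: mixed_partial_def)
  qed
  obtain Mu where u_smooth: "\<And>y. y \<in> {-1..1} \<Longrightarrow> wsmooth 0 s Mu (\<lambda>x. k1 x y * fstar x + k2 x y * hf x)"
  proof -
    obtain N1 where N1: "\<And>y. y \<in> {-1..1} \<Longrightarrow> Wnorm (Suc s) (\<lambda>x. k1 x y) \<le> ereal N1"
      using SUP_Wnorm_bound[OF k_x_bound[of k1]] r by blast
    obtain N2 where N2: "\<And>y. y \<in> {-1..1} \<Longrightarrow> Wnorm (Suc s) (\<lambda>x. k2 x y) \<le> ereal N2"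
      using SUP_Wnorm_bound[OF k_x_bound[of k2]] r by blast
    show ?thesis
    proof
      fix y :: real assume y: "y \<in> {-1..1}"
      have W: "(\<lambda>x. k1 x y) \<in> Wspace (Suc s)" "(\<lambda>x. k2 x y) \<in> Wspace (Suc s)" using k_x y r by auto
      from wsmooth_add[OF wsmooth_mult[OF A[OF W(1) N1[OF y]] f_smooth] wsmooth_mult[OF A[OF W(2) N2[OF y]] h_smooth]]
      show "wsmooth 0 s (2 ^ Suc s * (A * N1 * Mf) + 2 ^ Suc s * (A * N2 * Mh)) (\<lambda>x. k1 x y * fstar x + k2 x y * hf x)"
        by simp
    qed
  qed
  have ucont: "continuous_on {-1..1} (\<lambda>x. k1 x y * fstar x + k2 x y * hf x)" if "y \<in> {-1..1}" for y
    by (intro continuous_intros K1.cont_x K2.cont_x that fcont hfcont)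
  obtain C m1 where C: "C \<ge> 0" "m1 \<ge> 1" "\<And>M u m. M \<ge> 0 \<Longrightarrow> continuous_on {-1..1} u \<Longrightarrow> wsmooth 0 s M u \<Longrightarrow> m \<ge> m1 \<Longrightarrow>
     \<bar>integral {-1..1} u - (\<Sum>t\<in>gauss_nodes m. gauss_weight m t * u t)\<bar> \<le> C * M / real m ^ Suc s"
    using gauss_error_wsmooth[of s] by blast
  have Mu0: "Mu \<ge> 0" using wsmooth_nonneg u_smooth[of 0] by auto
  have consistency: "\<bar>fstar y - op_Gm k1 k2 h g m fstar y\<bar> \<le> C * Mu / real m ^ r" if m: "m \<ge> m1" and y: "y \<in> {-1..1}" for m y
  proof -
    have i1: "(\<lambda>x. k1 x y * fstar x) integrable_on {-1..1}" "(\<lambda>x. k2 x y * hf x) integrable_on {-1..1}"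
      by (intro integrable_continuous_real continuous_intros K1.cont_x K2.cont_x y fcont hfcont)+
    have "fstar y = integral {-1..1} (\<lambda>x. k1 x y * fstar x + k2 x y * hf x) + g y"
      unfolding integral_add[OF i1] using f_fix[OF y] by (simp add: op_G_def hf_def)
    moreover have "op_Gm k1 k2 h g m fstar y = (\<Sum>t\<in>gauss_nodes m. gauss_weight m t * (k1 t y * fstar t + k2 t y * hf t)) + g y"
      by (simp add: op_Gm_def hf_def distrib_left sum.distrib mult.assoc)
    ultimately show ?thesis using C(3)[OF Mu0 ucont[OF y] u_smooth[OF y] m] unfolding r by simp
  qed

  \<comment> \<open>The kernel \<kappa> belongs to the derivative of op_G at fstar, and its
    discretization by the Gauss rule to the derivative of op_Gm at fstar.\<close>
  define hv where "hv x = partial2 h x (fstar x)" for x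
  define \<kappa> where "\<kappa> x y = k1 x y + k2 x y * hv x" for x y
  have hvcont: "continuous_on {-1..1} hv"
  proof -
    have "continuous_on (tube fstar \<delta>) (\<lambda>(x, v). partial2 h x v)" using H2 by (simp add: cond_H2_def)
    moreover have "continuous_on {-1..1} (\<lambda>x. (x, fstar x))" by (intro continuous_intros fcont)
    moreover have "(\<lambda>x. (x, fstar x)) ` {-1..1} \<subseteq> tube fstar \<delta>" using delta_pos by (auto simp: tube_def)
    ultimately have "continuous_on {-1..1} (\<lambda>x. case (x, fstar x) of (x, v) \<Rightarrow> partial2 h x v)"
      by (rule continuous_on_compose2)
    then show ?thesis by (simp add: hv_def)
  qed
  interpret KK: continuous_kernel \<kappa>
  proof
    have "continuous_on ({-1..1} \<times> {-1..1}) (\<lambda>p. hv (fst p))"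
      by (rule continuous_on_compose2[OF hvcont]) (auto intro!: continuous_intros)
    then show "continuous_on ({-1..1} \<times> {-1..1}) (\<lambda>(x, y). \<kappa> x y)"
      using k1_cont k2_cont unfolding \<kappa>_def case_prod_beta by (intro continuous_intros)
  qed
  obtain c m2 where c: "c > 0" and stab: "\<And>m F. m \<ge> m2 \<Longrightarrow> c * norm F \<le> norm (F - KK.nystrom_op m F)"
  proof (rule KK.nystrom_stability)
    fix \<phi> :: "real \<Rightarrow> real" and y :: real
    assume phi: "continuous_on {-1..1} \<phi>" and eq: "\<And>y. y \<in> {-1..1} \<Longrightarrow> integral {-1..1} (\<lambda>x. \<kappa> x y * \<phi> x) = \<phi> y"
      and y: "y \<in> {-1..1}"
    have "op_G_deriv k1 k2 h fstar \<phi> z = \<phi> z" if z: "z \<in> {-1..1}" for z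
    proof -
      have i1: "(\<lambda>x. k1 x z * \<phi> x) integrable_on {-1..1}" "(\<lambda>x. k2 x z * hv x * \<phi> x) integrable_on {-1..1}"
        by (intro integrable_continuous_real continuous_intros K1.cont_x K2.cont_x z phi hvcont)+
      have "op_G_deriv k1 k2 h fstar \<phi> z = integral {-1..1} (\<lambda>x. k1 x z * \<phi> x + k2 x z * hv x * \<phi> x)"
        unfolding integral_add[OF i1] by (simp add: op_G_deriv_def hv_def)
      also have "\<dots> = integral {-1..1} (\<lambda>x. \<kappa> x z * \<phi> x)" by (simp add: \<kappa>_def distrib_right)
      finally show ?thesis using eq[OF z] by simp
    qed
    then show "\<phi> y = 0" using not_eigenvalue phi y unfolding is_eigenvalue_def eq_C0_def C0_def by auto
  qed blast

  \<comment> \<open>Fixed points are sought in the Banach space of bounded continuous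
    functions, where F0 stands for fstar and G m for op_Gm.\<close>
  define G where "G m F = const_extend (op_Gm k1 k2 h g m (apply_bcontfun F))" for m and F :: "real \<Rightarrow>\<^sub>C real"
  have Gm_cont: "continuous_on {-1..1} (op_Gm k1 k2 h g m u)" for m u
    unfolding op_Gm_def by (intro continuous_intros K1.cont_y K2.cont_y K1.node_in G1)
  have apply_G: "apply_bcontfun (G m F) y = op_Gm k1 k2 h g m (apply_bcontfun F) (clip y)" for m F y
    unfolding G_def by (rule apply_const_extend[OF Gm_cont])
  have Gm_cong: "op_Gm k1 k2 h g m u y = op_Gm k1 k2 h g m v y" if "\<And>t. t \<in> {-1..1} \<Longrightarrow> u t = v t" for m u v y
    unfolding op_Gm_def using that K1.node_in by (simp cong: sum.cong)
  define F0 where "F0 = const_extend fstar"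
  have apply_F0: "apply_bcontfun F0 x = fstar (clip x)" for x unfolding F0_def by (rule apply_const_extend[OF fcont])
  obtain b where b: "b \<ge> 0" "\<And>x y. x \<in> {-1..1} \<Longrightarrow> y \<in> {-1..1} \<Longrightarrow> \<bar>k2 x y\<bar> \<le> b" using K2.kernel_bound by blast
  \<comment> \<open>The weights of the Gauss rule add up to 2 and \<bar>k2\<bar> \<le> b, so
    that a linearization error \<eta> of h becomes an error of at most 2 * b * \<eta> \<le> c
    / 2 of the discrete operator.\<close>
  define \<eta> where "\<eta> = c / (4 * (b + 1))"
  have \<eta>: "\<eta> > 0" using c b(1) by (simp add: \<eta>_def)
  have b\<eta>: "2 * (b * \<eta>) \<le> c / 2"
  proof -
    have "b * \<eta> \<le> (b + 1) * \<eta>" using \<eta> by (intro mult_right_mono) auto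
    also have "(b + 1) * \<eta> = c / 4" using b(1) by (simp add: \<eta>_def divide_simps)
    finally show ?thesis by linarith
  qed
  obtain \<epsilon> where \<epsilon>: "0 < \<epsilon>" "\<epsilon> \<le> \<delta>" and lin: "\<And>x v w. x \<in> {-1..1} \<Longrightarrow> \<bar>v - fstar x\<bar> \<le> \<epsilon> \<Longrightarrow> \<bar>w - fstar x\<bar> \<le> \<epsilon> \<Longrightarrow>
     \<bar>h x v - h x w - hv x * (v - w)\<bar> \<le> \<eta> * \<bar>v - w\<bar>"
    unfolding hv_def by (rule linearization_small[OF fcont delta_pos H2 \<eta>]) blast
  have in_ball: "\<bar>apply_bcontfun F t - fstar t\<bar> \<le> \<epsilon>" if "F \<in> cball F0 \<epsilon>" "t \<in> {-1..1}" for F t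
    using norm_bounded[of "F - F0" t] that clip(2)[OF that(2)] by (simp add: apply_F0 dist_norm norm_minus_commute)
  have diff: "norm (G m F - G m H - KK.nystrom_op m (F - H)) \<le> c / 2 * norm (F - H)"
    if m: "m > 0" and FH: "F \<in> cball F0 \<epsilon>" "H \<in> cball F0 \<epsilon>" for m F H
  proof (rule norm_bound)
    fix x
    define y where "y = clip x"
    have y: "y \<in> {-1..1}" unfolding y_def by (rule clip(1))
    let ?F = "apply_bcontfun F" and ?H = "apply_bcontfun H"
    have "apply_bcontfun (G m F - G m H - KK.nystrom_op m (F - H)) x =
      (\<Sum>t\<in>gauss_nodes m. gauss_weight m t * (k2 t y * (h t (?F t) - h t (?H t) - hv t * (?F t - ?H t))))"
      by (simp add: apply_G KK.apply_nystrom_op KK.nystrom_def op_Gm_def \<kappa>_def y_def[symmetric] algebra_simps sum.distrib sum_subtractf)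
    also have "\<bar>\<dots>\<bar> \<le> 2 * (b * (\<eta> * norm (F - H)))"
    proof (rule gauss_quadrature_mult_le[OF m b(2)[OF _ y]])
      fix t :: real assume t: "t \<in> {-1..1}"
      have "\<bar>h t (?F t) - h t (?H t) - hv t * (?F t - ?H t)\<bar> \<le> \<eta> * \<bar>?F t - ?H t\<bar>"
        by (rule lin[OF t in_ball[OF FH(1) t] in_ball[OF FH(2) t]])
      also have "\<dots> \<le> \<eta> * norm (F - H)" using norm_bounded[of "F - H" t] \<eta> by (intro mult_left_mono) auto
      finally show "\<bar>h t (?F t) - h t (?H t) - hv t * (?F t - ?H t)\<bar> \<le> \<eta> * norm (F - H)" .
    qed
    also have "\<dots> = (2 * (b * \<eta>)) * norm (F - H)" by simp
    also have "\<dots> \<le> c / 2 * norm (F - H)" by (rule mult_right_mono[OF b\<eta>]) simp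
    finally show "norm (apply_bcontfun (G m F - G m H - KK.nystrom_op m (F - H)) x) \<le> c / 2 * norm (F - H)" by simp
  qed
  have start: "norm (F0 - G m F0) \<le> C * Mu / real m ^ r" if m: "m \<ge> m1" for m
  proof (rule norm_bound)
    fix x
    have "op_Gm k1 k2 h g m (apply_bcontfun F0) (clip x) = op_Gm k1 k2 h g m fstar (clip x)"
      by (rule Gm_cong) (simp add: apply_F0 clip(2))
    then show "norm (apply_bcontfun (F0 - G m F0) x) \<le> C * Mu / real m ^ r"
      using consistency[OF m clip(1)[of x]] by (simp add: apply_G apply_F0)
  qed
  obtain m3 where m3: "\<And>m. m \<ge> m3 \<Longrightarrow> C * Mu / real m ^ r \<le> c * \<epsilon> / 2"
  proof -
    have "(\<lambda>m. C * Mu / real m ^ r) \<longlonglongrightarrow> 0"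
      using r_ge_1 by (intro tendsto_divide_0[OF tendsto_const] filterlim_at_top_imp_at_infinity filterlim_pow_at_top filterlim_real_sequentially) auto
    then have "\<forall>\<^sub>F m in sequentially. C * Mu / real m ^ r < c * \<epsilon> / 2"
      using c \<epsilon>(1) by (intro order_tendstoD(2)) auto
    then obtain N where "\<And>m. m \<ge> N \<Longrightarrow> C * Mu / real m ^ r < c * \<epsilon> / 2"
      unfolding eventually_sequentially by blast
    then show ?thesis by (intro that[of N] less_imp_le)
  qed
  define m0 where "m0 = max m1 (max m2 m3)"
  have "\<exists>F\<in>cball F0 \<epsilon>. G m F = F \<and> (\<forall>H\<in>cball F0 \<epsilon>. G m H = H \<longrightarrow> H = F) \<and> norm (F - F0) \<le> 2 / c * norm (F0 - G m F0)"
    if m: "m \<ge> m0" for m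
  proof (rule newton_fixed_point[where K = "KK.nystrom_op m", OF KK.linear_nystrom_op _ c stab \<epsilon>(1)])
    show m2: "m \<ge> m2" using m by (simp add: m0_def)
    have mp: "m > 0" using m C(2) by (simp add: m0_def)
    show "\<exists>F. F - KK.nystrom_op m F = H" for H
    proof (rule finite_rank_surj[OF KK.linear_nystrom_op _ KK.nystrom_op_range])
      show "finite ((\<lambda>t. const_extend (\<kappa> t)) ` gauss_nodes m)" using gauss_nodes(1) by blast
      fix F assume "F - KK.nystrom_op m F = 0"
      then have "c * norm F \<le> 0" using stab[OF m2, of F] by simp
      then show "F = 0" using c by (simp add: mult_le_0_iff)
    qed
    show "norm (G m F - G m H - KK.nystrom_op m (F - H)) \<le> c / 2 * norm (F - H)"
      if "F \<in> cball F0 \<epsilon>" "H \<in> cball F0 \<epsilon>" for F H by (rule diff[OF mp that])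
    show "norm (F0 - G m F0) \<le> c * \<epsilon> / 2"
      by (rule order_trans[OF start m3]) (use m in \<open>auto simp: m0_def\<close>)
  qed
  then have "\<forall>m. \<exists>F. m \<ge> m0 \<longrightarrow> F \<in> cball F0 \<epsilon> \<and> G m F = F \<and> (\<forall>H\<in>cball F0 \<epsilon>. G m H = H \<longrightarrow> H = F) \<and> norm (F - F0) \<le> 2 / c * norm (F0 - G m F0)"
    by blast
  from choice[OF this] obtain F where F: "\<And>m. m \<ge> m0 \<Longrightarrow> F m \<in> cball F0 \<epsilon>" "\<And>m. m \<ge> m0 \<Longrightarrow> G m (F m) = F m"
    "\<And>m H. m \<ge> m0 \<Longrightarrow> H \<in> cball F0 \<epsilon> \<Longrightarrow> G m H = H \<Longrightarrow> H = F m"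
    "\<And>m. m \<ge> m0 \<Longrightarrow> norm (F m - F0) \<le> 2 / c * norm (F0 - G m F0)" by blast
  define f where "f m = apply_bcontfun (F m)" for m
  have fixed: "unique_fixed_point_in (op_Gm k1 k2 h g m) (f m) (C0_ball fstar \<epsilon>)" if m: "m \<ge> m0" for m
    unfolding unique_fixed_point_in_def
  proof (intro conjI ballI impI)
    show "f m \<in> C0_ball fstar \<epsilon>" unfolding C0_ball_def C0_def f_def
      using in_ball[OF F(1)[OF m]] by (auto intro!: max_norm_le)
    show "eq_C0 (op_Gm k1 k2 h g m (f m)) (f m)" unfolding eq_C0_def
    proof
      fix y :: real assume y: "y \<in> {-1..1}"
      have "apply_bcontfun (F m) y = op_Gm k1 k2 h g m (f m) (clip y)"
        using apply_G[of m "F m" y] F(2)[OF m] by (simp add: f_def)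
      then show "op_Gm k1 k2 h g m (f m) y = f m y" by (simp add: f_def clip(2)[OF y])
    qed
    fix u assume u: "u \<in> C0_ball fstar \<epsilon>" and ufix: "eq_C0 (op_Gm k1 k2 h g m u) u"
    have ucont: "continuous_on {-1..1} u" using u by (simp add: C0_ball_def C0_def)
    have u_near: "\<bar>u x - fstar x\<bar> \<le> \<epsilon>" if "x \<in> {-1..1}" for x
    proof -
      have "max_norm (\<lambda>x. u x - fstar x) \<le> \<epsilon>" using u by (simp add: C0_ball_def)
      then show ?thesis
        using max_norm_ge[OF continuous_on_diff[OF ucont fcont] that] by linarith
    qed
    have apply_u: "apply_bcontfun (const_extend u) x = u (clip x)" for x by (rule apply_const_extend[OF ucont])
    have "norm (const_extend u - F0) \<le> \<epsilon>"
      by (rule norm_bound) (use u_near[OF clip(1)] in \<open>simp add: apply_u apply_F0\<close>)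
    then have "const_extend u \<in> cball F0 \<epsilon>" by (simp add: dist_norm norm_minus_commute)
    moreover have "G m (const_extend u) = const_extend u"
    proof (rule bcontfun_eqI)
      fix x
      have "op_Gm k1 k2 h g m (apply_bcontfun (const_extend u)) (clip x) = op_Gm k1 k2 h g m u (clip x)"
        by (rule Gm_cong) (simp add: apply_u clip(2))
      also have "\<dots> = u (clip x)" using ufix clip(1)[of x] by (simp add: eq_C0_def)
      finally show "apply_bcontfun (G m (const_extend u)) x = apply_bcontfun (const_extend u) x" by (simp add: apply_G apply_u)
    qed
    ultimately have "const_extend u = F m" by (rule F(3)[OF m])
    then show "eq_C0 u (f m)" unfolding eq_C0_def f_def using apply_u clip(2) by metis
  qed
  have rate: "\<bar>max_norm (\<lambda>x. fstar x - f m x)\<bar> \<le> 2 / c * (C * Mu) * \<bar>1 / real m ^ r\<bar>" if m: "m \<ge> m0" for m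
  proof -
    have bd: "\<bar>fstar x - f m x\<bar> \<le> norm (F m - F0)" if "x \<in> {-1..1}" for x
      using norm_bounded[of "F m - F0" x] clip(2)[OF that] by (simp add: apply_F0 f_def abs_minus_commute)
    have "0 \<le> \<bar>fstar 0 - f m 0\<bar>" by simp
    also have "\<dots> \<le> max_norm (\<lambda>x. fstar x - f m x)"
      by (rule max_norm_ge) (use fcont in \<open>auto simp: f_def intro: continuous_on_diff\<close>)
    finally have "\<bar>max_norm (\<lambda>x. fstar x - f m x)\<bar> = max_norm (\<lambda>x. fstar x - f m x)" by simp
    also have "\<dots> \<le> norm (F m - F0)" by (rule max_norm_le[OF bd])
    also have "\<dots> \<le> 2 / c * norm (F0 - G m F0)" by (rule F(4)[OF m])
    also have "\<dots> \<le> 2 / c * (C * Mu / real m ^ r)"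
      by (rule mult_left_mono[OF start]) (use m c in \<open>auto simp: m0_def\<close>)
    finally show ?thesis by simp
  qed
  have "(\<lambda>m. max_norm (\<lambda>x. fstar x - f m x)) \<in> O(\<lambda>m. 1 / real m ^ r)"
    by (rule bigoI[of _ "2 / c * (C * Mu)"]) (use rate in \<open>auto simp: eventually_sequentially\<close>)
  with \<epsilon> fixed show ?thesis by blast
qed

end
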